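(* Let $E$ be a Banach lattice with the $\sigma$-interpolation property and assume that $E^*$ has order continuous norm. Suppose $u_0\in E^+$ and $\mathcal G$ is a collection of positive linear operators on $E$ such that the adjoint $T^*$ is a lattice homomorphism for each $T\in\mathcal G$, and such that: (a) for every $x\in E^+$ there exists $T\in\mathcal G$ with $x\le\|x\|_E\,Tu_0$; (b) for every disjoint sequence $(x_n)_{n\ge1}$ in $[0,u_0]$ and every sequence $(T_n)_{n\ge1}$ in $\mathcal G$ there exists $v\in E^+$ with $T_nx_n\le v$ for all $n$. Then $E$ is a Grothendieck space.
   Context: A Banach space $X$ is a Grothendieck space if every weak-$*$ convergent sequence in $X^*$ is weakly convergent (i.e. $\sigma(X^*,X)$-convergent sequences are $\sigma(X^*,X^{**})$-convergent). A Banach lattice $E$ has the $\sigma$-interpolation property if for any sequences $(x_n),(y_n)$ in $E$ with $x_n\le x_{n+1}\le y_{n+1}\le y_n$ for all $n$ there exists $z\in E$ with $x_n\le z\le y_n$ for all $n$. *)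

theory Defs
  imports "HOL-Analysis.Analysis"
begin

text \<open>Banach lattices: the ambient type carries a lattice order compatible with the
  additive group structure (class ordered_ab_group_add + lattice) and a complete norm
  (class banach); we additionally require compatibility with scalar multiplication
  and monotonicity of the norm with respect to the modulus.\<close>

definition labs :: "'a::{lattice, ab_group_add} \<Rightarrow> 'a" where
  "labs x = sup x (- x)"

definition banach_lattice :: "'a::{banach, lattice, ordered_ab_group_add} itself \<Rightarrow> bool" where
  "banach_lattice _ \<longleftrightarrow>
     (\<forall>(x::'a) c. 0 \<le> x \<longrightarrow> 0 \<le> c \<longrightarrow> 0 \<le> c *\<^sub>R x) \<and>
     (\<forall>x y::'a. labs x \<le> labs y \<longrightarrow> norm x \<le> norm y)"

definition sigma_interpolation :: "'a::order itself \<Rightarrow> bool" where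
  "sigma_interpolation _ \<longleftrightarrow>
     (\<forall>(x::nat \<Rightarrow> 'a) y. (\<forall>n. x n \<le> x (Suc n) \<and> x (Suc n) \<le> y (Suc n) \<and> y (Suc n) \<le> y n)
        \<longrightarrow> (\<exists>z. \<forall>n. x n \<le> z \<and> z \<le> y n))"

definition dual_le :: "('a::{real_normed_vector, order} \<Rightarrow>\<^sub>L real) \<Rightarrow> ('a \<Rightarrow>\<^sub>L real) \<Rightarrow> bool" where
  "dual_le f g \<longleftrightarrow> (\<forall>x. 0 \<le> x \<longrightarrow> blinfun_apply f x \<le> blinfun_apply g x)"

definition is_sup2 :: "('b \<Rightarrow> 'b \<Rightarrow> bool) \<Rightarrow> 'b \<Rightarrow> 'b \<Rightarrow> 'b \<Rightarrow> bool" where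
  "is_sup2 le x y z \<longleftrightarrow> le x z \<and> le y z \<and> (\<forall>w. le x w \<and> le y w \<longrightarrow> le z w)"

definition rsup :: "('b \<Rightarrow> 'b \<Rightarrow> bool) \<Rightarrow> 'b \<Rightarrow> 'b \<Rightarrow> 'b" where
  "rsup le x y = (THE z. is_sup2 le x y z)"

definition is_glb :: "('b \<Rightarrow> 'b \<Rightarrow> bool) \<Rightarrow> 'b set \<Rightarrow> 'b \<Rightarrow> bool" where
  "is_glb le D z \<longleftrightarrow> (\<forall>d\<in>D. le z d) \<and> (\<forall>w. (\<forall>d\<in>D. le w d) \<longrightarrow> le w z)"

definition downward_directed :: "('b \<Rightarrow> 'b \<Rightarrow> bool) \<Rightarrow> 'b set \<Rightarrow> bool" where
  "downward_directed le D \<longleftrightarrow> D \<noteq> {} \<and> (\<forall>a\<in>D. \<forall>b\<in>D. \<exists>c\<in>D. le c a \<and> le c b)"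

text \<open>Order continuous norm: every downward directed set (net) decreasing to 0 has norms
  decreasing to 0 (for decreasing nets in a normed lattice the norm net is decreasing, so
  convergence to 0 means infimum 0).\<close>
definition order_continuous_norm :: "('b::real_normed_vector \<Rightarrow> 'b \<Rightarrow> bool) \<Rightarrow> bool" where
  "order_continuous_norm le \<longleftrightarrow>
     (\<forall>D. downward_directed le D \<and> is_glb le D 0 \<longrightarrow> (INF d\<in>D. norm d) = 0)"

definition adjoint_op :: "('a::real_normed_vector \<Rightarrow>\<^sub>L 'a) \<Rightarrow> ('a \<Rightarrow>\<^sub>L real) \<Rightarrow> ('a \<Rightarrow>\<^sub>L real)" where
  "adjoint_op T f = f o\<^sub>L T"

definition lattice_hom :: "('b \<Rightarrow> 'b \<Rightarrow> bool) \<Rightarrow> ('b \<Rightarrow> 'b) \<Rightarrow> bool" where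
  "lattice_hom le h \<longleftrightarrow> (\<forall>x y. h (rsup le x y) = rsup le (h x) (h y))"

definition positive_op :: "('a::{real_normed_vector, order} \<Rightarrow>\<^sub>L 'a) \<Rightarrow> bool" where
  "positive_op T \<longleftrightarrow> (\<forall>x. 0 \<le> x \<longrightarrow> 0 \<le> blinfun_apply T x)"

definition grothendieck :: "'a::real_normed_vector itself \<Rightarrow> bool" where
  "grothendieck _ \<longleftrightarrow>
     (\<forall>(fs :: nat \<Rightarrow> ('a \<Rightarrow>\<^sub>L real)) f.
        (\<forall>x. (\<lambda>n. blinfun_apply (fs n) x) \<longlonglongrightarrow> blinfun_apply f x) \<longrightarrow>
        (\<forall>\<phi> :: ('a \<Rightarrow>\<^sub>L real) \<Rightarrow>\<^sub>L real. (\<lambda>n. blinfun_apply \<phi> (fs n)) \<longlonglongrightarrow> blinfun_apply \<phi> f))"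

end

theory Submission
  imports Defs "HOL-Library.Lattice_Algebras"
begin

text \<open>Let \<open>f\<^sub>n \<rightarrow> 0\<close> weak* and \<open>e = \<Sum> 2\<^sup>-\<^sup>n |f\<^sub>n|\<close>. If for every positive \<open>\<phi>\<close> in the bidual the quantities
  \<open>\<phi> ((|f\<^sub>n| - K e)\<^sup>+)\<close> tend to 0 uniformly in \<open>n\<close> as \<open>K \<rightarrow> \<infinity>\<close>, then order continuity of the dual norm
  allows \<open>\<phi>\<close> to be approximated by elements of \<open>E\<close> and \<open>f\<^sub>n \<rightarrow> 0\<close> weakly.

  Otherwise there are pairwise disjoint \<open>0 \<le> u\<^sub>j \<le> |f\<^sub>n\<^sub>j|\<close> with \<open>\<phi> u\<^sub>j \<ge> \<epsilon>\<close>. By Goldstine's theorem and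
  condition (a), for every \<open>N\<close> some \<open>T\<^sub>N\<close> satisfies \<open>u\<^sub>j (T\<^sub>N u\<^sub>0) \<ge> \<delta>\<close> for all \<open>j < N\<close>; the functionals
  \<open>T\<^sub>N\<^sup>* u\<^sub>j\<close>, \<open>j < N\<close>, are disjoint, so a diagonal selection yields disjoint \<open>y\<^sub>k\<close> in \<open>[0, u\<^sub>0]\<close> on which they
  stay large. Condition (b) gives one \<open>v\<close> on which infinitely many \<open>u\<^sub>j\<close> are large, and a second selection
  below \<open>v\<close> gives disjoint \<open>z\<^sub>k \<le> v\<close> with \<open>|f\<^sub>n\<^sub>k| z\<^sub>k\<close> bounded away from 0. By interpolation and Rosenthal's
  disjointification argument this is impossible for a weak* null sequence.\<close>

section \<open>Cones with the Riesz decomposition property\<close>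

text \<open>The dual and the bidual carry their order only as a relation, so lattice arguments are
  run over a cone with Riesz decomposition. The dual cone is again of this kind, so one set of
  proofs serves both levels. The obstacle in the disjoint case is that Goldstine's theorem treats
  finitely many functionals at a time. The operator \<open>T N\<close> changes with
  \<open>N\<close>, and the adjoint images of the \<open>u j\<close> form a triangular array in
  which disjointness holds only within a row. The selection must move across rows; condition (b)
  fits because it allows a different operator for every term. The images
  \<open>T (N k) (y k)\<close> need not be disjoint, so (b) is used only for the bound
  \<open>v\<close>, and disjoint elements have to be chosen afresh below \<open>v\<close>. The
  weights in \<open>e\<close> put every modulus in the sequence below a multiple of one functional,
  so that questions about the sequence reduce to the interval from 0 to \<open>e\<close>.\<close>

locale riesz_cone =
  fixes P :: "'v::real_normed_vector set"
  assumes zero: "0 \<in> P"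
    and add: "\<And>a b. a \<in> P \<Longrightarrow> b \<in> P \<Longrightarrow> a + b \<in> P"
    and scale: "\<And>a c. a \<in> P \<Longrightarrow> 0 \<le> c \<Longrightarrow> c *\<^sub>R a \<in> P"
    and decomp: "\<And>a b c. a \<in> P \<Longrightarrow> b \<in> P \<Longrightarrow> c \<in> P \<Longrightarrow> a + b - c \<in> P \<Longrightarrow>
      \<exists>c1 c2. c = c1 + c2 \<and> c1 \<in> P \<and> c2 \<in> P \<and> a - c1 \<in> P \<and> b - c2 \<in> P"
    and gen: "\<And>v. \<exists>a b. a \<in> P \<and> b \<in> P \<and> v = a - b \<and> norm a \<le> norm v \<and> norm b \<le> norm v"
    and norm_mono: "\<And>a b. a \<in> P \<Longrightarrow> b - a \<in> P \<Longrightarrow> norm a \<le> norm b"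
begin

section \<open>Functionals built from their values on the cone\<close>

lemma blinfun_eqI_cone:
  fixes f g :: "'v \<Rightarrow>\<^sub>L real"
  assumes "\<And>a. a \<in> P \<Longrightarrow> f a = g a"
  shows "f = g"
proof (rule blinfun_eqI)
  fix v
  obtain a b where "a \<in> P" "b \<in> P" "v = a - b"
    using gen by blast
  then show "f v = g v"
    using assms by (simp add: blinfun.bilinear_simps)
qed

text \<open>Put \<open>q (a - b) = p a - p b\<close>; additivity of \<open>p\<close> makes this
  independent of the chosen difference. The two suprema below are built on the cone and extended by
  this lemma.\<close>

lemma cone_extension:
  fixes p :: "'v \<Rightarrow> real"
  assumes p_add: "\<And>a b. a \<in> P \<Longrightarrow> b \<in> P \<Longrightarrow> p (a + b) = p a + p b"
    and p_scale: "\<And>a c. a \<in> P \<Longrightarrow> 0 \<le> c \<Longrightarrow> p (c *\<^sub>R a) = c * p a"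
    and p_bound: "\<And>a. a \<in> P \<Longrightarrow> \<bar>p a\<bar> \<le> C * norm a"
  shows "\<exists>\<psi>::'v \<Rightarrow>\<^sub>L real. \<forall>a\<in>P. \<psi> a = p a"
proof -
  obtain A B where AB: "\<And>v. A v \<in> P" "\<And>v. B v \<in> P" "\<And>v. v = A v - B v"
      "\<And>v. norm (A v) \<le> norm v" "\<And>v. norm (B v) \<le> norm v"
    using gen by metis
  define q where "q v = p (A v) - p (B v)" for v
  have q: "q (a - b) = p a - p b" if "a \<in> P" "b \<in> P" for a b
  proof -
    have "A (a - b) + b = a + B (a - b)"
      using AB(3)[of "a - b"] by (simp add: algebra_simps)
    then have "p (A (a - b)) + p b = p a + p (B (a - b))"
      using p_add that AB(1,2) by metis
    then show ?thesis by (simp add: q_def)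
  qed
  have qP: "q a = p a" if "a \<in> P" for a
    using q[OF that zero] p_scale[OF zero, of 0] by simp
  have q_add: "q (v + w) = q v + q w" for v w
  proof -
    have "v + w = (A v + A w) - (B v + B w)"
      using AB(3)[of v] AB(3)[of w] by (simp add: algebra_simps)
    then have "q (v + w) = p (A v + A w) - p (B v + B w)"
      using q[of "A v + A w" "B v + B w"] AB(1,2) add by simp
    then show ?thesis using AB(1,2) p_add by (simp add: q_def)
  qed
  have q_pos: "q (c *\<^sub>R v) = c * q v" if "0 \<le> c" for c v
  proof -
    have "c *\<^sub>R v = c *\<^sub>R A v - c *\<^sub>R B v"
      using AB(3)[of v] by (metis scaleR_right_diff_distrib)
    then have "q (c *\<^sub>R v) = p (c *\<^sub>R A v) - p (c *\<^sub>R B v)"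
      using q[of "c *\<^sub>R A v" "c *\<^sub>R B v"] AB(1,2) scale that by simp
    then show ?thesis using AB(1,2) p_scale that by (simp add: q_def algebra_simps)
  qed
  have q_minus: "q (- v) = - q v" for v
    using q_add[of v "- v"] q_pos[of 0 0] by simp
  have q_scale: "q (c *\<^sub>R v) = c * q v" for c v
    using q_pos[of c v] q_pos[of "- c" v] q_minus[of "c *\<^sub>R v"] by (cases "0 \<le> c") auto
  have C: "\<bar>q v\<bar> \<le> norm v * (2 * \<bar>C\<bar>)" for v
  proof -
    have "\<bar>p (A v)\<bar> \<le> \<bar>C\<bar> * norm v" "\<bar>p (B v)\<bar> \<le> \<bar>C\<bar> * norm v"
      using p_bound[OF AB(1)[of v]] p_bound[OF AB(2)[of v]] AB(4,5)[of v]
      by (smt (verit) mult_left_mono mult_right_mono norm_ge_zero abs_ge_self abs_ge_zero)+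
    then show ?thesis by (simp add: q_def algebra_simps)
  qed
  have "bounded_linear q"
    by (rule bounded_linear_intro[where K = "2 * \<bar>C\<bar>"]) (use q_add q_scale C in auto)
  then show ?thesis
    using qP bounded_linear_Blinfun_apply by metis
qed

text \<open>A Riesz-Kantorovich formula: \<open>\<psi> a\<close> is the supremum of
  \<open>\<phi> b\<close> over \<open>b\<close> in \<open>I\<close> below \<open>a\<close>, additive
  because decomposition and heredity of \<open>I\<close> split every competitor for a sum. With
  \<open>I = P\<close> it yields the positive part of \<open>\<phi>\<close>; a smaller ideal yields
  the part of it carried by \<open>I\<close>.\<close>

lemma ideal_sup:
  fixes \<phi> :: "'v \<Rightarrow>\<^sub>L real"
  assumes IP: "I \<subseteq> P" and I0: "0 \<in> I"
    and I_add: "\<And>a b. a \<in> I \<Longrightarrow> b \<in> I \<Longrightarrow> a + b \<in> I"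
    and I_scale: "\<And>a c. a \<in> I \<Longrightarrow> 0 \<le> c \<Longrightarrow> c *\<^sub>R a \<in> I"
    and I_hered: "\<And>a b. a \<in> I \<Longrightarrow> b \<in> P \<Longrightarrow> a - b \<in> P \<Longrightarrow> b \<in> I"
  shows "\<exists>\<psi>::'v \<Rightarrow>\<^sub>L real. \<forall>a\<in>P. (\<forall>b\<in>I. a - b \<in> P \<longrightarrow> \<phi> b \<le> \<psi> a) \<and>
     (\<forall>\<eta>>0. \<exists>b\<in>I. a - b \<in> P \<and> \<psi> a - \<eta> < \<phi> b)"
proof -
  define S where "S a = {\<phi> b |b. b \<in> I \<and> a - b \<in> P}" for a
  define p where "p a = Sup (S a)" for a
  have S_ne: "S a \<noteq> {}" if "a \<in> P" for a
    using that I0 by (force simp: S_def)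
  have S_le: "s \<le> norm \<phi> * norm a" if s: "s \<in> S a" for s a
  proof -
    obtain b where b: "b \<in> I" "a - b \<in> P" "s = \<phi> b" using s by (auto simp: S_def)
    have "\<phi> b \<le> norm \<phi> * norm b" using norm_blinfun[of \<phi> b] by simp
    also have "\<dots> \<le> norm \<phi> * norm a"
      using norm_mono[of b a] b IP by (intro mult_left_mono) auto
    finally show ?thesis using b by simp
  qed
  have S_bdd: "bdd_above (S a)" for a
    using S_le by (auto simp: bdd_above_def)
  have p_ge: "\<phi> b \<le> p a" if "b \<in> I" "a - b \<in> P" for a b
    unfolding p_def by (rule cSup_upper[OF _ S_bdd]) (use that in \<open>auto simp: S_def\<close>)
  have p_approx: "\<exists>b\<in>I. a - b \<in> P \<and> p a - \<eta> < \<phi> b" if "a \<in> P" "0 < \<eta>" for a \<eta>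
    using less_cSupD[OF S_ne[OF that(1)], of "p a - \<eta>"] that(2) unfolding p_def by (auto simp: S_def)
  have p_le: "p a \<le> u" if "a \<in> P" "\<And>b. b \<in> I \<Longrightarrow> a - b \<in> P \<Longrightarrow> \<phi> b \<le> u" for a u
    unfolding p_def by (rule cSup_least[OF S_ne[OF that(1)]]) (use that in \<open>auto simp: S_def\<close>)
  have "\<exists>\<psi>::'v \<Rightarrow>\<^sub>L real. \<forall>a\<in>P. \<psi> a = p a"
  proof (rule cone_extension)
    fix a b assume ab: "a \<in> P" "b \<in> P"
    show "p (a + b) = p a + p b"
    proof (rule antisym)
      show "p (a + b) \<le> p a + p b"
      proof (rule p_le[OF add[OF ab]])
        fix c assume c: "c \<in> I" "a + b - c \<in> P"
        then obtain c1 c2 where cc: "c = c1 + c2" "c1 \<in> P" "c2 \<in> P" "a - c1 \<in> P" "b - c2 \<in> P"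
          using decomp[OF ab, of c] IP by auto
        have "c1 \<in> I" "c2 \<in> I"
          using I_hered[OF c(1)] cc by auto
        then show "\<phi> c \<le> p a + p b"
          using p_ge[of c1 a] p_ge[of c2 b] cc by (simp add: blinfun.bilinear_simps)
      qed
      show "p a + p b \<le> p (a + b)"
      proof (rule field_le_epsilon)
        fix \<eta> :: real assume "0 < \<eta>"
        then obtain c1 c2 where c: "c1 \<in> I" "a - c1 \<in> P" "p a - \<eta>/2 < \<phi> c1"
            "c2 \<in> I" "b - c2 \<in> P" "p b - \<eta>/2 < \<phi> c2"
          using p_approx[OF ab(1), of "\<eta>/2"] p_approx[OF ab(2), of "\<eta>/2"] by auto
        have "a + b - (c1 + c2) \<in> P"
          using add[OF c(2,5)] by (simp add: algebra_simps)
        from p_ge[OF I_add[OF c(1,4)] this] c(3,6)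
        show "p a + p b \<le> p (a + b) + \<eta>"
          by (simp add: blinfun.bilinear_simps)
      qed
    qed
  next
    have le: "c * p a \<le> p (c *\<^sub>R a)" if a: "a \<in> P" "0 \<le> c" for a c
    proof (cases "c = 0")
      case True
      then show ?thesis using p_ge[OF I0, of 0] zero by (simp add: blinfun.bilinear_simps)
    next
      case False
      then have c: "c > 0" using a by simp
      have "p a \<le> p (c *\<^sub>R a) / c"
      proof (rule p_le[OF a(1)])
        fix b assume b: "b \<in> I" "a - b \<in> P"
        have "c *\<^sub>R a - c *\<^sub>R b \<in> P"
          using scale[OF b(2) a(2)] by (simp add: scaleR_right_diff_distrib)
        from p_ge[OF I_scale[OF b(1) a(2)] this] c show "\<phi> b \<le> p (c *\<^sub>R a) / c"
          by (simp add: blinfun.bilinear_simps field_simps)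
      qed
      then show ?thesis using c by (simp add: field_simps)
    qed
    fix a :: 'v and c :: real assume a: "a \<in> P" "0 \<le> c"
    show "p (c *\<^sub>R a) = c * p a"
    proof (cases "c = 0")
      case True
      have "p 0 \<le> 0"
      proof (rule p_le[OF zero])
        fix b assume b: "b \<in> I" "0 - b \<in> P"
        then have "norm b \<le> 0" using norm_mono[of b 0] IP by auto
        then show "\<phi> b \<le> 0" by (simp add: blinfun.bilinear_simps)
      qed
      then show ?thesis using True le[OF a] by simp
    next
      case False
      then have c: "c > 0" using a by simp
      show ?thesis
        using le[OF a] le[OF scale[OF a], of "1/c"] c by (simp add: field_simps)
    qed
  next
    fix a assume a: "a \<in> P"
    have "p a \<le> norm \<phi> * norm a"
      by (rule p_le[OF a]) (use S_le in \<open>auto simp: S_def\<close>)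
    moreover have "0 \<le> p a"
      using p_ge[OF I0, of a] a by (simp add: blinfun.bilinear_simps)
    ultimately show "\<bar>p a\<bar> \<le> norm \<phi> * norm a" by simp
  qed
  then show ?thesis using p_ge p_approx by metis
qed

text \<open>The supremum may be taken pointwise: directedness supplies one member that is nearly
  optimal at \<open>a\<close> and at \<open>b\<close> at once, hence at \<open>a + b\<close>. The
  bound \<open>h\<close> keeps it finite.\<close>

lemma directed_sup:
  fixes D :: "('v \<Rightarrow>\<^sub>L real) set"
  assumes ne: "D \<noteq> {}"
    and dir: "\<And>d d'. d \<in> D \<Longrightarrow> d' \<in> D \<Longrightarrow> \<exists>e\<in>D. \<forall>a\<in>P. d a \<le> e a \<and> d' a \<le> e a"
    and bdd: "\<And>d a. d \<in> D \<Longrightarrow> a \<in> P \<Longrightarrow> d a \<le> (h :: 'v \<Rightarrow>\<^sub>L real) a"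
  shows "\<exists>\<psi>::'v \<Rightarrow>\<^sub>L real. \<forall>a\<in>P. (\<forall>d\<in>D. d a \<le> \<psi> a) \<and> (\<forall>\<eta>>0. \<exists>d\<in>D. \<psi> a - \<eta> < d a)"
proof -
  define p where "p a = (SUP d\<in>D. blinfun_apply d a)" for a
  obtain d where d: "d \<in> D" using ne by auto
  have bd: "bdd_above ((\<lambda>d. blinfun_apply d a) ` D)" if "a \<in> P" for a
    using bdd that by (auto simp: bdd_above_def)
  have p_ge: "d a \<le> p a" if "d \<in> D" "a \<in> P" for d a
    unfolding p_def using bd that by (auto intro: cSUP_upper)
  have p_le: "p a \<le> u" if "a \<in> P" "\<And>d. d \<in> D \<Longrightarrow> d a \<le> u" for a u
    unfolding p_def using ne that by (auto intro: cSUP_least)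
  have p_approx: "\<exists>d\<in>D. p a - \<eta> < d a" if "a \<in> P" "0 < \<eta>" for a \<eta>
    using p_le[OF that(1), of "p a - \<eta>"] that(2) by fastforce
  have "\<exists>\<psi>::'v \<Rightarrow>\<^sub>L real. \<forall>a\<in>P. \<psi> a = p a"
  proof (rule cone_extension)
    fix a b assume ab: "a \<in> P" "b \<in> P"
    show "p (a + b) = p a + p b"
    proof (rule antisym)
      show "p (a + b) \<le> p a + p b"
        by (rule p_le[OF add[OF ab]])
          (use p_ge ab in \<open>auto simp: blinfun.bilinear_simps intro: add_mono\<close>)
      show "p a + p b \<le> p (a + b)"
      proof (rule field_le_epsilon)
        fix \<eta> :: real assume "0 < \<eta>"
        then obtain d d' where d: "d \<in> D" "p a - \<eta>/2 < d a" "d' \<in> D" "p b - \<eta>/2 < d' b"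
          using p_approx[OF ab(1), of "\<eta>/2"] p_approx[OF ab(2), of "\<eta>/2"] by auto
        obtain e where e: "e \<in> D" "\<forall>a\<in>P. d a \<le> e a \<and> d' a \<le> e a"
          using dir[OF d(1,3)] by auto
        then have "p a - \<eta>/2 < e a" "p b - \<eta>/2 < e b"
          using d ab by force+
        then show "p a + p b \<le> p (a + b) + \<eta>"
          using p_ge[OF e(1) add[OF ab]] by (simp add: blinfun.bilinear_simps)
      qed
    qed
  next
    have le: "p (c *\<^sub>R a) \<le> c * p a" if "a \<in> P" "0 \<le> c" for a c
      by (rule p_le[OF scale[OF that]])
        (use p_ge that in \<open>auto simp: blinfun.bilinear_simps intro: mult_left_mono\<close>)
    fix a :: 'v and c :: real assume a: "a \<in> P" "0 \<le> c"
    show "p (c *\<^sub>R a) = c * p a"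
    proof (cases "c = 0")
      case True
      then show ?thesis using ne by (simp add: p_def blinfun.bilinear_simps)
    next
      case False
      then have c: "c > 0" using a by simp
      show ?thesis
        using le[OF a] le[OF scale[OF a], of "1/c"] c by (simp add: field_simps)
    qed
  next
    fix a assume a: "a \<in> P"
    have "p a \<le> h a" "d a \<le> p a"
      using p_le[OF a] bdd a p_ge d by auto
    moreover have "\<bar>h a\<bar> \<le> norm h * norm a" "\<bar>d a\<bar> \<le> norm d * norm a"
      using norm_blinfun[of h a] norm_blinfun[of d a] by auto
    ultimately show "\<bar>p a\<bar> \<le> (norm h + norm d) * norm a"
      by (simp add: algebra_simps abs_le_iff)
  qed
  then show ?thesis using p_ge p_approx by metis
qed

text \<open>The positive part of \<open>\<phi>\<close> in the dual order, that is, the functional of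
  \<open>ideal_sup\<close> for the ideal \<open>P\<close> itself.\<close>

definition pp :: "('v \<Rightarrow>\<^sub>L real) \<Rightarrow> ('v \<Rightarrow>\<^sub>L real)" where
  "pp \<phi> = (SOME \<psi>. \<forall>a\<in>P. (\<forall>b\<in>P. a - b \<in> P \<longrightarrow> blinfun_apply \<phi> b \<le> blinfun_apply \<psi> a) \<and>
     (\<forall>\<eta>>0. \<exists>b\<in>P. a - b \<in> P \<and> blinfun_apply \<psi> a - \<eta> < blinfun_apply \<phi> b))"

lemma pp_spec:
  fixes \<phi> :: "'v \<Rightarrow>\<^sub>L real"
  assumes "a \<in> P"
  shows "\<And>b. b \<in> P \<Longrightarrow> a - b \<in> P \<Longrightarrow> \<phi> b \<le> pp \<phi> a"
    and "\<And>\<eta>. 0 < \<eta> \<Longrightarrow> \<exists>b\<in>P. a - b \<in> P \<and> pp \<phi> a - \<eta> < \<phi> b"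
proof -
  have "\<forall>a\<in>P. (\<forall>b\<in>P. a - b \<in> P \<longrightarrow> \<phi> b \<le> pp \<phi> a) \<and>
     (\<forall>\<eta>>0. \<exists>b\<in>P. a - b \<in> P \<and> pp \<phi> a - \<eta> < \<phi> b)"
    unfolding pp_def by (rule someI_ex, rule ideal_sup) (use zero add scale in auto)
  then show "\<And>b. b \<in> P \<Longrightarrow> a - b \<in> P \<Longrightarrow> \<phi> b \<le> pp \<phi> a"
    and "\<And>\<eta>. 0 < \<eta> \<Longrightarrow> \<exists>b\<in>P. a - b \<in> P \<and> pp \<phi> a - \<eta> < \<phi> b"
    using assms by auto
qed

section \<open>Lattice operations and disjointness in the dual of a cone\<close>

lemma pp_nonneg:
  fixes \<phi> :: "'v \<Rightarrow>\<^sub>L real"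
  shows "a \<in> P \<Longrightarrow> 0 \<le> pp \<phi> a"
  using pp_spec(1)[of a 0 \<phi>] zero by (simp add: blinfun.bilinear_simps)

lemma pp_ge:
  fixes \<phi> :: "'v \<Rightarrow>\<^sub>L real"
  shows "a \<in> P \<Longrightarrow> \<phi> a \<le> pp \<phi> a"
  using pp_spec(1)[of a a \<phi>] zero by simp

lemma cone_mono:
  fixes \<psi> :: "'v \<Rightarrow>\<^sub>L real"
  assumes "\<And>a. a \<in> P \<Longrightarrow> 0 \<le> \<psi> a" "b - a \<in> P"
  shows "\<psi> a \<le> \<psi> b"
  using assms(1)[OF assms(2)] by (simp add: blinfun.bilinear_simps)

lemma pp_least:
  fixes \<phi> \<psi> :: "'v \<Rightarrow>\<^sub>L real"
  assumes "\<And>a. a \<in> P \<Longrightarrow> 0 \<le> \<psi> a" "\<And>a. a \<in> P \<Longrightarrow> \<phi> a \<le> \<psi> a" "a \<in> P"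
  shows "pp \<phi> a \<le> \<psi> a"
proof (rule field_le_epsilon)
  fix \<eta> :: real assume "0 < \<eta>"
  then obtain b where "b \<in> P" "a - b \<in> P" "pp \<phi> a - \<eta> < \<phi> b"
    using pp_spec(2)[OF assms(3)] by blast
  then show "pp \<phi> a \<le> \<psi> a + \<eta>"
    using assms(2)[of b] cone_mono[OF assms(1), of a b] by simp
qed

text \<open>Minimality of the positive part, used twice: \<open>pp \<phi> - \<phi>\<close> majorises
  \<open>- \<phi>\<close> and 0, and \<open>pp (- \<phi>) + \<phi>\<close> majorises
  \<open>\<phi>\<close> and 0.\<close>

lemma pp_uminus: "pp (- \<phi>) = pp \<phi> - \<phi>"
proof (rule blinfun_eqI_cone)
  fix a assume a: "a \<in> P"
  have "pp (- \<phi>) a \<le> (pp \<phi> - \<phi>) a"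
    by (rule pp_least[OF _ _ a]) (simp_all add: blinfun.bilinear_simps pp_ge pp_nonneg)
  moreover have "pp \<phi> a \<le> (pp (- \<phi>) + \<phi>) a"
    by (rule pp_least[OF _ _ a])
      (use pp_ge[of _ "- \<phi>"] in \<open>force simp: blinfun.bilinear_simps pp_nonneg\<close>)+
  ultimately show "pp (- \<phi>) a = (pp \<phi> - \<phi>) a"
    by (simp add: blinfun.bilinear_simps)
qed

lemma norm_pp: "norm (pp \<phi>) \<le> norm \<phi>"
proof (rule norm_blinfun_bound)
  fix v
  obtain a b where ab: "a \<in> P" "b \<in> P" "v = a - b" "norm a \<le> norm v" "norm b \<le> norm v"
    using gen by blast
  have le: "pp \<phi> c \<le> norm \<phi> * norm v" if c: "c \<in> P" "norm c \<le> norm v" for c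
  proof (rule field_le_epsilon)
    fix \<eta> :: real assume "0 < \<eta>"
    then obtain b where b: "b \<in> P" "c - b \<in> P" "pp \<phi> c - \<eta> < \<phi> b"
      using pp_spec(2)[OF c(1)] by blast
    have "\<phi> b \<le> norm \<phi> * norm b" using norm_blinfun[of \<phi> b] by simp
    also have "\<dots> \<le> norm \<phi> * norm v"
      using norm_mono[OF b(1,2)] c by (intro mult_left_mono) auto
    finally show "pp \<phi> c \<le> norm \<phi> * norm v + \<eta>" using b by simp
  qed
  \<comment> \<open>A difference of two numbers between 0 and \<open>norm \<phi> * norm v\<close>,
    so no factor 2 arises.\<close>
  show "norm (pp \<phi> v) \<le> norm \<phi> * norm v"
    using le[OF ab(1,4)] le[OF ab(2,5)] pp_nonneg[OF ab(1), of \<phi>] pp_nonneg[OF ab(2), of \<phi>] ab(3)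
    by (simp add: blinfun.bilinear_simps)
qed simp

text \<open>For positive functionals, the infimum of \<open>\<mu>\<close> and \<open>\<nu>\<close>
  at \<open>a\<close> is the infimum of these values over all \<open>b\<close> between 0 and
  \<open>a\<close>; the condition says that it is 0. This form is chosen because later constructions
  use the splitting element \<open>b\<close> itself.\<close>

definition disj :: "('v \<Rightarrow>\<^sub>L real) \<Rightarrow> ('v \<Rightarrow>\<^sub>L real) \<Rightarrow> bool" where
  "disj \<mu> \<nu> \<longleftrightarrow> (\<forall>a\<in>P. \<forall>\<eta>>0. \<exists>b\<in>P. a - b \<in> P \<and> blinfun_apply \<mu> (a - b) + blinfun_apply \<nu> b < \<eta>)"

lemma disj_commute: "disj \<mu> \<nu> \<Longrightarrow> disj \<nu> \<mu>"
  unfolding disj_def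
proof (intro ballI allI impI)
  fix a and \<eta> :: real
  assume H: "\<forall>a\<in>P. \<forall>\<eta>>0. \<exists>b\<in>P. a - b \<in> P \<and> \<mu> (a - b) + \<nu> b < \<eta>" and "a \<in> P" "0 < \<eta>"
  then obtain b where "b \<in> P" "a - b \<in> P" "\<mu> (a - b) + \<nu> b < \<eta>" by blast
  then show "\<exists>b\<in>P. a - b \<in> P \<and> \<nu> (a - b) + \<mu> b < \<eta>"
    by (intro bexI[of _ "a - b"]) auto
qed

text \<open>An almost optimal \<open>b\<close> in the supremum for \<open>pp \<phi> a\<close> works,
  since \<open>pp \<phi> (a - b) + pp (- \<phi>) b = pp \<phi> a - \<phi> b\<close>.\<close>

lemma disj_pp: "disj (pp \<phi>) (pp (- \<phi>))"
  unfolding disj_def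
proof (intro ballI allI impI)
  fix a and \<eta> :: real assume "a \<in> P" "0 < \<eta>"
  then obtain b where "b \<in> P" "a - b \<in> P" "pp \<phi> a - \<eta> < \<phi> b"
    using pp_spec(2) by blast
  then show "\<exists>b\<in>P. a - b \<in> P \<and> pp \<phi> (a - b) + pp (- \<phi>) b < \<eta>"
    by (auto simp: pp_uminus blinfun.bilinear_simps)
qed

lemma disj_mono:
  fixes \<mu> \<nu> \<mu>' \<nu>' :: "'v \<Rightarrow>\<^sub>L real"
  assumes "disj \<mu> \<nu>" "\<And>a. a \<in> P \<Longrightarrow> \<mu>' a \<le> \<mu> a" "\<And>a. a \<in> P \<Longrightarrow> \<nu>' a \<le> \<nu> a"
  shows "disj \<mu>' \<nu>'"
  using assms unfolding disj_def by (meson add_mono le_less_trans)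

text \<open>\<open>\<mu> - pp (\<mu> - \<nu>)\<close> is the infimum of \<open>\<mu>\<close> and
  \<open>\<nu>\<close>. Once it vanishes, \<open>\<mu>\<close> and \<open>\<nu>\<close> are the
  positive and the negative part of \<open>\<mu> - \<nu>\<close>.\<close>

lemma disjI:
  fixes \<mu> \<nu> :: "'v \<Rightarrow>\<^sub>L real"
  assumes pos: "\<And>a. a \<in> P \<Longrightarrow> 0 \<le> \<mu> a" "\<And>a. a \<in> P \<Longrightarrow> 0 \<le> \<nu> a"
    and inf0: "\<And>w::'v \<Rightarrow>\<^sub>L real. (\<And>a. a \<in> P \<Longrightarrow> 0 \<le> blinfun_apply w a) \<Longrightarrow>
      (\<And>a. a \<in> P \<Longrightarrow> blinfun_apply w a \<le> \<mu> a) \<Longrightarrow> (\<And>a. a \<in> P \<Longrightarrow> blinfun_apply w a \<le> \<nu> a) \<Longrightarrow> w = 0"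
  shows "disj \<mu> \<nu>"
proof -
  have "\<mu> - pp (\<mu> - \<nu>) = 0"
  proof (rule inf0)
    fix a assume a: "a \<in> P"
    have "pp (\<mu> - \<nu>) a \<le> \<mu> a"
      by (rule pp_least[OF _ _ a]) (use pos in \<open>auto simp: blinfun.bilinear_simps\<close>)
    then show "0 \<le> (\<mu> - pp (\<mu> - \<nu>)) a" by (simp add: blinfun.bilinear_simps)
    show "(\<mu> - pp (\<mu> - \<nu>)) a \<le> \<mu> a"
      using pp_nonneg[OF a] by (simp add: blinfun.bilinear_simps)
    show "(\<mu> - pp (\<mu> - \<nu>)) a \<le> \<nu> a"
      using pp_ge[OF a, of "\<mu> - \<nu>"] by (simp add: blinfun.bilinear_simps)
  qed
  then have "pp (\<mu> - \<nu>) = \<mu>" "pp (- (\<mu> - \<nu>)) = \<nu>"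
    using pp_uminus[of "\<mu> - \<nu>"] by simp_all
  then show ?thesis using disj_pp by metis
qed

lemma disj_inf_zero:
  fixes \<mu> \<nu> w :: "'v \<Rightarrow>\<^sub>L real"
  assumes "disj \<mu> \<nu>" and w: "\<And>a. a \<in> P \<Longrightarrow> 0 \<le> w a" "\<And>a. a \<in> P \<Longrightarrow> w a \<le> \<mu> a" "\<And>a. a \<in> P \<Longrightarrow> w a \<le> \<nu> a"
  shows "w = 0"
proof (rule blinfun_eqI_cone)
  fix a assume a: "a \<in> P"
  have "w a \<le> 0"
  proof (rule field_le_epsilon)
    fix \<eta> :: real assume "0 < \<eta>"
    then obtain b where "b \<in> P" "a - b \<in> P" "\<mu> (a - b) + \<nu> b < \<eta>"
      using assms(1) a unfolding disj_def by blast
    then show "w a \<le> 0 + \<eta>"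
      using w(2)[of "a - b"] w(3)[of b] by (simp add: blinfun.diff_right)
  qed
  then show "w a = (0 :: 'v \<Rightarrow>\<^sub>L real) a" using w(1)[OF a] by simp
qed

text \<open>Makes the locale iterable: what holds for functionals on \<open>P\<close> then holds for
  functionals on the dual cone.\<close>

lemma dual_cone: "riesz_cone {f::'v \<Rightarrow>\<^sub>L real. \<forall>a\<in>P. 0 \<le> blinfun_apply f a}"
proof
  fix f :: "'v \<Rightarrow>\<^sub>L real"
  show "\<exists>a b. a \<in> {f. \<forall>a\<in>P. 0 \<le> blinfun_apply f a} \<and> b \<in> {f. \<forall>a\<in>P. 0 \<le> blinfun_apply f a} \<and> f = a - b \<and>
      norm a \<le> norm f \<and> norm b \<le> norm f"
    by (rule exI[of _ "pp f"], rule exI[of _ "pp (- f)"])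
      (use norm_pp[of f] norm_pp[of "- f"] pp_uminus[of f] in \<open>auto simp: pp_nonneg pp_ge blinfun.bilinear_simps\<close>)
next
  fix f g h :: "'v \<Rightarrow>\<^sub>L real"
  assume f: "f \<in> {f. \<forall>a\<in>P. 0 \<le> blinfun_apply f a}" and g: "g \<in> {f. \<forall>a\<in>P. 0 \<le> blinfun_apply f a}" and h: "h \<in> {f. \<forall>a\<in>P. 0 \<le> blinfun_apply f a}"
    and le: "f + g - h \<in> {f. \<forall>a\<in>P. 0 \<le> blinfun_apply f a}"
  have 1: "pp (h - f) a \<le> h a" if "a \<in> P" for a
    by (rule pp_least[OF _ _ that]) (use f h in \<open>auto simp: blinfun.bilinear_simps\<close>)
  have 2: "pp (h - f) a \<le> g a" if "a \<in> P" for a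
    by (rule pp_least[OF _ _ that]) (use g le in \<open>force simp: blinfun.bilinear_simps\<close>)+
  show "\<exists>c1 c2. h = c1 + c2 \<and> c1 \<in> {f. \<forall>a\<in>P. 0 \<le> blinfun_apply f a} \<and> c2 \<in> {f. \<forall>a\<in>P. 0 \<le> blinfun_apply f a} \<and>
      f - c1 \<in> {f. \<forall>a\<in>P. 0 \<le> blinfun_apply f a} \<and> g - c2 \<in> {f. \<forall>a\<in>P. 0 \<le> blinfun_apply f a}"
    \<comment> \<open>The first piece is the infimum of \<open>h\<close> and \<open>f\<close>, the
      largest part of \<open>h\<close> that fits under \<open>f\<close>.\<close>
    by (rule exI[of _ "h - pp (h - f)"], rule exI[of _ "pp (h - f)"])
      (use 1 2 pp_ge[of _ "h - f"] in \<open>auto simp: blinfun.bilinear_simps pp_nonneg algebra_simps\<close>)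
next
  fix f g :: "'v \<Rightarrow>\<^sub>L real"
  assume f: "f \<in> {f. \<forall>a\<in>P. 0 \<le> blinfun_apply f a}" and g: "g - f \<in> {f. \<forall>a\<in>P. 0 \<le> blinfun_apply f a}"
  show "norm f \<le> norm g"
  proof (rule norm_blinfun_bound)
    fix v
    obtain a b where ab: "a \<in> P" "b \<in> P" "v = a - b" "norm a \<le> norm v" "norm b \<le> norm v"
      using gen by blast
    have le: "0 \<le> f c \<and> f c \<le> norm g * norm v" if c: "c \<in> P" "norm c \<le> norm v" for c
    proof -
      have "f c \<le> g c" using g c by (auto simp: blinfun.bilinear_simps)
      also have "g c \<le> norm g * norm c" using norm_blinfun[of g c] by simp
      also have "\<dots> \<le> norm g * norm v" using c by (intro mult_left_mono) auto
      finally show ?thesis using f c by auto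
    qed
    show "norm (f v) \<le> norm g * norm v"
      using le[OF ab(1,4)] le[OF ab(2,5)] ab(3) by (auto simp: blinfun.bilinear_simps)
  qed simp
qed (auto simp: blinfun.bilinear_simps)

end

section \<open>Rosenthal disjointification and uniform boundedness\<close>

lemma infinite_nat_partition:
  fixes A :: "nat set"
  assumes "infinite A"
  shows "\<exists>C :: nat \<Rightarrow> nat set. (\<forall>q. infinite (C q) \<and> C q \<subseteq> A) \<and> (\<forall>p q. p \<noteq> q \<longrightarrow> C p \<inter> C q = {})"
proof -
  define e where "e q m = enumerate A (prod_encode (q, m))" for q m
  have inj: "e q m = e q' m' \<longleftrightarrow> q = q' \<and> m = m'" for q m q' m'
    using strict_mono_enumerate[OF assms] by (simp add: e_def strict_mono_eq)
  have "infinite (range (e q))" for q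
    using inj by (intro range_inj_infinite) (auto simp: inj_def)
  moreover have "range (e q) \<subseteq> A" for q
    using enumerate_in_set[OF assms] by (auto simp: e_def)
  moreover have "range (e p) \<inter> range (e q) = {}" if "p \<noteq> q" for p q
    using inj that by auto
  ultimately show ?thesis
    by (intro exI[of _ "\<lambda>q. range (e q)"]) simp
qed

text \<open>Were every infinite set bad, split it into infinitely many infinite pieces and collect
  one bad index from each. The collected set misses \<open>C q - {k q}\<close>, so superadditivity
  lowers its bound by \<open>\<epsilon>\<close>. Enough repetitions would make \<open>\<rho>\<close>
  negative.\<close>

lemma rosenthal_disjointification:
  fixes \<rho> :: "nat \<Rightarrow> nat set \<Rightarrow> real"
  assumes nonneg: "\<And>k A. 0 \<le> \<rho> k A" and bound: "\<And>k. \<rho> k UNIV \<le> M"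
    and super: "\<And>k A B. A \<inter> B = {} \<Longrightarrow> \<rho> k A + \<rho> k B \<le> \<rho> k (A \<union> B)" and "0 < \<epsilon>"
  shows "\<exists>A. infinite A \<and> (\<forall>k\<in>A. \<rho> k (A - {k}) \<le> \<epsilon>)"
proof (rule ccontr)
  assume neg: "\<not> ?thesis"
  have bad: "\<exists>k\<in>A. \<epsilon> < \<rho> k (A - {k})" if "infinite A" for A
    using neg that by (meson not_le)
  have mono: "\<rho> k A \<le> \<rho> k B" if "A \<subseteq> B" for k A B
    using super[of A "B - A" k] nonneg[of k "B - A"] that by (simp add: Un_absorb1)
  have "\<exists>B. infinite B \<and> (\<forall>k\<in>B. \<rho> k B \<le> M - real p * \<epsilon>)" for p
  proof (induction p)
    case 0
    then show ?case using bound by (intro exI[of _ UNIV]) auto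
  next
    case (Suc p)
    then obtain A where A: "infinite A" "\<And>k. k \<in> A \<Longrightarrow> \<rho> k A \<le> M - real p * \<epsilon>" by blast
    obtain C :: "nat \<Rightarrow> nat set" where
      "(\<forall>q. infinite (C q) \<and> C q \<subseteq> A) \<and> (\<forall>p q. p \<noteq> q \<longrightarrow> C p \<inter> C q = {})"
      using infinite_nat_partition[OF A(1)] ..
    then have C: "\<And>q. infinite (C q)" "\<And>q. C q \<subseteq> A" "\<And>p q. p \<noteq> q \<Longrightarrow> C p \<inter> C q = {}"
      by simp_all
    have "\<forall>q. \<exists>k. k \<in> C q \<and> \<epsilon> < \<rho> k (C q - {k})"
      using bad[OF C(1)] by auto
    from choice[OF this] obtain k where k: "\<And>q. k q \<in> C q" "\<And>q. \<epsilon> < \<rho> (k q) (C q - {k q})"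
      by auto
    have "inj k"
    proof (rule injI)
      fix q r assume "k q = k r"
      then show "q = r" using k(1)[of q] k(1)[of r] C(3)[of q r] by (cases "q = r") auto
    qed
    then have "infinite (range k)" by (rule range_inj_infinite)
    moreover have "\<rho> (k q) (range k) \<le> M - real (Suc p) * \<epsilon>" for q
    proof -
      have dis: "(C q - {k q}) \<inter> range k = {}"
      proof -
        have "k r \<notin> C q - {k q}" for r
          using k(1)[of r] C(3)[of q r] by (cases "q = r") auto
        then show ?thesis by blast
      qed
      have "\<rho> (k q) (C q - {k q}) + \<rho> (k q) (range k) \<le> \<rho> (k q) ((C q - {k q}) \<union> range k)"
        by (rule super[OF dis])
      also have "\<dots> \<le> \<rho> (k q) A" using C(2) k(1) by (intro mono) blast
      also have "\<dots> \<le> M - real p * \<epsilon>" using A(2) C(2) k(1) by blast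
      finally show ?thesis using k(2)[of q] by (simp add: algebra_simps)
    qed
    ultimately show ?case by blast
  qed
  note step = this
  obtain p :: nat where "M / \<epsilon> < real p" using reals_Archimedean2 by blast
  then have neg: "M - real p * \<epsilon> < 0" using \<open>0 < \<epsilon>\<close> by (simp add: field_simps)
  obtain B where B: "infinite B \<and> (\<forall>k\<in>B. \<rho> k B \<le> M - real p * \<epsilon>)" using step[of p] ..
  then obtain k where "k \<in> B" using infinite_imp_nonempty by blast
  then have "\<rho> k B \<le> M - real p * \<epsilon>" using B by simp
  then show False using neg nonneg[of k B] by simp
qed

text \<open>Baire's theorem puts a ball of radius \<open>r\<close> inside some \<open>A m\<close>; a
  vector of norm \<open>r\<close> is a difference of two points of it, whence the bound
  \<open>2 * real m / r\<close>.\<close>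

lemma uniform_boundedness:
  fixes fs :: "nat \<Rightarrow> ('a::banach \<Rightarrow>\<^sub>L real)"
  assumes "\<And>x. (\<lambda>n. fs n x) \<longlonglongrightarrow> f x"
  shows "\<exists>B. \<forall>n. norm (fs n) \<le> B"
proof -
  define A where "A m = {x. \<forall>n. \<bar>fs n x\<bar> \<le> real m}" for m
  have "closed (A m)" for m
  proof -
    have "A m = (\<Inter>n. {x. \<bar>fs n x\<bar> \<le> real m})" by (auto simp: A_def)
    moreover have "closed {x. \<bar>fs n x\<bar> \<le> real m}" for n
      by (intro closed_Collect_le continuous_intros)
    ultimately show ?thesis by auto
  qed
  moreover have "(\<Union>m. A m) = UNIV"
  proof -
    have "\<exists>m. x \<in> A m" for x
    proof -
      have "Bseq (\<lambda>n. fs n x)" using assms convergentI convergent_imp_Bseq by blast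
      then obtain K where K: "\<And>n. \<bar>fs n x\<bar> \<le> K" by (auto simp: Bseq_def)
      obtain m :: nat where "K \<le> real m" using real_arch_simple by blast
      then show ?thesis using K by (auto simp: A_def intro: order_trans)
    qed
    then show ?thesis by auto
  qed
  ultimately have "\<exists>m. interior (A m) \<noteq> {}"
    using Baire_category_alt[of "euclidean :: 'a topology" "range A"]
      completely_metrizable_space_euclidean
    by force
  then obtain m x where "x \<in> interior (A m)" by auto
  then obtain r where r: "0 < r" "cball x r \<subseteq> A m"
    by (meson interior_subset mem_interior_cball subset_trans)
  have "norm (fs n) \<le> 2 * real m / r" for n
  proof (rule norm_blinfun_bound)
    fix y
    show "norm (fs n y) \<le> 2 * real m / r * norm y"
    proof (cases "y = 0")
      case False
      define z where "z = (r / norm y) *\<^sub>R y"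
      have "norm z = r" using False r by (simp add: z_def)
      then have "x + z \<in> A m" "x \<in> A m" using r by (auto simp: dist_norm)
      then have "\<bar>fs n (x + z)\<bar> \<le> real m" "\<bar>fs n x\<bar> \<le> real m" by (auto simp: A_def)
      then have "\<bar>fs n z\<bar> \<le> 2 * real m" by (simp add: blinfun.bilinear_simps)
      then have "(r / norm y) * \<bar>fs n y\<bar> \<le> 2 * real m"
        using r by (simp add: z_def blinfun.bilinear_simps abs_mult)
      then show ?thesis using False r by (simp add: field_simps)
    qed (simp add: blinfun.bilinear_simps)
  qed (use r in auto)
  then show ?thesis by blast
qed

section \<open>Banach lattices and their duals\<close>

lemma
  fixes a b c :: "'a::{lattice, ordered_ab_group_add}"
  shows diff_inf_eq_sup_diff: "a - inf b c = sup (a - b) (a - c)"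
    and add_inf_distrib_left: "a + inf b c = inf (a + b) (a + c)"
    and add_eq_sup_add_inf: "a + b = sup a b + inf a b"
    and pos_part_minus_neg_part: "sup a 0 - sup (- a) 0 = a"
    and inf_pos_neg_part: "inf (sup a 0) (sup (- a) 0) = 0"
    and zero_le_doubleD: "0 \<le> a + a \<Longrightarrow> 0 \<le> a"
proof -
  interpret lattice_ab_group_add "(+)" "0 :: 'a" "(-)" uminus "(\<le>)" "(<)" inf sup
    by unfold_locales
  show "a - inf b c = sup (a - b) (a - c)"
    by (simp only: diff_conv_add_uminus neg_inf_eq_sup add_sup_distrib_left)
  show dist: "a + inf b c = inf (a + b) (a + c)" for a b c :: 'a
    by (rule add_inf_distrib_left)
  show "0 \<le> a + a \<Longrightarrow> 0 \<le> a"
    by (simp only: zero_le_double_add_iff_zero_le_single_add)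
  show "a + b = sup a b + inf a b"
    by (rule add_eq_inf_sup)
  show *: "sup a 0 - sup (- a) 0 = a"
    using prts[of a] pprt_neg[of a] unfolding pprt_def by simp
  have "inf (sup a 0) (sup (- a) 0) = sup (- a) 0 + inf a 0"
    unfolding dist using * by (simp only: diff_eq_eq add.commute add_0_right add_0_left)
  also have "inf a 0 = - sup (- a) 0"
    using pprt_neg[of a] unfolding pprt_def nprt_def by simp
  finally show "inf (sup a 0) (sup (- a) 0) = 0"
    by (simp only: add.right_inverse)
qed

lemma inf_add_zero:
  fixes a b c :: "'a::{lattice, ordered_ab_group_add}"
  assumes "0 \<le> a" "0 \<le> b" "0 \<le> c" "inf a c = 0" "inf b c = 0"
  shows "inf (a + b) c = 0"
proof (rule antisym)
  let ?w = "inf (a + b) c"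
  have "?w \<le> inf (a + b) (a + c)"
    using assms by (simp add: le_infI2 add_increasing)
  also have "\<dots> = a + inf b c" by (simp add: add_inf_distrib_left)
  finally have "?w \<le> inf a c" using assms(5) by simp
  then show "?w \<le> 0" using assms(4) by simp
  show "0 \<le> ?w" using assms by simp
qed

text \<open>Disjoint elements satisfy \<open>a + b = sup a b\<close>, so their sum respects common
  upper bounds. The induction also carries that the partial sum is disjoint from the remaining
  terms.\<close>

lemma sum_disjoint_le:
  fixes z :: "'i \<Rightarrow> 'a::{lattice, ordered_ab_group_add}"
  assumes "finite J" "0 \<le> u" "\<And>j. j \<in> J \<Longrightarrow> 0 \<le> z j \<and> z j \<le> u"
    "\<And>i j. i \<in> J \<Longrightarrow> j \<in> J \<Longrightarrow> i \<noteq> j \<Longrightarrow> inf (z i) (z j) = 0"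
  shows "sum z J \<le> u"
proof -
  have "K \<subseteq> J \<longrightarrow> sum z K \<le> u \<and> (\<forall>j\<in>J - K. inf (sum z K) (z j) = 0)" if "finite K" for K
    using that
  proof (induction K)
    case empty
    then show ?case using assms by (auto simp: inf_absorb1)
  next
    case (insert k K)
    show ?case
    proof
      assume sub: "insert k K \<subseteq> J"
      then have IH: "sum z K \<le> u" "\<And>j. j \<in> J - K \<Longrightarrow> inf (sum z K) (z j) = 0"
        using insert by auto
      have nn: "0 \<le> sum z K" using sub assms(3) by (intro sum_nonneg) auto
      have "inf (sum z K) (z k) = 0" using IH(2) insert sub by auto
      then have "z k + sum z K = sup (sum z K) (z k)"
        using add_eq_sup_add_inf[of "sum z K" "z k"] by (simp add: add.commute)
      also have "\<dots> \<le> u" using IH sub assms(3) by auto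
      finally have "sum z (insert k K) \<le> u" using insert by simp
      moreover have "inf (sum z (insert k K)) (z j) = 0" if j: "j \<in> J - insert k K" for j
        using inf_add_zero[of "z k" "sum z K" "z j"] nn sub assms(3,4) IH(2)[of j] j insert by auto
      ultimately show "sum z (insert k K) \<le> u \<and>
          (\<forall>j\<in>J - insert k K. inf (sum z (insert k K)) (z j) = 0)" by blast
    qed
  qed
  then show ?thesis using assms(1) by blast
qed

lemma labs_of_nonneg:
  fixes x :: "'a::{lattice, ordered_ab_group_add}"
  assumes "0 \<le> x" shows "labs x = x"
proof -
  have "- x \<le> x" using assms by (meson neg_le_0_iff_le order_trans)
  then show ?thesis by (simp add: labs_def sup_absorb1)
qed

lemma labs_nonneg:
  fixes x :: "'a::{lattice, ordered_ab_group_add}"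
  shows "0 \<le> labs x"
proof -
  have "x \<le> labs x" "- x \<le> labs x" by (auto simp: labs_def)
  then have "x + - x \<le> labs x + labs x" by (rule add_mono)
  then show ?thesis using zero_le_doubleD by simp
qed

lemma dual_le_refl [simp]: "dual_le f f"
  by (simp add: dual_le_def)

lemma dual_le_trans: "dual_le f g \<Longrightarrow> dual_le g h \<Longrightarrow> dual_le f h"
  unfolding dual_le_def by (meson order_trans)

lemma dual_le_diff [simp]: "dual_le 0 (g - f) \<longleftrightarrow> dual_le f g"
  by (simp add: dual_le_def blinfun.bilinear_simps)

lemma dual_leD: "dual_le f g \<Longrightarrow> 0 \<le> x \<Longrightarrow> blinfun_apply f x \<le> blinfun_apply g x"
  by (simp add: dual_le_def)

lemma dual_posD: "dual_le 0 f \<Longrightarrow> 0 \<le> x \<Longrightarrow> 0 \<le> blinfun_apply f x"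
  using dual_leD[of 0 f x] by simp

lemma dual_pos_mono:
  fixes x y :: "'a::{real_normed_vector, ordered_ab_group_add}"
  shows "dual_le 0 f \<Longrightarrow> x \<le> y \<Longrightarrow> blinfun_apply f x \<le> blinfun_apply f y"
  using dual_posD[of f "y - x"] by (simp add: blinfun.bilinear_simps)

locale banach_lattice_space =
  fixes TY :: "'a::{banach, lattice, ordered_ab_group_add} itself"
  assumes BL: "banach_lattice TYPE('a)"
begin

lemma scale_nonneg: "0 \<le> x \<Longrightarrow> 0 \<le> c \<Longrightarrow> 0 \<le> c *\<^sub>R (x::'a)"
  using BL by (simp add: banach_lattice_def)

lemma scale_left_mono: "x \<le> y \<Longrightarrow> 0 \<le> c \<Longrightarrow> c *\<^sub>R x \<le> c *\<^sub>R (y::'a)"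
  using scale_nonneg[of "y - x" c] by (simp add: scaleR_right_diff_distrib)

lemma scale_right_mono: "c \<le> d \<Longrightarrow> 0 \<le> x \<Longrightarrow> c *\<^sub>R x \<le> d *\<^sub>R (x::'a)"
  using scale_nonneg[of x "d - c"] by (simp add: scaleR_left_diff_distrib)

lemma norm_le_labs: "labs x \<le> labs y \<Longrightarrow> norm x \<le> norm (y::'a)"
  using BL by (simp add: banach_lattice_def)

lemma norm_labs: "norm (labs x) = norm (x::'a)"
  using norm_le_labs[of "labs x" x] norm_le_labs[of x "labs x"] labs_of_nonneg[OF labs_nonneg, of x]
  by simp

text \<open>First level: \<open>E.pp\<close> and \<open>E.disj\<close> act on the dual. Both parts
  of \<open>v\<close> lie below \<open>labs v\<close>, which gives the norm bounds in
  \<open>gen\<close>.\<close>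

sublocale E: riesz_cone "{x::'a. 0 \<le> x}"
proof
  fix v :: 'a
  have "sup v 0 - sup (- v) 0 = v"
    by (rule pos_part_minus_neg_part)
  moreover have "sup v 0 \<le> labs v" "sup (- v) 0 \<le> labs v"
    using labs_nonneg[of v] by (auto simp: labs_def)
  then have "labs (sup v 0) \<le> labs v" "labs (sup (- v) 0) \<le> labs v"
    using labs_of_nonneg[of "sup v 0"] labs_of_nonneg[of "sup (- v) 0"] by auto
  ultimately show "\<exists>a b. a \<in> {x. 0 \<le> x} \<and> b \<in> {x. 0 \<le> x} \<and> v = a - b \<and> norm a \<le> norm v \<and> norm b \<le> norm v"
    by (intro exI[of _ "sup v 0"] exI[of _ "sup (- v) 0"] conjI norm_le_labs) auto
next
  fix a b c :: 'a
  assume "a \<in> {x. 0 \<le> x}" "b \<in> {x. 0 \<le> x}" "c \<in> {x. 0 \<le> x}" "a + b - c \<in> {x. 0 \<le> x}"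
  moreover from this have "c - inf c a \<le> b"
    by (simp add: diff_inf_eq_sup_diff algebra_simps)
  ultimately show "\<exists>c1 c2. c = c1 + c2 \<and> c1 \<in> {x. 0 \<le> x} \<and> c2 \<in> {x. 0 \<le> x} \<and>
      a - c1 \<in> {x. 0 \<le> x} \<and> b - c2 \<in> {x. 0 \<le> x}"
    by (intro exI[of _ "inf c a"] exI[of _ "c - inf c a"]) auto
next
  fix a b :: 'a
  assume "a \<in> {x. 0 \<le> x}" "b - a \<in> {x. 0 \<le> x}"
  then show "norm a \<le> norm b"
    by (intro norm_le_labs) (auto simp: labs_of_nonneg order_trans[of 0 a b])
qed (auto intro: scale_nonneg)

text \<open>Second level: \<open>F.pp\<close> and \<open>F.disj\<close> act on the bidual.\<close>

sublocale F: riesz_cone "{f::'a \<Rightarrow>\<^sub>L real. dual_le 0 f}"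
proof -
  have "{f::'a \<Rightarrow>\<^sub>L real. dual_le 0 f} = {f. \<forall>a\<in>{x. 0 \<le> x}. 0 \<le> blinfun_apply f a}"
    by (auto simp: dual_le_def)
  then show "riesz_cone {f::'a \<Rightarrow>\<^sub>L real. dual_le 0 f}" using E.dual_cone by simp
qed

lemma dual_le_antisym: "dual_le f g \<Longrightarrow> dual_le g f \<Longrightarrow> f = (g :: 'a \<Rightarrow>\<^sub>L real)"
  by (rule E.blinfun_eqI_cone) (simp add: dual_le_def antisym)

lemma
  fixes f g :: "'a \<Rightarrow>\<^sub>L real"
  shows pos_part_nonneg: "dual_le 0 (E.pp f)"
    and pos_part_ge: "dual_le f (E.pp f)"
    and pos_part_least: "dual_le 0 g \<Longrightarrow> dual_le f g \<Longrightarrow> dual_le (E.pp f) g"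
  using E.pp_nonneg[of _ f] E.pp_ge[of _ f] E.pp_least[of g f] by (auto simp: dual_le_def)

lemma pos_part_mono:
  fixes f g :: "'a \<Rightarrow>\<^sub>L real"
  shows "dual_le f g \<Longrightarrow> dual_le (E.pp f) (E.pp g)"
  by (meson dual_le_trans pos_part_ge pos_part_least pos_part_nonneg)

lemma dual_disjD:
  fixes \<mu> \<nu> :: "'a \<Rightarrow>\<^sub>L real"
  assumes "E.disj \<mu> \<nu>" "0 \<le> x" "0 < \<eta>"
  obtains y where "0 \<le> y" "y \<le> x" "\<mu> (x - y) + \<nu> y < \<eta>"
proof -
  have "\<exists>b\<in>{x. 0 \<le> x}. x - b \<in> {x. 0 \<le> x} \<and> \<mu> (x - b) + \<nu> b < \<eta>"
    using assms unfolding E.disj_def by blast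
  then show thesis using that by auto
qed

subsection \<open>Disjoint sequences in order intervals\<close>

text \<open>Subtraction from \<open>u\<close> turns a meet into a join, and a join of nonnegative
  elements is at most their sum.\<close>

lemma finite_inf_bound:
  fixes q :: "'i \<Rightarrow> 'a"
  assumes "finite K" "0 \<le> u" "\<And>k. k \<in> K \<Longrightarrow> 0 \<le> q k \<and> q k \<le> u"
  shows "\<exists>z. 0 \<le> z \<and> z \<le> u \<and> (\<forall>k\<in>K. z \<le> q k) \<and> u - z \<le> (\<Sum>k\<in>K. u - q k)"
  using assms
proof (induction K)
  case empty
  then show ?case by (intro exI[of _ u]) auto
next
  case (insert k K)
  then obtain z where z: "0 \<le> z" "z \<le> u" "\<forall>k\<in>K. z \<le> q k" "u - z \<le> (\<Sum>k\<in>K. u - q k)"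
    by auto
  have qk: "0 \<le> q k" "q k \<le> u" using insert by auto
  have "u - inf z (q k) = sup (u - z) (u - q k)"
    by (rule diff_inf_eq_sup_diff)
  also have "\<dots> \<le> (u - z) + (u - q k)" using z qk by simp
  also have "\<dots> \<le> (\<Sum>k\<in>insert k K. u - q k)" using insert z(4) by (simp add: add.commute)
  finally show ?case using z qk by (intro exI[of _ "inf z (q k)"]) (auto intro: le_infI1)
qed

text \<open>For one pair, take \<open>a\<close> with \<open>\<mu> i (u - a) + \<mu> j a\<close>
  small. The positive and negative parts of \<open>2 *\<^sub>R a - u\<close> are disjoint and cost
  only twice that error. Meeting over all partners handles the family.\<close>

lemma finite_disjointify:
  fixes \<mu> :: "nat \<Rightarrow> ('a \<Rightarrow>\<^sub>L real)"
  assumes "finite J" "0 \<le> u" "\<And>j. j \<in> J \<Longrightarrow> dual_le 0 (\<mu> j)"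
    "\<And>i j. i \<in> J \<Longrightarrow> j \<in> J \<Longrightarrow> i \<noteq> j \<Longrightarrow> E.disj (\<mu> i) (\<mu> j)" "0 < \<eta>"
  shows "\<exists>z. (\<forall>j\<in>J. 0 \<le> z j \<and> z j \<le> u \<and> \<mu> j (u - z j) \<le> \<eta>) \<and>
    (\<forall>i\<in>J. \<forall>j\<in>J. i \<noteq> j \<longrightarrow> inf (z i) (z j) = 0)"
proof -
  \<comment> \<open>The final meet adds up at most \<open>card J\<close> losses of
    \<open>2 * \<eta>'\<close>; the summand 1 covers an empty \<open>J\<close>.\<close>
  define \<eta>' where "\<eta>' = \<eta> / (2 * (real (card J) + 1))"
  have \<eta>': "0 < \<eta>'" "2 * \<eta>' * real (card J) \<le> \<eta>" using assms(5) by (auto simp: \<eta>'_def field_simps)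
  have "\<forall>i j. \<exists>a. i \<in> J \<longrightarrow> j \<in> J \<longrightarrow> i \<noteq> j \<longrightarrow> 0 \<le> a \<and> a \<le> u \<and> \<mu> i (u - a) + \<mu> j a < \<eta>'"
    by (meson dual_disjD[OF assms(4) assms(2) \<eta>'(1)])
  then obtain a where a: "\<And>i j. i \<in> J \<Longrightarrow> j \<in> J \<Longrightarrow> i \<noteq> j \<Longrightarrow>
      0 \<le> a i j \<and> a i j \<le> u \<and> \<mu> i (u - a i j) + \<mu> j (a i j) < \<eta>'"
    by metis
  \<comment> \<open>Both orders of a pair use the \<open>a\<close> whose first index is the smaller
    one, so that \<open>p i j\<close> and \<open>p j i\<close> are opposite parts of the same
    element.\<close>
  define p where "p i j = (if i < j then sup (2 *\<^sub>R a i j - u) 0 else sup (u - 2 *\<^sub>R a j i) 0)" for i j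
  have p_bound: "0 \<le> p i j \<and> p i j \<le> u \<and> \<mu> i (u - p i j) \<le> 2 * \<eta>'"
    if ij: "i \<in> J" "j \<in> J" "i \<noteq> j" for i j
  proof (cases "i < j")
    case True
    have A: "0 \<le> a i j" "a i j \<le> u" "\<mu> i (u - a i j) + \<mu> j (a i j) < \<eta>'" using a ij by auto
    have "2 *\<^sub>R a i j \<le> 2 *\<^sub>R u" using A by (intro scale_left_mono) auto
    then have "2 *\<^sub>R a i j - u \<le> u" by (simp add: scaleR_2 algebra_simps)
    then have 1: "p i j \<le> u" "0 \<le> p i j" using True assms(2) by (auto simp: p_def)
    have "2 *\<^sub>R a i j - u \<le> p i j" using True by (simp add: p_def)
    then have "u - p i j \<le> 2 *\<^sub>R (u - a i j)" by (simp add: scaleR_2 algebra_simps)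
    then have "\<mu> i (u - p i j) \<le> 2 * \<mu> i (u - a i j)"
      using dual_pos_mono[OF assms(3)[OF ij(1)]] by (metis blinfun.scaleR_right real_scaleR_def)
    moreover have "0 \<le> \<mu> j (a i j)" using dual_posD[OF assms(3)[OF ij(2)] A(1)] .
    ultimately show ?thesis using A 1 by auto
  next
    case False
    have A: "0 \<le> a j i" "a j i \<le> u" "\<mu> j (u - a j i) + \<mu> i (a j i) < \<eta>'" using a ij by auto
    have "0 \<le> 2 *\<^sub>R a j i" using A by (intro scale_nonneg) auto
    then have 1: "p i j \<le> u" "0 \<le> p i j" using False assms(2) by (auto simp: p_def)
    have "u - 2 *\<^sub>R a j i \<le> p i j" using False by (simp add: p_def)
    then have "u - p i j \<le> 2 *\<^sub>R a j i" by (simp add: algebra_simps)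
    then have "\<mu> i (u - p i j) \<le> 2 * \<mu> i (a j i)"
      using dual_pos_mono[OF assms(3)[OF ij(1)]] by (metis blinfun.scaleR_right real_scaleR_def)
    moreover have "0 \<le> \<mu> j (u - a j i)" using dual_posD[OF assms(3)[OF ij(2)]] A by simp
    ultimately show ?thesis using A 1 by auto
  qed
  have p_disj: "inf (p i j) (p j i) = 0" if ij: "i \<noteq> j" for i j
    using inf_pos_neg_part[of "2 *\<^sub>R a i j - u"] inf_pos_neg_part[of "2 *\<^sub>R a j i - u"] ij
    by (auto simp: p_def inf_commute)
  have "\<forall>i. \<exists>z. i \<in> J \<longrightarrow> 0 \<le> z \<and> z \<le> u \<and> (\<forall>k\<in>J - {i}. z \<le> p i k) \<and> u - z \<le> (\<Sum>k\<in>J - {i}. u - p i k)"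
  proof
    fix i
    show "\<exists>z. i \<in> J \<longrightarrow> 0 \<le> z \<and> z \<le> u \<and> (\<forall>k\<in>J - {i}. z \<le> p i k) \<and> u - z \<le> (\<Sum>k\<in>J - {i}. u - p i k)"
    proof (cases "i \<in> J")
      case True
      then show ?thesis
        using finite_inf_bound[of "J - {i}" u "p i"] assms(1,2) p_bound[of i] by simp
    qed simp
  qed
  then obtain z where z: "\<And>i. i \<in> J \<Longrightarrow> 0 \<le> z i \<and> z i \<le> u \<and> (\<forall>k\<in>J - {i}. z i \<le> p i k) \<and>
      u - z i \<le> (\<Sum>k\<in>J - {i}. u - p i k)"
    by metis
  have "\<mu> i (u - z i) \<le> \<eta>" if i: "i \<in> J" for i
  proof -
    have "\<mu> i (u - z i) \<le> \<mu> i (\<Sum>k\<in>J - {i}. u - p i k)"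
      using dual_pos_mono[OF assms(3)[OF i]] z[OF i] by blast
    also have "\<dots> = (\<Sum>k\<in>J - {i}. \<mu> i (u - p i k))" by (simp add: blinfun.sum_right)
    also have "\<dots> \<le> (\<Sum>k\<in>J - {i}. 2 * \<eta>')" using p_bound i by (intro sum_mono) auto
    also have "\<dots> \<le> 2 * \<eta>' * real (card J)"
      using \<eta>'(1) assms(1) by (simp add: card_Diff_singleton_if)
    finally show ?thesis using \<eta>'(2) by simp
  qed
  moreover have "inf (z i) (z j) = 0" if ij: "i \<in> J" "j \<in> J" "i \<noteq> j" for i j
  proof (rule antisym)
    have "inf (z i) (z j) \<le> inf (p i j) (p j i)" using z ij by (intro inf_mono) auto
    then show "inf (z i) (z j) \<le> 0" using p_disj ij by simp
    show "0 \<le> inf (z i) (z j)" using z ij by simp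
  qed
  ultimately show ?thesis using z by blast
qed

text \<open>\<open>c\<close> is the part of \<open>u\<close> still free for later choices, \<open>R n\<close> the indices of row \<open>n\<close> still in play, and
  \<open>s\<close> bounds the relative mass they have lost.\<close>

definition selection_state ::
  "(nat \<Rightarrow> nat \<Rightarrow> ('a \<Rightarrow>\<^sub>L real)) \<Rightarrow> 'a \<Rightarrow> 'a \<Rightarrow> (nat \<Rightarrow> nat set) \<Rightarrow> real \<Rightarrow> bool" where
  "selection_state \<mu> u c R s \<longleftrightarrow> 0 \<le> c \<and> c \<le> u \<and> (\<forall>M. \<exists>n. M \<le> card (R n)) \<and> (\<forall>n. R n \<subseteq> {..<n}) \<and>
     (\<forall>n. \<forall>i\<in>R n. blinfun_apply (\<mu> n i) (u - c) \<le> s * blinfun_apply (\<mu> n i) u)"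

text \<open>In a long row the disjointified \<open>z j\<close> cannot all carry a noticeable share
  of the mass of another functional, because they sum to at most \<open>u\<close>. A pigeonhole over
  the finitely many \<open>j\<close> finds one whose removal still leaves rows of unbounded
  length.\<close>

lemma selection_step:
  fixes \<mu> :: "nat \<Rightarrow> nat \<Rightarrow> ('a \<Rightarrow>\<^sub>L real)"
  assumes u: "0 \<le> u" and \<delta>: "0 < \<delta>"
    and pos: "\<And>n i. i < n \<Longrightarrow> dual_le 0 (\<mu> n i)"
    and mass: "\<And>n i. i < n \<Longrightarrow> \<delta> \<le> \<mu> n i u"
    and disj: "\<And>n i j. i < n \<Longrightarrow> j < n \<Longrightarrow> i \<noteq> j \<Longrightarrow> E.disj (\<mu> n i) (\<mu> n j)"
    and st: "selection_state \<mu> u c R s" and s: "s \<le> 1/8" and \<tau>: "0 < \<tau>"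
  shows "\<exists>c' R' j n y. selection_state \<mu> u c' R' (s + \<tau>) \<and> i0 < j \<and> j < n \<and> 0 \<le> y \<and> y \<le> c \<and>
    inf y c' = 0 \<and> c' \<le> c \<and> \<mu> n j u / 2 \<le> \<mu> n j y"
proof -
  have c: "0 \<le> c" "c \<le> u" and R_unb: "\<And>M. \<exists>n. M \<le> card (R n)" and R_sub: "\<And>n. R n \<subseteq> {..<n}"
    and R_mass: "\<And>n i. i \<in> R n \<Longrightarrow> \<mu> n i (u - c) \<le> s * \<mu> n i u"
    using st by (auto simp: selection_state_def)
  have R_fin: "finite (R n)" for n using R_sub finite_subset by blast
  \<comment> \<open>More than \<open>4 / \<tau>\<close> candidates make the pigeonhole work;
    \<open>i0 + 1\<close> further indices may be discarded to force the new one above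
    \<open>i0\<close>.\<close>
  obtain M :: nat where M: "4 / \<tau> < real M" using reals_Archimedean2 by blast
  obtain n where n: "M + i0 + 1 \<le> card (R n)" using R_unb by blast
  define J where "J = R n - {..i0}"
  have finJ: "finite J" using R_fin by (simp add: J_def)
  have J: "\<And>j. j \<in> J \<Longrightarrow> j < n \<and> i0 < j \<and> j \<in> R n" using R_sub by (auto simp: J_def)
  have "card (R n) \<le> card J + card {..i0}"
    using diff_card_le_card_Diff[of "{..i0}" "R n"] by (simp add: J_def)
  then have cardJ: "M \<le> card J" using n by simp
  have "\<exists>z. (\<forall>j\<in>J. 0 \<le> z j \<and> z j \<le> u \<and> \<mu> n j (u - z j) \<le> \<delta> / 8) \<and>
      (\<forall>i\<in>J. \<forall>j\<in>J. i \<noteq> j \<longrightarrow> inf (z i) (z j) = 0)"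
    by (rule finite_disjointify[OF finJ u]) (use pos disj J \<delta> in auto)
  then obtain z where "(\<forall>j\<in>J. 0 \<le> z j \<and> z j \<le> u \<and> \<mu> n j (u - z j) \<le> \<delta> / 8) \<and>
      (\<forall>i\<in>J. \<forall>j\<in>J. i \<noteq> j \<longrightarrow> inf (z i) (z j) = 0)" ..
  then have z: "\<And>j. j \<in> J \<Longrightarrow> 0 \<le> z j \<and> z j \<le> u \<and> \<mu> n j (u - z j) \<le> \<delta> / 8"
      "\<And>i j. i \<in> J \<Longrightarrow> j \<in> J \<Longrightarrow> i \<noteq> j \<Longrightarrow> inf (z i) (z j) = 0"
    by auto
  have zsum: "sum z J \<le> u"
    by (rule sum_disjoint_le[OF finJ u]) (use z in auto)
  \<comment> \<open>The factor 4 anticipates that passing from \<open>c\<close> to \<open>c'\<close>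
    removes at most \<open>4 *\<^sub>R z j\<close>, which has to cost no more than the share
    \<open>\<tau>\<close>.\<close>
  define Rj where "Rj j m = {i \<in> R m. 4 * \<mu> m i (z j) \<le> \<tau> * \<mu> m i u}" for j m
  have cover: "R m \<subseteq> (\<Union>j\<in>J. Rj j m)" for m
  proof
    fix i assume i: "i \<in> R m"
    then have im: "i < m" using R_sub by auto
    show "i \<in> (\<Union>j\<in>J. Rj j m)"
    proof (rule ccontr)
      assume "i \<notin> (\<Union>j\<in>J. Rj j m)"
      then have big: "\<tau> / 4 * \<mu> m i u \<le> \<mu> m i (z j)" if "j \<in> J" for j
        using i that by (force simp: Rj_def)
      have "real (card J) * (\<tau> / 4 * \<mu> m i u) \<le> (\<Sum>j\<in>J. \<mu> m i (z j))"
        using sum_bounded_below[of J "\<tau> / 4 * \<mu> m i u"] big by simp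
      also have "\<dots> = \<mu> m i (sum z J)" by (simp add: blinfun.sum_right)
      also have "\<dots> \<le> \<mu> m i u" using dual_pos_mono[OF pos[OF im] zsum] .
      finally have "real (card J) * \<tau> / 4 * \<mu> m i u \<le> 1 * \<mu> m i u" by simp
      moreover have "0 < \<mu> m i u" using mass[OF im] \<delta> by simp
      ultimately have "real (card J) * \<tau> / 4 \<le> 1" by (metis mult_le_cancel_right_pos)
      moreover have "4 < real (card J) * \<tau>"
      proof -
        have "4 < real M * \<tau>" using M \<tau> by (simp add: field_simps)
        also have "\<dots> \<le> real (card J) * \<tau>" using cardJ \<tau> by simp
        finally show ?thesis .
      qed
      ultimately show False by simp
    qed
  qed
  have "\<exists>j\<in>J. \<forall>B. \<exists>m. B \<le> card (Rj j m)"
  proof (rule ccontr)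
    assume "\<not> ?thesis"
    then have "\<forall>j\<in>J. \<exists>B. \<forall>m. card (Rj j m) < B" by (simp add: not_le)
    then obtain B where B: "\<And>j m. j \<in> J \<Longrightarrow> card (Rj j m) < B j"
      by (metis bchoice)
    have "card (R m) \<le> sum B J" for m
    proof -
      have "card (R m) \<le> card (\<Union>j\<in>J. Rj j m)"
        using cover finJ R_fin by (intro card_mono) (auto simp: Rj_def)
      also have "\<dots> \<le> (\<Sum>j\<in>J. card (Rj j m))" using card_UN_le[OF finJ] by blast
      also have "\<dots> \<le> sum B J" using B by (intro sum_mono) (simp add: less_imp_le)
      finally show ?thesis .
    qed
    moreover obtain m where "sum B J + 1 \<le> card (R m)" using R_unb by blast
    ultimately show False using Suc_n_not_le_n[of "sum B J"] order_trans by fastforce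
  qed
  then obtain j where j: "j \<in> J" and unb: "\<And>B. \<exists>m. B \<le> card (Rj j m)" by blast
  \<comment> \<open>\<open>y\<close> lives where \<open>z j\<close> exceeds a quarter of
    \<open>u\<close>, and \<open>c'\<close> where it stays below: up to a positive factor, the two
    truncated elements are the positive and the negative part of
    \<open>4 *\<^sub>R z j - u\<close>.\<close>
  define c' where "c' = inf c (sup (u - 4 *\<^sub>R z j) 0)"
  define y where "y = inf (sup (z j - (1/4) *\<^sub>R u) 0) c"
  have zj: "0 \<le> z j" "z j \<le> u" "\<mu> n j (u - z j) \<le> \<delta> / 8" using z j by auto
  have "0 \<le> 4 *\<^sub>R z j" "0 \<le> (1/4) *\<^sub>R u" using zj u by (auto intro!: scale_nonneg)
  have c': "0 \<le> c'" "c' \<le> c" using c by (auto simp: c'_def)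
  have y: "0 \<le> y" "y \<le> c" using c by (auto simp: y_def)
  have "4 *\<^sub>R sup (z j - (1/4) *\<^sub>R u) 0 = sup (4 *\<^sub>R z j - u) 0"
  proof (rule antisym)
    have "(1/4) *\<^sub>R (4 *\<^sub>R z j - u) \<le> (1/4) *\<^sub>R sup (4 *\<^sub>R z j - u) 0" by (intro scale_left_mono) auto
    then have "z j - (1/4) *\<^sub>R u \<le> (1/4) *\<^sub>R sup (4 *\<^sub>R z j - u) 0" by (simp add: scaleR_right_diff_distrib)
    then have "sup (z j - (1/4) *\<^sub>R u) 0 \<le> (1/4) *\<^sub>R sup (4 *\<^sub>R z j - u) 0" by (simp add: scale_nonneg)
    then show "4 *\<^sub>R sup (z j - (1/4) *\<^sub>R u) 0 \<le> sup (4 *\<^sub>R z j - u) 0"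
      using scale_left_mono[of "sup (z j - (1/4) *\<^sub>R u) 0" "(1/4) *\<^sub>R sup (4 *\<^sub>R z j - u) 0" 4] by simp
    have "4 *\<^sub>R (z j - (1/4) *\<^sub>R u) \<le> 4 *\<^sub>R sup (z j - (1/4) *\<^sub>R u) 0" by (intro scale_left_mono) auto
    then show "sup (4 *\<^sub>R z j - u) 0 \<le> 4 *\<^sub>R sup (z j - (1/4) *\<^sub>R u) 0"
      by (simp add: scaleR_right_diff_distrib scale_nonneg)
  qed
  then have "inf (4 *\<^sub>R sup (z j - (1/4) *\<^sub>R u) 0) (sup (u - 4 *\<^sub>R z j) 0) = 0"
    using inf_pos_neg_part[of "4 *\<^sub>R z j - u"] by simp
  moreover have "sup (z j - (1/4) *\<^sub>R u) 0 \<le> 4 *\<^sub>R sup (z j - (1/4) *\<^sub>R u) 0"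
    using scale_right_mono[of 1 4 "sup (z j - (1/4) *\<^sub>R u) 0"] by simp
  ultimately have "inf y c' \<le> 0"
    unfolding y_def c'_def by (metis inf_mono[OF order_trans[OF inf_le1] inf_le2])
  then have yc': "inf y c' = 0" using y c' by (simp add: antisym)
  have st': "selection_state \<mu> u c' (Rj j) (s + \<tau>)"
    unfolding selection_state_def
  proof (intro conjI allI ballI)
    show "0 \<le> c'" "c' \<le> u" using c c' by auto
    show "\<exists>n. M \<le> card (Rj j n)" for M by (rule unb)
    show "Rj j n \<subseteq> {..<n}" for n using R_sub[of n] by (auto simp: Rj_def)
  next
    fix m i assume i: "i \<in> Rj j m"
    then have iR: "i \<in> R m" and small: "4 * \<mu> m i (z j) \<le> \<tau> * \<mu> m i u" and im: "i < m"
      using R_sub by (auto simp: Rj_def)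
    have "u - c' = sup (u - c) (u - sup (u - 4 *\<^sub>R z j) 0)"
      unfolding c'_def by (rule diff_inf_eq_sup_diff)
    also have "\<dots> \<le> (u - c) + 4 *\<^sub>R z j"
    proof (rule sup_least)
      show "u - c \<le> u - c + 4 *\<^sub>R z j" using \<open>0 \<le> 4 *\<^sub>R z j\<close> by simp
      have "u - sup (u - 4 *\<^sub>R z j) 0 \<le> u - (u - 4 *\<^sub>R z j)" by (rule diff_left_mono) simp
      then have "u - sup (u - 4 *\<^sub>R z j) 0 \<le> 4 *\<^sub>R z j" by simp
      also have "\<dots> \<le> u - c + 4 *\<^sub>R z j" using c by simp
      finally show "u - sup (u - 4 *\<^sub>R z j) 0 \<le> u - c + 4 *\<^sub>R z j" .
    qed
    finally have "\<mu> m i (u - c') \<le> \<mu> m i ((u - c) + 4 *\<^sub>R z j)"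
      by (rule dual_pos_mono[OF pos[OF im]])
    then have "\<mu> m i (u - c') \<le> \<mu> m i (u - c) + 4 * \<mu> m i (z j)"
      by (simp add: blinfun.add_right blinfun.scaleR_right)
    then show "\<mu> m i (u - c') \<le> (s + \<tau>) * \<mu> m i u"
      using R_mass[OF iR] small by (simp add: algebra_simps)
  qed
  have jn: "j < n" "i0 < j" "j \<in> R n" using J j by auto
  have "u - y = sup (u - sup (z j - (1/4) *\<^sub>R u) 0) (u - c)"
    unfolding y_def by (rule diff_inf_eq_sup_diff)
  also have "\<dots> \<le> (u - z j) + (1/4) *\<^sub>R u + (u - c)"
  proof (rule sup_least)
    have "u - sup (z j - (1/4) *\<^sub>R u) 0 \<le> u - (z j - (1/4) *\<^sub>R u)" by (rule diff_left_mono) simp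
    then have "u - sup (z j - (1/4) *\<^sub>R u) 0 \<le> (u - z j) + (1/4) *\<^sub>R u" by (simp add: algebra_simps)
    also have "\<dots> \<le> (u - z j) + (1/4) *\<^sub>R u + (u - c)" using c by simp
    finally show "u - sup (z j - (1/4) *\<^sub>R u) 0 \<le> (u - z j) + (1/4) *\<^sub>R u + (u - c)" .
    show "u - c \<le> (u - z j) + (1/4) *\<^sub>R u + (u - c)"
      using zj \<open>0 \<le> (1/4) *\<^sub>R u\<close> by simp
  qed
  finally have "\<mu> n j (u - y) \<le> \<mu> n j ((u - z j) + (1/4) *\<^sub>R u + (u - c))"
    by (rule dual_pos_mono[OF pos[OF jn(1)]])
  also have "\<dots> = \<mu> n j (u - z j) + 1/4 * \<mu> n j u + \<mu> n j (u - c)"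
    by (simp add: blinfun.add_right blinfun.scaleR_right)
  \<comment> \<open>The losses of \<open>y\<close>: 1/8 from \<open>z j\<close>, as
    \<open>\<delta>\<close> bounds the mass from below; 1/4 from the cut; 1/8 from \<open>c\<close>,
    as \<open>s\<close> is at most 1/8. Half of the mass remains.\<close>
  also have "\<dots> \<le> 1/8 * \<mu> n j u + 1/4 * \<mu> n j u + 1/8 * \<mu> n j u"
  proof -
    have "s * \<mu> n j u \<le> 1/8 * \<mu> n j u" using s mass[OF jn(1)] \<delta> by (intro mult_right_mono) auto
    then show ?thesis using R_mass[OF jn(3)] zj(3) mass[OF jn(1)] by simp
  qed
  finally have "\<mu> n j u / 2 \<le> \<mu> n j y" by (simp add: blinfun.diff_right)
  then show ?thesis using st' jn y yc' c' by blast
qed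

text \<open>Iteration of \<open>selection_step\<close>: each new element is taken below the part
  \<open>c\<close> left free by the earlier ones, hence is disjoint from them.\<close>

lemma disjoint_selection:
  fixes \<mu> :: "nat \<Rightarrow> nat \<Rightarrow> ('a \<Rightarrow>\<^sub>L real)"
  assumes u: "0 \<le> u" and \<delta>: "0 < \<delta>"
    and pos: "\<And>n i. i < n \<Longrightarrow> dual_le 0 (\<mu> n i)"
    and mass: "\<And>n i. i < n \<Longrightarrow> \<delta> \<le> \<mu> n i u"
    and disj: "\<And>n i j. i < n \<Longrightarrow> j < n \<Longrightarrow> i \<noteq> j \<Longrightarrow> E.disj (\<mu> n i) (\<mu> n j)"
  obtains N i :: "nat \<Rightarrow> nat" and y where "strict_mono i" "\<And>k. i k < N k" "\<And>k. 0 \<le> y k" "\<And>k. y k \<le> u"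
    "\<And>k. \<delta> / 2 \<le> \<mu> (N k) (i k) (y k)" "\<And>k l. k \<noteq> l \<Longrightarrow> inf (y k) (y l) = 0"
proof -
  \<comment> \<open>The increments serve as \<open>\<tau>\<close>; they halve at every step, and
    their total stays below the 1/8 that \<open>selection_step\<close> tolerates.\<close>
  define s where "s k = (1/8) * (1 - (1/2::real)^k)" for k
  have s_le: "s k \<le> 1/8" for k by (simp add: s_def)
  define Pr where "Pr k x = (case x of (c, R, i, n, y) \<Rightarrow> selection_state \<mu> u c R (s k))"
    for k and x :: "'a \<times> (nat \<Rightarrow> nat set) \<times> nat \<times> nat \<times> 'a"
  define Q where "Q x x' = (case x of (c, R, i, n, y) \<Rightarrow> case x' of (c', R', i', n', y') \<Rightarrow>
      i < i' \<and> i' < n' \<and> 0 \<le> y' \<and> y' \<le> c \<and> inf y' c' = 0 \<and> c' \<le> c \<and> c \<le> u \<and> \<mu> n' i' u / 2 \<le> \<mu> n' i' y')"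
    for x x' :: "'a \<times> (nat \<Rightarrow> nat set) \<times> nat \<times> nat \<times> 'a"
  have "\<exists>f. \<forall>k. Pr k (f k) \<and> Q (f k) (f (Suc k))"
  proof (rule dependent_nat_choice)
    \<comment> \<open>The initial state constrains only \<open>c\<close> and \<open>R\<close>; its
      index, row and element are arbitrary, which is why the resulting sequences start at
      \<open>Suc k\<close>.\<close>
    have "selection_state \<mu> u u (\<lambda>n. {..<n}) (s 0)"
      using u by (auto simp: selection_state_def s_def)
    then show "\<exists>x. Pr 0 x" unfolding Pr_def by auto
  next
    fix x k assume "Pr k x"
    moreover obtain c R i n y where x: "x = (c, R, i, n, y)" by (cases x) auto
    ultimately have st: "selection_state \<mu> u c R (s k)" by (simp add: Pr_def)
    have "0 < s (Suc k) - s k" by (simp add: s_def field_simps)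
    from selection_step[OF u \<delta> pos mass disj st s_le this, of i]
    obtain c' R' j n' y' where "selection_state \<mu> u c' R' (s (Suc k))" "i < j" "j < n'" "0 \<le> y'" "y' \<le> c"
      "inf y' c' = 0" "c' \<le> c" "\<mu> n' j u / 2 \<le> \<mu> n' j y'" by auto
    moreover have "c \<le> u" using st by (simp add: selection_state_def)
    ultimately show "\<exists>x'. Pr (Suc k) x' \<and> Q x x'"
      unfolding Pr_def Q_def x by (intro exI[of _ "(c', R', j, n', y')"]) simp
  qed
  then obtain f where f: "\<And>k. Q (f k) (f (Suc k))" by blast
  define c where "c k = fst (f k)" for k
  define i where "i k = fst (snd (snd (f k)))" for k
  define n where "n k = fst (snd (snd (snd (f k))))" for k
  define y where "y k = snd (snd (snd (snd (f k))))" for k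
  have Q: "i k < i (Suc k)" "i (Suc k) < n (Suc k)" "0 \<le> y (Suc k)" "y (Suc k) \<le> c k"
    "inf (y (Suc k)) (c (Suc k)) = 0" "c (Suc k) \<le> c k" "c k \<le> u"
    "\<mu> (n (Suc k)) (i (Suc k)) u / 2 \<le> \<mu> (n (Suc k)) (i (Suc k)) (y (Suc k))" for k
    using f[of k] unfolding Q_def c_def i_def n_def y_def by (auto split: prod.splits)
  have c_anti: "k \<le> l \<Longrightarrow> c l \<le> c k" for k l
    using lift_Suc_antimono_le[of c] Q(6) by blast
  have dj: "inf (y (Suc k)) (y (Suc l)) = 0" if "k < l" for k l
  proof (rule antisym)
    have "y (Suc l) \<le> c (Suc k)" using Q(4)[of l] c_anti[of "Suc k" l] that by auto
    then have "inf (y (Suc k)) (y (Suc l)) \<le> inf (y (Suc k)) (c (Suc k))" by (intro inf_mono) auto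
    then show "inf (y (Suc k)) (y (Suc l)) \<le> 0" using Q(5) by simp
    show "0 \<le> inf (y (Suc k)) (y (Suc l))" using Q(3) by simp
  qed
  show thesis
  proof (rule that[of "\<lambda>k. i (Suc k)" "\<lambda>k. n (Suc k)" "\<lambda>k. y (Suc k)"])
    show "strict_mono (\<lambda>k. i (Suc k))" using Q(1) by (simp add: strict_mono_Suc_iff)
    show "inf (y (Suc k)) (y (Suc l)) = 0" if "k \<noteq> l" for k l
      using dj[of k l] dj[of l k] that by (metis inf_commute nat_neq_iff)
    show "\<delta> / 2 \<le> \<mu> (n (Suc k)) (i (Suc k)) (y (Suc k))" for k
      using Q(8)[of k] mass[OF Q(2)[of k]] by simp
    show "y (Suc k) \<le> u" for k using Q(4,7) order_trans by blast
  qed (use Q in auto)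
qed

subsection \<open>Weak* null sequences and interpolation\<close>

definition dabs :: "('a \<Rightarrow>\<^sub>L real) \<Rightarrow> ('a \<Rightarrow>\<^sub>L real)" where
  "dabs f = E.pp f + E.pp (- f)"

lemma dabs_ge_parts: "dual_le (E.pp f) (dabs f)" "dual_le (E.pp (- f)) (dabs f)"
  using pos_part_nonneg[of f] pos_part_nonneg[of "- f"]
  by (auto simp: dabs_def dual_le_def blinfun.bilinear_simps)

lemma dabs_ge: "dual_le f (dabs f)" "dual_le (- f) (dabs f)"
  using dabs_ge_parts pos_part_ge dual_le_trans by blast+

lemma dabs_nonneg: "dual_le 0 (dabs f)"
  using dabs_ge_parts(1) pos_part_nonneg dual_le_trans by blast

lemma abs_le_dabs: "0 \<le> x \<Longrightarrow> \<bar>blinfun_apply f x\<bar> \<le> dabs f x"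
  using dabs_ge[of f] by (auto simp: dual_le_def blinfun.bilinear_simps abs_le_iff)

lemma norm_dabs: "norm (dabs f) \<le> 2 * norm f"
  using norm_triangle_ineq[of "E.pp f" "E.pp (- f)"] E.norm_pp[of f] E.norm_pp[of "- f"]
  by (simp add: dabs_def)

text \<open>One of the two parts has value at least \<open>\<delta> / 2\<close> at \<open>x\<close>;
  approximating its defining supremum to within \<open>\<delta> / 4\<close> leaves
  \<open>\<delta> / 4\<close>.\<close>

lemma dabs_approx:
  assumes "0 \<le> x" "0 < \<delta>" "\<delta> \<le> dabs f x"
  shows "\<exists>y. 0 \<le> y \<and> y \<le> x \<and> \<delta> / 4 \<le> \<bar>blinfun_apply f y\<bar>"
proof -
  have pos: "\<exists>y. 0 \<le> y \<and> y \<le> x \<and> \<delta> / 4 \<le> blinfun_apply g y" if "\<delta> / 2 \<le> E.pp g x" for g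
    using E.pp_spec(2)[of x "\<delta>/4" g] that assms by fastforce
  have "\<delta> / 2 \<le> E.pp f x \<or> \<delta> / 2 \<le> E.pp (- f) x"
    using assms by (auto simp: dabs_def blinfun.bilinear_simps)
  then show ?thesis
    using pos[of f] pos[of "- f"] by (fastforce simp: blinfun.bilinear_simps)
qed

text \<open>The outer contents \<open>\<rho> k\<close> below are superadditive by interpolation, which replaces the
  countable additivity available in the \<open>\<sigma>\<close>-complete case.\<close>

lemma weak_star_null_on_disjoint:
  fixes fs :: "nat \<Rightarrow> ('a \<Rightarrow>\<^sub>L real)"
  assumes interp: "sigma_interpolation TYPE('a)"
    and null: "\<And>x. (\<lambda>n. fs n x) \<longlonglongrightarrow> 0"
    and z: "\<And>k. 0 \<le> z k" "\<And>k. z k \<le> v" "\<And>k l. k \<noteq> l \<Longrightarrow> inf (z k) (z l) = 0"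
    and \<delta>: "0 < \<delta>" "\<And>k. \<delta> \<le> dabs (fs k) (z k)"
  shows False
proof -
  have interpolate: "\<exists>z. \<forall>n. a n \<le> z \<and> z \<le> b n"
    if "\<forall>n. a n \<le> a (Suc n) \<and> a (Suc n) \<le> b (Suc n) \<and> b (Suc n) \<le> b n" for a b :: "nat \<Rightarrow> 'a"
    using interp[unfolded sigma_interpolation_def, rule_format, of a b] that by blast
  have v: "0 \<le> v" using z(1)[of 0] z(2)[of 0] by simp
  have "\<forall>k. \<exists>y. 0 \<le> y \<and> y \<le> z k \<and> \<delta> / 4 \<le> \<bar>fs k y\<bar>"
    using dabs_approx[OF z(1) \<delta>] by (intro allI)
  from choice[OF this] obtain x where x: "\<And>k. 0 \<le> x k" "\<And>k. x k \<le> z k" "\<And>k. \<delta> / 4 \<le> \<bar>fs k (x k)\<bar>"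
    by blast
  have x_v: "sum x J \<le> v" if "finite J" for J
  proof (rule sum_disjoint_le[OF that v])
    fix i j :: nat assume "i \<noteq> j"
    have "inf (x i) (x j) \<le> inf (z i) (z j)" using x by (intro inf_mono)
    then show "inf (x i) (x j) = 0" using z(3)[OF \<open>i \<noteq> j\<close>] x by (simp add: antisym)
  next
    show "0 \<le> x j \<and> x j \<le> v" for j using x(1,2)[of j] z(2)[of j] by simp
  qed
  obtain B where B: "\<And>n. norm (fs n) \<le> B"
    using uniform_boundedness[of fs "\<lambda>_. 0"] null by blast
  define S where "S A n = sum x (A \<inter> {..<n})" for A n
  have S_mono: "S A n \<le> S A (Suc n)" for A n
    unfolding S_def using x by (intro sum_mono2) auto
  have S_Un: "S (A \<union> B) n = S A n + S B n" if "A \<inter> B = {}" for A B n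
    unfolding S_def using that by (subst sum.union_disjoint[symmetric]) (auto simp: Int_Un_distrib2)
  have S_nn: "0 \<le> S A n" for A n
    unfolding S_def using x by (intro sum_nonneg) auto
  \<comment> \<open>Upper bounds stand in for the supremum of the partial sums, which may fail to
    exist.\<close>
  define U where "U A = {w. 0 \<le> w \<and> (\<forall>n. S A n \<le> w)}" for A
  have vU: "v \<in> U A" for A using v x_v by (auto simp: U_def S_def)
  define \<rho> where "\<rho> k A = (INF w\<in>U A. dabs (fs k) w)" for k A
  have bdd: "bdd_below ((\<lambda>w. dabs (fs k) w) ` U A)" for k A
    using dual_posD[OF dabs_nonneg] by (auto simp: bdd_below_def U_def)
  have \<rho>_le: "\<rho> k A \<le> dabs (fs k) w" if "w \<in> U A" for k A w
    unfolding \<rho>_def using that by (intro cINF_lower bdd)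
  have "\<exists>A. infinite A \<and> (\<forall>k\<in>A. \<rho> k (A - {k}) \<le> \<delta> / 32)"
  proof (rule rosenthal_disjointification)
    show "0 \<le> \<rho> k A" for k A
      unfolding \<rho>_def using vU dual_posD[OF dabs_nonneg] by (intro cINF_greatest) (auto simp: U_def)
    show "\<rho> k UNIV \<le> 2 * B * norm v" for k
    proof -
      have "\<rho> k UNIV \<le> dabs (fs k) v" using \<rho>_le vU by blast
      also have "\<dots> \<le> norm (dabs (fs k)) * norm v" using norm_blinfun[of "dabs (fs k)" v] by simp
      also have "\<dots> \<le> 2 * B * norm v"
        using norm_dabs[of "fs k"] B[of k] by (intro mult_right_mono) auto
      finally show ?thesis .
    qed
    show "\<rho> k A + \<rho> k B \<le> \<rho> k (A \<union> B)" if AB: "A \<inter> B = {}" for k A B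
      unfolding \<rho>_def[of k "A \<union> B"]
    proof (rule cINF_greatest)
      fix w assume w: "w \<in> U (A \<union> B)"
      have le: "S A n + S B n \<le> w" for n using w S_Un[OF AB] by (auto simp: U_def)
      \<comment> \<open>The interpolating \<open>a\<close> splits \<open>w\<close> into an upper
        bound \<open>a\<close> for the sums over \<open>A\<close> and an upper bound
        \<open>w - a\<close> for those over \<open>B\<close>.\<close>
      have "\<forall>n. S A n \<le> S A (Suc n) \<and> S A (Suc n) \<le> w - S B (Suc n) \<and> w - S B (Suc n) \<le> w - S B n"
        using S_mono le by (auto simp: algebra_simps)
      from interpolate[OF this] obtain a where a: "\<And>n. S A n \<le> a" "\<And>n. a \<le> w - S B n"
        by blast
      have "0 \<le> a" using a(1)[of 0] S_nn[of A 0] by simp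
      moreover have "S B n \<le> w - a" for n using a(2)[of n] by (simp add: algebra_simps)
      moreover from this[of 0] have "0 \<le> w - a" using S_nn[of B 0] by (rule order_trans[rotated])
      ultimately have "a \<in> U A" "w - a \<in> U B" using a by (auto simp: U_def)
      then have "\<rho> k A \<le> dabs (fs k) a" "\<rho> k B \<le> dabs (fs k) (w - a)" using \<rho>_le by auto
      then show "\<rho> k A + \<rho> k B \<le> dabs (fs k) w" by (simp add: blinfun.diff_right)
    qed (use vU in blast)
  qed (use \<delta> in simp)
  then obtain A where A: "infinite A" "\<And>k. k \<in> A \<Longrightarrow> \<rho> k (A - {k}) \<le> \<delta> / 32" by blast
  have "\<exists>w\<in>U (A - {k}). dabs (fs k) w < \<delta> / 16" if "k \<in> A" for k
  proof -
    have "\<rho> k (A - {k}) < \<delta> / 16" using A(2)[OF that] \<delta> by simp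
    then show ?thesis unfolding \<rho>_def using vU bdd by (subst (asm) cINF_less_iff) auto
  qed
  then obtain w where w: "\<And>k. k \<in> A \<Longrightarrow> w k \<in> U (A - {k})" "\<And>k. k \<in> A \<Longrightarrow> dabs (fs k) (w k) < \<delta> / 16"
    by metis
  have S_w: "S A n \<le> w k + x k" if "k \<in> A" for k n
  proof -
    have "S A n \<le> S (A - {k}) n + S {k} n"
      using S_Un[of "A - {k}" "{k}" n] that by (simp add: insert_absorb)
    also have "S (A - {k}) n \<le> w k" using w(1)[OF that] by (simp add: U_def)
    also have "S {k} n \<le> x k" using x by (cases "k < n") (auto simp: S_def)
    finally show ?thesis by simp
  qed
  \<comment> \<open>Running meets merge the separate bounds \<open>w k + x k\<close> into one
    decreasing sequence, so that a single \<open>t\<close> can satisfy \<open>x k \<le> t\<close>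
    and \<open>t \<le> w k + x k\<close> for all \<open>k\<close> in \<open>A\<close>.\<close>
  define Y where "Y = rec_nat v (\<lambda>n y. if n \<in> A then inf y (w n + x n) else y)"
  have Y: "Y 0 = v" "\<And>n. Y (Suc n) = (if n \<in> A then inf (Y n) (w n + x n) else Y n)"
    by (auto simp: Y_def)
  have SY: "S A m \<le> Y n" for m n
    by (induction n) (use Y vU S_w in \<open>auto simp: U_def\<close>)
  have "\<forall>n. S A n \<le> S A (Suc n) \<and> S A (Suc n) \<le> Y (Suc n) \<and> Y (Suc n) \<le> Y n"
    by (intro allI conjI S_mono SY) (simp add: Y(2))
  from interpolate[OF this] obtain t where t: "\<And>n. S A n \<le> t" "\<And>n. t \<le> Y n"
    by blast
  \<comment> \<open>\<open>fs k t\<close> differs by less than \<open>\<delta> / 16\<close> from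
    \<open>fs k (x k)\<close>, whose modulus is at least \<open>\<delta> / 4\<close>.\<close>
  have big: "\<delta> / 8 \<le> \<bar>fs k t\<bar>" if k: "k \<in> A" for k
  proof -
    have "x k \<le> S A (Suc k)"
      unfolding S_def using x k sum_mono2[of "A \<inter> {..<Suc k}" "{k}" x] by simp
    then have "x k \<le> t" using t(1)[of "Suc k"] by simp
    then have 1: "0 \<le> t - x k" by simp
    have "t \<le> w k + x k" using t(2)[of "Suc k"] Y(2)[of k] k by simp
    then have 2: "t - x k \<le> w k" by (simp add: algebra_simps)
    have "\<bar>fs k (t - x k)\<bar> \<le> dabs (fs k) (t - x k)" using abs_le_dabs[OF 1] .
    also have "\<dots> \<le> dabs (fs k) (w k)" using dual_pos_mono[OF dabs_nonneg 2] .
    also have "\<dots> < \<delta> / 16" using w(2)[OF k] .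
    finally have "\<bar>fs k t - fs k (x k)\<bar> < \<delta> / 16" by (simp add: blinfun.diff_right)
    then show ?thesis using x(3)[of k] \<delta>(1) by linarith
  qed
  obtain N where "\<And>n. n \<ge> N \<Longrightarrow> \<bar>fs n t\<bar> < \<delta> / 8"
    using LIMSEQ_D[OF null[of t], of "\<delta> / 8"] \<delta> by auto
  moreover obtain k where "k \<in> A" "N \<le> k" using A(1) by (meson infinite_nat_iff_unbounded_le)
  ultimately show False using big[of k] by (meson not_less)
qed

subsection \<open>Adjoints that are lattice homomorphisms\<close>

lemma rsup_dual_eqI: "is_sup2 dual_le f g s \<Longrightarrow> rsup dual_le f (g :: 'a \<Rightarrow>\<^sub>L real) = s"
  unfolding rsup_def by (rule the_equality) (auto simp: is_sup2_def intro: dual_le_antisym)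

text \<open>\<open>rsup\<close> is a definite description and says something only once a supremum is
  exhibited; translating the positive part supplies it.\<close>

lemma rsup_dual: "rsup dual_le f g = g + E.pp (f - (g :: 'a \<Rightarrow>\<^sub>L real))"
proof (rule rsup_dual_eqI)
  have "dual_le f (g + E.pp (f - g))" "dual_le g (g + E.pp (f - g))"
    using pos_part_ge[of "f - g"] pos_part_nonneg[of "f - g"]
    by (auto simp: dual_le_def blinfun.bilinear_simps algebra_simps)
  moreover have "dual_le (g + E.pp (f - g)) w" if "dual_le f w" "dual_le g w" for w
    using pos_part_least[of "w - g" "f - g"] that
    by (auto simp: dual_le_def blinfun.bilinear_simps algebra_simps)
  ultimately show "is_sup2 dual_le f g (g + E.pp (f - g))" by (auto simp: is_sup2_def)
qed

lemma rsup_disjoint: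
  fixes \<mu> \<nu> :: "'a \<Rightarrow>\<^sub>L real"
  assumes "dual_le 0 \<mu>" "dual_le 0 \<nu>" "E.disj \<mu> \<nu>"
  shows "rsup dual_le \<mu> \<nu> = \<mu> + \<nu>"
proof (rule rsup_dual_eqI)
  have "dual_le (\<mu> + \<nu>) w" if w: "dual_le \<mu> w" "dual_le \<nu> w" for w
    unfolding dual_le_def
  proof (intro allI impI)
    fix x :: 'a assume x: "0 \<le> x"
    show "(\<mu> + \<nu>) x \<le> w x"
    proof (rule field_le_epsilon)
      fix \<eta> :: real assume "0 < \<eta>"
      then obtain y where y: "0 \<le> y" "y \<le> x" "\<mu> (x - y) + \<nu> y < \<eta>"
        using dual_disjD[OF assms(3) x] by blast
      have "\<mu> y \<le> w y" "\<nu> (x - y) \<le> w (x - y)"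
        using dual_leD[OF w(1) y(1)] dual_leD[OF w(2), of "x - y"] y by auto
      then show "(\<mu> + \<nu>) x \<le> w x + \<eta>" using y(3) by (simp add: blinfun.bilinear_simps)
    qed
  qed
  then show "is_sup2 dual_le \<mu> \<nu> (\<mu> + \<nu>)"
    using assms(1,2) by (auto simp: is_sup2_def dual_le_def blinfun.bilinear_simps)
qed

text \<open>The adjoint sends the supremum \<open>\<mu> + \<nu>\<close> to the supremum of the
  images. Cancelling in \<open>rsup_dual\<close> identifies the images with the positive and
  negative parts of their difference.\<close>

lemma adjoint_preserves_disj:
  fixes \<mu> \<nu> :: "'a \<Rightarrow>\<^sub>L real"
  assumes "lattice_hom dual_le (adjoint_op T)" "dual_le 0 \<mu>" "dual_le 0 \<nu>" "E.disj \<mu> \<nu>"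
  shows "E.disj (adjoint_op T \<mu>) (adjoint_op T \<nu>)"
proof -
  let ?a = "adjoint_op T \<mu>" and ?b = "adjoint_op T \<nu>"
  have "adjoint_op T (\<mu> + \<nu>) = rsup dual_le ?a ?b"
    using assms(1) rsup_disjoint[OF assms(2-4)] unfolding lattice_hom_def by metis
  then have "?a + ?b = ?b + E.pp (?a - ?b)"
    unfolding rsup_dual by (simp add: adjoint_op_def bounded_bilinear.add_left[OF bounded_bilinear_blinfun_compose])
  then have "E.pp (?a - ?b) = ?a" "E.pp (- (?a - ?b)) = ?b"
    using E.pp_uminus[of "?a - ?b"] by simp_all
  then show ?thesis using E.disj_pp by metis
qed

subsection \<open>Finite approximation of bidual functionals\<close>

text \<open>Gradient descent on the squared deficit \<open>Q\<close> replaces a separation argument in \<open>\<real>\<^sup>N\<close>.\<close>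

lemma finite_goldstine:
  fixes \<phi> :: "('a \<Rightarrow>\<^sub>L real) \<Rightarrow>\<^sub>L real" and us :: "nat \<Rightarrow> ('a \<Rightarrow>\<^sub>L real)"
  assumes \<epsilon>: "0 < \<epsilon>" and us: "\<And>i. i < N \<Longrightarrow> \<epsilon> \<le> \<phi> (us i)" and \<phi>: "\<phi> \<noteq> 0"
  shows "\<exists>x. norm x \<le> 1 \<and> (\<forall>i<N. \<epsilon> / (8 * norm \<phi>) \<le> us i x)"
proof -
  \<comment> \<open>In units of \<open>d\<close> times the total deficit, \<open>norm w\<close> is
    at least 4. Half of it is lost since \<open>z\<close> norms \<open>w\<close> up to a factor 2,
    and the values at \<open>x\<close> take away at most 1, so a gain of 1 remains. The claimed
    constant is \<open>d / 2\<close>.\<close>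
  define d where "d = \<epsilon> / (4 * norm \<phi>)"
  have d: "0 < d" using \<epsilon> \<phi> by (simp add: d_def)
  define p where "p t = max 0 t" for t :: real
  have p_nn: "0 \<le> p t" for t by (simp add: p_def)
  \<comment> \<open>A quadratic majorant of the squared positive part with its slope
    \<open>2 * p a\<close>, which is what a descent estimate needs.\<close>
  have p_sq: "(p (a - b))\<^sup>2 \<le> (p a)\<^sup>2 - 2 * p a * b + b\<^sup>2" for a b
  proof (cases "a \<le> 0 \<or> a - b \<le> 0")
    case True
    have "0 \<le> (p a - b)\<^sup>2" by simp
    show ?thesis
    proof (cases "a \<le> 0")
      case True
      then have "p a = 0" "\<bar>p (a - b)\<bar> \<le> \<bar>b\<bar>" by (auto simp: p_def)
      then show ?thesis using abs_le_square_iff[of "p (a - b)" b] by simp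
    next
      case False
      then have "p (a - b) = 0" using True by (auto simp: p_def)
      then show ?thesis using \<open>0 \<le> (p a - b)\<^sup>2\<close> by (simp add: power2_diff)
    qed
  next
    case False
    then show ?thesis by (simp add: p_def power2_diff)
  qed
  define Q where "Q x = (\<Sum>i<N. (p (d - us i x))\<^sup>2)" for x
  have Q_nn: "0 \<le> Q x" for x by (auto simp: Q_def intro: sum_nonneg)
  define L where "L = (\<Sum>i<N. (2 * norm (us i))\<^sup>2) + 1"
  have L: "0 < L" by (auto simp: L_def intro!: add_nonneg_pos sum_nonneg)
  define q where "q = (INF x\<in>{x. norm x \<le> 1}. Q x)"
  have bdd: "bdd_below (Q ` {x. norm x \<le> 1})" using Q_nn by (auto simp: bdd_below_def)
  have q_le: "q \<le> Q x" if "norm x \<le> 1" for x unfolding q_def using that bdd by (intro cINF_lower) auto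
  have q_nn: "0 \<le> q" unfolding q_def by (rule cINF_greatest) (auto intro: exI[of _ 0] simp: Q_nn)
  have q_approx: "\<exists>x. norm x \<le> 1 \<and> Q x < q + \<eta>" if "0 < \<eta>" for \<eta>
  proof -
    have "(0::'a) \<in> {x. norm x \<le> 1}" by simp
    then have "{x::'a. norm x \<le> 1} \<noteq> {}" by blast
    from cINF_less_iff[OF this bdd, of "q + \<eta>"] that show ?thesis by (simp add: q_def)
  qed
  \<comment> \<open>Move from \<open>x\<close> towards a vector of the ball on which the
    deficit-weighted sum \<open>w\<close> is large; by convexity \<open>y\<close> stays in the
    ball.\<close>
  have descent: "\<exists>y. norm y \<le> 1 \<and> Q y \<le> Q x - 2 * s * d * sqrt q + s\<^sup>2 * L"
    if x: "norm x \<le> 1" and s: "0 \<le> s" "s \<le> 1" for x s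
  proof -
    define l where "l i = p (d - us i x)" for i
    define w where "w = (\<Sum>i<N. l i *\<^sub>R us i)"
    have l_nn: "0 \<le> l i" for i by (simp add: l_def p_nn)
    have "\<epsilon> * sum l {..<N} \<le> \<phi> w"
    proof -
      have "\<epsilon> * sum l {..<N} = (\<Sum>i<N. l i * \<epsilon>)" by (simp add: sum_distrib_left mult.commute)
      also have "\<dots> \<le> (\<Sum>i<N. l i * \<phi> (us i))" using us l_nn by (intro sum_mono mult_left_mono) auto
      also have "\<dots> = \<phi> w" by (simp add: w_def blinfun.sum_right blinfun.scaleR_right)
      finally show ?thesis .
    qed
    also have "\<phi> w \<le> norm \<phi> * norm w" using norm_blinfun[of \<phi> w] by simp
    finally have w_norm: "4 * d * sum l {..<N} \<le> norm w"
      using \<phi> by (simp add: d_def field_simps)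
    have "\<exists>z. norm z \<le> 1 \<and> norm w / 2 \<le> w z"
    proof (cases "w = 0")
      case False
      have "\<exists>z. norm w / 2 * norm z < norm (w z)"
      proof (rule ccontr)
        assume "\<not> ?thesis"
        then have "norm w \<le> norm w / 2" by (intro norm_blinfun_bound) (auto simp: not_less)
        then show False using False by simp
      qed
      then obtain z where z: "norm w / 2 * norm z < \<bar>w z\<bar>" by auto
      then have z0: "0 < norm z" using False by (auto simp: blinfun.bilinear_simps)
      define z' where "z' = (sgn (w z) / norm z) *\<^sub>R z"
      have "norm z' \<le> 1" using z0 by (simp add: z'_def abs_sgn_eq)
      moreover have "w z' = \<bar>w z\<bar> / norm z" by (simp add: z'_def blinfun.scaleR_right sgn_if)
      moreover have "norm w / 2 \<le> \<bar>w z\<bar> / norm z" using z z0 by (simp add: field_simps)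
      ultimately show ?thesis by (intro exI[of _ z']) simp
    qed (auto intro: exI[of _ 0])
    then obtain z where z: "norm z \<le> 1" "norm w / 2 \<le> w z" by blast
    define y where "y = x + s *\<^sub>R (z - x)"
    have "y = (1 - s) *\<^sub>R x + s *\<^sub>R z" by (simp add: y_def algebra_simps)
    then have "norm y \<le> (1 - s) * norm x + s * norm z"
      using norm_triangle_ineq[of "(1 - s) *\<^sub>R x" "s *\<^sub>R z"] s by simp
    also have "\<dots> \<le> (1 - s) * 1 + s * 1" using x z s by (intro add_mono mult_left_mono) auto
    finally have y: "norm y \<le> 1" by simp
    have "Q y \<le> (\<Sum>i<N. (l i)\<^sup>2 - 2 * l i * (s * us i (z - x)) + (s * us i (z - x))\<^sup>2)"
      unfolding Q_def
    proof (rule sum_mono)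
      fix i
      have eq: "d - us i y = (d - us i x) - s * us i (z - x)"
        by (simp add: y_def blinfun.add_right blinfun.scaleR_right)
      show "(p (d - us i y))\<^sup>2 \<le> (l i)\<^sup>2 - 2 * l i * (s * us i (z - x)) + (s * us i (z - x))\<^sup>2"
        unfolding eq l_def by (rule p_sq)
    qed
    also have "\<dots> = Q x - 2 * s * (\<Sum>i<N. l i * us i (z - x)) + s\<^sup>2 * (\<Sum>i<N. (us i (z - x))\<^sup>2)"
      by (simp add: Q_def l_def sum.distrib sum_subtractf sum_distrib_left power_mult_distrib algebra_simps)
    also have "\<dots> \<le> Q x - 2 * s * (d * sqrt q) + s\<^sup>2 * L"
    proof -
      have "(\<Sum>i<N. l i * us i (z - x)) = w z - (\<Sum>i<N. l i * us i x)"
        by (simp add: w_def blinfun.sum_left blinfun.scaleR_left blinfun.diff_right sum_subtractf algebra_simps)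
      moreover have "(\<Sum>i<N. l i * us i x) \<le> (\<Sum>i<N. l i * d)"
      proof (rule sum_mono)
        fix i show "l i * us i x \<le> l i * d"
          by (cases "us i x \<le> d") (use l_nn[of i] in \<open>auto simp: l_def p_def intro: mult_left_mono\<close>)
      qed
      moreover have "(\<Sum>i<N. l i * d) = d * sum l {..<N}" by (simp add: sum_distrib_left mult.commute)
      ultimately have 1: "d * sum l {..<N} \<le> (\<Sum>i<N. l i * us i (z - x))" using w_norm z(2) by simp
      \<comment> \<open>The gain involves the sum of the deficits and \<open>Q\<close> the sum of
        their squares; the l2 norm is at most the l1 norm.\<close>
      have "sqrt q \<le> sqrt (Q x)" using q_le[OF x] by simp
      also have "\<dots> = L2_set l {..<N}" by (simp add: L2_set_def Q_def l_def)
      also have "\<dots> \<le> sum l {..<N}" using l_nn by (intro L2_set_le_sum) auto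
      finally have "d * sqrt q \<le> (\<Sum>i<N. l i * us i (z - x))" using 1 d by (meson mult_left_mono order_trans less_imp_le)
      then have "s * (d * sqrt q) \<le> s * (\<Sum>i<N. l i * us i (z - x))" using s by (intro mult_left_mono) auto
      moreover have "(\<Sum>i<N. (us i (z - x))\<^sup>2) \<le> L"
      proof -
        have "(\<Sum>i<N. (us i (z - x))\<^sup>2) \<le> (\<Sum>i<N. (2 * norm (us i))\<^sup>2)"
        proof (rule sum_mono)
          fix i
          have "\<bar>us i (z - x)\<bar> \<le> norm (us i) * norm (z - x)" using norm_blinfun[of "us i" "z - x"] by simp
          also have "\<dots> \<le> norm (us i) * 2"
            using norm_triangle_ineq4[of z x] x z by (intro mult_left_mono) auto
          finally have "\<bar>us i (z - x)\<bar> \<le> \<bar>2 * norm (us i)\<bar>" by simp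
          then show "(us i (z - x))\<^sup>2 \<le> (2 * norm (us i))\<^sup>2" by (rule abs_le_square_iff[THEN iffD1])
        qed
        then show ?thesis by (simp add: L_def)
      qed
      then have "s\<^sup>2 * (\<Sum>i<N. (us i (z - x))\<^sup>2) \<le> s\<^sup>2 * L" by (intro mult_left_mono) auto
      ultimately show ?thesis by linarith
    qed
    finally show ?thesis using y by (auto simp: mult.assoc)
  qed
  have "q = 0"
  proof (rule ccontr)
    assume "q \<noteq> 0"
    then have q: "0 < q" using q_nn by simp
    define g where "g = d * sqrt q"
    have g: "0 < g" using d q by (simp add: g_def)
    \<comment> \<open>With \<open>s * L \<le> g\<close> the quadratic error eats at most half of the
      gain \<open>2 * s * g\<close>, so a start within \<open>s * g\<close> of the infimum ends
      below it.\<close>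
    define s where "s = min 1 (g / L)"
    have s: "0 < s" "s \<le> 1" "s * L \<le> g" using g L by (auto simp: s_def min_def field_simps)
    obtain x where x: "norm x \<le> 1" "Q x < q + s * g" using q_approx[of "s * g"] s g by auto
    obtain y where y: "norm y \<le> 1" "Q y \<le> Q x - 2 * s * d * sqrt q + s\<^sup>2 * L"
      using descent[OF x(1), of s] s by auto
    have "s\<^sup>2 * L \<le> s * g" using s by (simp add: power2_eq_square mult.assoc mult_left_mono)
    then have "Q y < q" using y(2) x(2) by (simp add: g_def algebra_simps)
    then show False using q_le[OF y(1)] by simp
  qed
  then obtain x where x: "norm x \<le> 1" "Q x < (d / 2)\<^sup>2" using q_approx[of "(d / 2)\<^sup>2"] d by auto
  have "d / 2 \<le> us i x" if "i < N" for i
  proof -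
    have "(p (d - us i x))\<^sup>2 \<le> Q x" unfolding Q_def using that by (intro member_le_sum) auto
    then have "(p (d - us i x))\<^sup>2 < (d / 2)\<^sup>2" using x by simp
    then have "p (d - us i x) < d / 2" using d power_less_imp_less_base by fastforce
    then have "d - us i x < d / 2" unfolding p_def by linarith
    then show ?thesis by simp
  qed
  then show ?thesis using x(1) by (auto simp: d_def intro!: exI[of _ x])
qed

subsection \<open>Weak convergence in a dual with order continuous norm\<close>

lemma dual_add_mono: "dual_le (f::'a \<Rightarrow>\<^sub>L real) g \<Longrightarrow> dual_le f' g' \<Longrightarrow> dual_le (f + f') (g + g')"
  by (auto simp: dual_le_def blinfun.bilinear_simps intro: add_mono)

lemma dual_scale_mono: "dual_le (f::'a \<Rightarrow>\<^sub>L real) g \<Longrightarrow> 0 \<le> c \<Longrightarrow> dual_le (c *\<^sub>R f) (c *\<^sub>R g)"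
  by (auto simp: dual_le_def blinfun.bilinear_simps intro: mult_left_mono)

lemma dual_scale_nonneg: "dual_le 0 (f::'a \<Rightarrow>\<^sub>L real) \<Longrightarrow> 0 \<le> c \<Longrightarrow> dual_le 0 (c *\<^sub>R f)"
  using dual_scale_mono[of 0 f c] by simp

lemma dual_decomp:
  fixes f g h :: "'a \<Rightarrow>\<^sub>L real"
  assumes "dual_le 0 f" "dual_le 0 g" "dual_le 0 h" "dual_le h (f + g)"
  obtains h1 h2 where "h = h1 + h2" "dual_le 0 h1" "dual_le 0 h2" "dual_le h1 f" "dual_le h2 g"
  using F.decomp[of f g h] assms by auto

lemma bidual_mono:
  fixes \<psi> :: "('a \<Rightarrow>\<^sub>L real) \<Rightarrow>\<^sub>L real"
  assumes "\<And>f. dual_le 0 f \<Longrightarrow> 0 \<le> blinfun_apply \<psi> f" "dual_le f g"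
  shows "\<psi> f \<le> \<psi> g"
  using assms(1)[of "g - f"] assms(2) by (simp add: blinfun.diff_right)

lemma oc_approx:
  fixes D :: "('a \<Rightarrow>\<^sub>L real) set"
  assumes oc: "order_continuous_norm (dual_le :: ('a \<Rightarrow>\<^sub>L real) \<Rightarrow> _ \<Rightarrow> bool)"
    and D: "downward_directed dual_le D" "is_glb dual_le D 0" and "0 < \<eta>"
  shows "\<exists>d\<in>D. norm d < \<eta>"
proof (rule ccontr)
  assume "\<not> ?thesis"
  then have "\<eta> \<le> (INF d\<in>D. norm d)"
    using D(1) by (intro cINF_greatest) (auto simp: downward_directed_def not_less)
  moreover have "(INF d\<in>D. norm d) = 0"
    using oc D unfolding order_continuous_norm_def by blast
  ultimately show False using \<open>0 < \<eta>\<close> by simp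
qed

text \<open>\<open>directed_sup\<close> provides suprema, so \<open>a\<close> is minus the supremum
  of the \<open>- b n\<close>. The differences \<open>b n - a\<close> have infimum 0, and order
  continuity makes their norms small.\<close>

lemma decreasing_dual_limit:
  fixes b :: "nat \<Rightarrow> ('a \<Rightarrow>\<^sub>L real)"
  assumes oc: "order_continuous_norm (dual_le :: ('a \<Rightarrow>\<^sub>L real) \<Rightarrow> _ \<Rightarrow> bool)"
    and nn: "\<And>n. dual_le 0 (b n)" and dec: "\<And>n. dual_le (b (Suc n)) (b n)"
  obtains a where "dual_le 0 a" "\<And>n. dual_le a (b n)" "\<And>\<eta>. 0 < \<eta> \<Longrightarrow> \<exists>n. norm (b n - a) < \<eta>"
proof -
  have anti: "dual_le (b n) (b m)" if "m \<le> n" for m n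
    using that by (induction rule: dec_induct) (use dec dual_le_trans in auto)
  have "\<exists>\<psi>::'a \<Rightarrow>\<^sub>L real. \<forall>a\<in>{x. 0 \<le> x}. (\<forall>d\<in>range (\<lambda>n. - b n). blinfun_apply d a \<le> \<psi> a) \<and>
      (\<forall>\<eta>>0. \<exists>d\<in>range (\<lambda>n. - b n). \<psi> a - \<eta> < blinfun_apply d a)"
  proof (rule E.directed_sup[where h = 0])
    fix d d' assume "d \<in> range (\<lambda>n. - b n)" "d' \<in> range (\<lambda>n. - b n)"
    then obtain m n where mn: "d = - b m" "d' = - b n" by auto
    show "\<exists>e\<in>range (\<lambda>n. - b n). \<forall>a\<in>{x. 0 \<le> x}. d a \<le> blinfun_apply e a \<and> d' a \<le> blinfun_apply e a"
      by (rule bexI[of _ "- b (max m n)"])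
        (use anti[of m "max m n"] anti[of n "max m n"] mn in \<open>auto simp: dual_le_def blinfun.bilinear_simps\<close>)
  next
    fix d and a :: 'a assume "d \<in> range (\<lambda>n. - b n)" "a \<in> {x. 0 \<le> x}"
    then show "blinfun_apply d a \<le> blinfun_apply 0 a"
      using nn by (auto simp: dual_le_def blinfun.bilinear_simps)
  qed auto
  then obtain \<psi> :: "'a \<Rightarrow>\<^sub>L real" where
    \<psi>: "\<forall>a\<in>{x. 0 \<le> x}. (\<forall>d\<in>range (\<lambda>n. - b n). blinfun_apply d a \<le> \<psi> a) \<and>
      (\<forall>\<eta>>0. \<exists>d\<in>range (\<lambda>n. - b n). \<psi> a - \<eta> < blinfun_apply d a)" ..
  have le: "(- \<psi>) x \<le> b n x" if "0 \<le> x" for x n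
  proof -
    have "(- b n) x \<le> \<psi> x" using \<psi> that by blast
    then show ?thesis by (simp add: blinfun.bilinear_simps)
  qed
  have approx: "\<exists>n. b n x < (- \<psi>) x + \<eta>" if x\<eta>: "0 \<le> x" "0 < \<eta>" for x \<eta>
  proof -
    have "\<exists>d\<in>range (\<lambda>n. - b n). \<psi> x - \<eta> < blinfun_apply d x" using \<psi> x\<eta> by blast
    then obtain n where "\<psi> x - \<eta> < (- b n) x" by blast
    then show ?thesis by (intro exI[of _ n]) (simp add: blinfun.bilinear_simps)
  qed
  have a_nn: "dual_le 0 (- \<psi>)"
    unfolding dual_le_def
  proof (intro allI impI)
    fix x :: 'a assume x: "0 \<le> x"
    have "0 \<le> (- \<psi>) x"
    proof (rule field_le_epsilon)
      fix \<eta> :: real assume "0 < \<eta>"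
      then obtain n where "b n x < (- \<psi>) x + \<eta>" using approx[OF x] by blast
      then show "0 \<le> (- \<psi>) x + \<eta>" using dual_posD[OF nn[of n] x] by simp
    qed
    then show "blinfun_apply 0 x \<le> (- \<psi>) x" by simp
  qed
  define D where "D = range (\<lambda>n. b n - (- \<psi>))"
  have "downward_directed dual_le D"
    unfolding downward_directed_def D_def
  proof (intro conjI ballI)
    fix p q assume "p \<in> range (\<lambda>n. b n - (- \<psi>))" "q \<in> range (\<lambda>n. b n - (- \<psi>))"
    then obtain m n where mn: "p = b m - (- \<psi>)" "q = b n - (- \<psi>)" by auto
    show "\<exists>c\<in>range (\<lambda>n. b n - (- \<psi>)). dual_le c p \<and> dual_le c q"
      by (rule bexI[of _ "b (max m n) - (- \<psi>)"])
        (use anti[of m "max m n"] anti[of n "max m n"] mn in \<open>auto simp: dual_le_def blinfun.bilinear_simps\<close>)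
  qed simp
  moreover have "is_glb dual_le D 0"
    unfolding is_glb_def D_def
  proof (intro conjI ballI allI impI)
    fix d assume "d \<in> range (\<lambda>n. b n - (- \<psi>))"
    then obtain n where d: "d = b n - (- \<psi>)" by blast
    have "dual_le (- \<psi>) (b n)" unfolding dual_le_def using le by blast
    then show "dual_le 0 d" unfolding d by (simp only: dual_le_diff)
  next
    fix w assume w: "\<forall>d\<in>range (\<lambda>n. b n - (- \<psi>)). dual_le w d"
    show "dual_le w 0"
      unfolding dual_le_def
    proof (intro allI impI)
      fix x :: 'a assume x: "0 \<le> x"
      have "w x \<le> 0"
      proof (rule field_le_epsilon)
        fix \<eta> :: real assume "0 < \<eta>"
        then obtain n where "b n x < (- \<psi>) x + \<eta>" using approx[OF x] by blast
        moreover have "dual_le w (b n - (- \<psi>))" using w by blast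
        ultimately show "w x \<le> 0 + \<eta>" using dual_leD[of w _ x] x by (fastforce simp: blinfun.bilinear_simps)
      qed
      then show "w x \<le> blinfun_apply 0 x" by simp
    qed
  qed
  ultimately have "\<exists>n. norm (b n - (- \<psi>)) < \<eta>" if "0 < \<eta>" for \<eta>
    using oc_approx[OF oc, of D \<eta>] that by (auto simp: D_def)
  then show thesis using that[of "- \<psi>"] a_nn le by (auto simp: dual_le_def)
qed

text \<open>Disjointness of the two parts of \<open>\<sigma>\<close> yields \<open>a n\<close> below
  \<open>e\<close> with \<open>F.pp \<sigma> (e - a n)\<close> and
  \<open>F.pp (- \<sigma>) (a n)\<close> tiny. Finite meets of \<open>e\<close> with the
  \<open>a n\<close> approach a limit in norm by order continuity, and the negative part of
  \<open>\<sigma>\<close> vanishes on that limit.\<close>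

lemma hahn_decomposition_approx:
  fixes \<sigma> :: "('a \<Rightarrow>\<^sub>L real) \<Rightarrow>\<^sub>L real"
  assumes oc: "order_continuous_norm (dual_le :: ('a \<Rightarrow>\<^sub>L real) \<Rightarrow> _ \<Rightarrow> bool)"
    and e: "dual_le 0 e" and \<eta>: "0 < \<eta>"
  obtains a where "dual_le 0 a" "dual_le a e" "\<And>b. dual_le 0 b \<Longrightarrow> dual_le b a \<Longrightarrow> 0 \<le> \<sigma> b" "\<sigma> (e - a) \<le> \<eta>"
proof -
  let ?p = "F.pp \<sigma>" and ?m = "F.pp (- \<sigma>)"
  have p_nn: "0 \<le> ?p f" and m_nn: "0 \<le> ?m f" and p_ge: "\<sigma> f \<le> ?p f" if "dual_le 0 f" for f
    using F.pp_nonneg[of f] F.pp_ge[of f \<sigma>] that by auto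
  have m_eq: "?m f = ?p f - \<sigma> f" for f by (simp add: F.pp_uminus blinfun.diff_left)
  have p_mono: "?p f \<le> ?p g" and m_mono: "?m f \<le> ?m g" if "dual_le f g" for f g
    using bidual_mono[OF p_nn that] bidual_mono[OF m_nn that] by simp_all
  have "\<exists>b. dual_le 0 b \<and> dual_le b e \<and> ?p (e - b) + ?m b < \<theta>" if "0 < \<theta>" for \<theta>
    using F.disj_pp[of \<sigma>] e that unfolding F.disj_def by fastforce
  \<comment> \<open>These errors sum to \<open>\<eta> / 2\<close>; the other half pays for replacing
    a finite meet by the limit.\<close>
  then have "\<forall>n. \<exists>b. dual_le 0 b \<and> dual_le b e \<and> ?p (e - b) + ?m b < \<eta> / 2 ^ (n + 2)" for n :: nat
    using \<eta> by simp
  then obtain a where a: "\<And>n. dual_le 0 (a n)" "\<And>n. dual_le (a n) e" "\<And>n::nat. ?p (e - a n) + ?m (a n) < \<eta> / 2 ^ (n + 2)"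
    by metis
  \<comment> \<open>\<open>f - E.pp (f - a n)\<close> is the infimum of \<open>f\<close> and
    \<open>a n\<close>.\<close>
  define b where "b = rec_nat e (\<lambda>n f. f - E.pp (f - a n))"
  have b: "b 0 = e" "\<And>n. b (Suc n) = b n - E.pp (b n - a n)" by (auto simp: b_def)
  have bn: "dual_le 0 (b n) \<and> dual_le (b n) e" for n
  proof (induction n)
    case 0 then show ?case using e b by simp
  next
    case (Suc n)
    have "dual_le (E.pp (b n - a n)) (b n)"
      by (rule pos_part_least) (use Suc a(1)[of n] in \<open>auto simp: dual_le_def blinfun.bilinear_simps\<close>)
    moreover have "dual_le (b (Suc n)) (b n)"
      using pos_part_nonneg[of "b n - a n"] by (simp add: b dual_le_def blinfun.bilinear_simps)
    ultimately show ?case using Suc dual_le_trans by (auto simp: b)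
  qed
  have b_dec: "dual_le (b (Suc n)) (b n)" for n
    using pos_part_nonneg[of "b n - a n"] by (simp add: b dual_le_def blinfun.bilinear_simps)
  have b_a: "dual_le (b (Suc n)) (a n)" for n
    using pos_part_ge[of "b n - a n"] by (simp add: b dual_le_def blinfun.bilinear_simps algebra_simps)
  have b_mass: "?p (e - b n) \<le> \<eta> / 2 * (1 - 1 / 2 ^ n)" for n
  proof (induction n)
    case 0 then show ?case by (simp add: b blinfun.bilinear_simps)
  next
    case (Suc n)
    have "dual_le (E.pp (b n - a n)) (e - a n)"
      by (rule pos_part_least) (use bn[of n] a(2)[of n] in \<open>auto simp: dual_le_def blinfun.bilinear_simps\<close>)
    then have "?p (E.pp (b n - a n)) \<le> ?p (e - a n)" by (rule p_mono)
    also have "\<dots> \<le> \<eta> / 2 ^ (n + 2)" using a(3)[of n] m_nn[OF a(1)[of n]] by simp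
    finally have "?p (e - b (Suc n)) \<le> ?p (e - b n) + \<eta> / 2 ^ (n + 2)"
      by (simp add: b blinfun.bilinear_simps)
    then show ?case using Suc by (simp add: field_simps)
  qed
  obtain c where c: "dual_le 0 c" "\<And>n. dual_le c (b n)" "\<And>\<eta>. 0 < \<eta> \<Longrightarrow> \<exists>n. norm (b n - c) < \<eta>"
    using decreasing_dual_limit[OF oc, of b] bn b_dec by blast
  have "dual_le c e" using c(2)[of 0] b(1) by simp
  moreover have "0 \<le> \<sigma> f" if f: "dual_le 0 f" "dual_le f c" for f
  proof -
    have "?m f \<le> \<eta> / 2 ^ n" for n :: nat
    proof -
      have "?m f \<le> ?m (a n)" using f(2) c(2)[of "Suc n"] b_a[of n] dual_le_trans by (blast intro: m_mono)
      also have "\<dots> \<le> \<eta> / 2 ^ (n + 2)" using a(3)[of n] p_nn[of "e - a n"] a(2)[of n] by simp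
      also have "\<dots> \<le> \<eta> / 2 ^ n" using \<eta> by (simp add: field_simps)
      finally show ?thesis .
    qed
    moreover have "(\<lambda>n. \<eta> / 2 ^ n) \<longlonglongrightarrow> 0" using LIMSEQ_divide_realpow_zero[of 2 \<eta>] by simp
    ultimately have "?m f \<le> 0" using LIMSEQ_le_const by blast
    then show ?thesis using m_eq[of f] p_nn[OF f(1)] by simp
  qed
  moreover have "\<sigma> (e - c) \<le> \<eta>"
  proof -
    define \<theta> where "\<theta> = \<eta> / (2 * (norm ?p + 1))"
    have \<theta>: "0 < \<theta>" using \<eta> by (simp add: \<theta>_def add_nonneg_pos)
    then obtain n where n: "norm (b n - c) < \<theta>" using c(3) by blast
    have "\<sigma> (e - c) \<le> ?p (e - c)" using p_ge[of "e - c"] \<open>dual_le c e\<close> by simp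
    also have "\<dots> = ?p (e - b n) + ?p (b n - c)" by (simp add: blinfun.bilinear_simps)
    also have "\<dots> \<le> \<eta> / 2 * (1 - 1 / 2 ^ n) + norm ?p * norm (b n - c)"
      using b_mass[of n] norm_blinfun[of ?p "b n - c"] by (intro add_mono) auto
    also have "\<dots> \<le> \<eta> / 2 + norm ?p * \<theta>"
      using n \<eta> by (intro add_mono mult_left_mono) auto
    also have "norm ?p * \<theta> \<le> \<eta> / 2"
    proof -
      have "norm ?p * \<theta> \<le> (norm ?p + 1) * \<theta>" using \<theta> by (intro mult_right_mono) auto
      also have "\<dots> = \<eta> / 2"
        using add_nonneg_pos[of "norm ?p" 1] by (simp add: \<theta>_def field_simps)
      finally show ?thesis .
    qed
    finally show ?thesis by simp
  qed
  ultimately show thesis using that c(1) by blast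
qed

section \<open>Ideals of the dual, given by their positive elements, and components of
  functionals\<close>

definition dual_ideal :: "('a \<Rightarrow>\<^sub>L real) set \<Rightarrow> bool" where
  "dual_ideal I \<longleftrightarrow> 0 \<in> I \<and> (\<forall>a\<in>I. dual_le 0 a) \<and> (\<forall>a\<in>I. \<forall>b\<in>I. a + b \<in> I) \<and>
    (\<forall>a\<in>I. \<forall>c\<ge>0. c *\<^sub>R a \<in> I) \<and> (\<forall>a\<in>I. \<forall>b. dual_le 0 b \<longrightarrow> dual_le b a \<longrightarrow> b \<in> I)"

lemma dual_idealD:
  assumes "dual_ideal I"
  shows "0 \<in> I" "a \<in> I \<Longrightarrow> dual_le 0 a" "a \<in> I \<Longrightarrow> b \<in> I \<Longrightarrow> a + b \<in> I"
    "a \<in> I \<Longrightarrow> 0 \<le> c \<Longrightarrow> c *\<^sub>R a \<in> I" "a \<in> I \<Longrightarrow> dual_le 0 b \<Longrightarrow> dual_le b a \<Longrightarrow> b \<in> I"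
  using assms unfolding dual_ideal_def by blast+

text \<open>\<open>c\<close> is the supremum of the members of \<open>I\<close> below
  \<open>e\<close>, the projection of \<open>e\<close> to the band generated by \<open>I\<close>. If
  \<open>w\<close> lies below \<open>c\<close> and \<open>e - c\<close>, its piece under a member of
  \<open>I\<close> can be added to every member below \<open>e\<close> without exceeding
  \<open>e\<close>; since \<open>c\<close> is the least upper bound, that piece is 0.\<close>

lemma ideal_component:
  assumes I: "dual_ideal I" and e: "dual_le 0 e"
  shows "\<exists>c. dual_le 0 c \<and> dual_le c e \<and> (\<forall>a\<in>I. dual_le a e \<longrightarrow> dual_le a c) \<and>
    (\<forall>x \<eta>. 0 \<le> x \<longrightarrow> 0 < \<eta> \<longrightarrow> (\<exists>a\<in>I. dual_le a e \<and> blinfun_apply c x - \<eta> < blinfun_apply a x)) \<and>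
    E.disj c (e - c)"
proof -
  note I = dual_idealD[OF I]
  define D where "D = {a \<in> I. dual_le a e}"
  have "\<exists>\<psi>::'a \<Rightarrow>\<^sub>L real. \<forall>a\<in>{x. 0 \<le> x}. (\<forall>d\<in>D. blinfun_apply d a \<le> \<psi> a) \<and>
      (\<forall>\<eta>>0. \<exists>d\<in>D. \<psi> a - \<eta> < blinfun_apply d a)"
  proof (rule E.directed_sup[where h = e])
    show "D \<noteq> {}" using I(1) e by (auto simp: D_def)
  next
    fix d d' assume d: "d \<in> D" "d' \<in> D"
    let ?s = "d' + E.pp (d - d')"
    have nn: "dual_le 0 d" "dual_le 0 d'" using d I(2) by (auto simp: D_def)
    have "dual_le (E.pp (d - d')) d" "dual_le (E.pp (d - d')) (e - d')"
      by (rule pos_part_least; use d nn in \<open>auto simp: D_def dual_le_def blinfun.bilinear_simps\<close>)+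
    then have "dual_le ?s (d' + d)" "dual_le ?s e" "dual_le 0 ?s"
      using nn pos_part_nonneg[of "d - d'"] by (auto simp: dual_le_def blinfun.bilinear_simps algebra_simps)
    then have "?s \<in> D" using I(3,5) d unfolding D_def by blast
    moreover have "dual_le d ?s" "dual_le d' ?s"
      using pos_part_nonneg[of "d - d'"] pos_part_ge[of "d - d'"]
      by (auto simp: dual_le_def blinfun.bilinear_simps algebra_simps)
    ultimately show "\<exists>e\<in>D. \<forall>a\<in>{x. 0 \<le> x}. d a \<le> blinfun_apply e a \<and> d' a \<le> blinfun_apply e a"
      by (auto simp: dual_le_def)
  next
    fix d and a :: 'a assume "d \<in> D" "a \<in> {x. 0 \<le> x}"
    then show "blinfun_apply d a \<le> blinfun_apply e a" by (auto simp: D_def dual_le_def)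
  qed
  then obtain c :: "'a \<Rightarrow>\<^sub>L real" where c: "\<forall>a\<in>{x. 0 \<le> x}. (\<forall>d\<in>D. blinfun_apply d a \<le> c a) \<and>
      (\<forall>\<eta>>0. \<exists>d\<in>D. c a - \<eta> < blinfun_apply d a)" ..
  have ub: "dual_le a c" if "a \<in> D" for a using c that by (auto simp: dual_le_def)
  have approx: "\<exists>a\<in>D. c x - \<eta> < blinfun_apply a x" if "0 \<le> x" "0 < \<eta>" for x \<eta>
    using c that by blast
  have least: "dual_le c h" if h: "\<And>a. a \<in> D \<Longrightarrow> dual_le a h" for h
    unfolding dual_le_def
  proof (intro allI impI)
    fix x :: 'a assume x: "0 \<le> x"
    show "c x \<le> h x"
    proof (rule field_le_epsilon)
      fix \<eta> :: real assume "0 < \<eta>"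
      then obtain a where "a \<in> D" "c x - \<eta> < a x" using approx[OF x] by blast
      then show "c x \<le> h x + \<eta>" using dual_leD[OF h[of a] x] by simp
    qed
  qed
  have c_nn: "dual_le 0 c" using ub[of 0] I(1) e by (simp add: D_def)
  have c_e: "dual_le c e" by (rule least) (simp add: D_def)
  have "E.disj c (e - c)"
  proof (rule E.disjI)
    fix w :: "'a \<Rightarrow>\<^sub>L real"
    assume "\<And>a. a \<in> {x. 0 \<le> x} \<Longrightarrow> 0 \<le> blinfun_apply w a"
      "\<And>a. a \<in> {x. 0 \<le> x} \<Longrightarrow> blinfun_apply w a \<le> c a"
      "\<And>a. a \<in> {x. 0 \<le> x} \<Longrightarrow> blinfun_apply w a \<le> (e - c) a"
    then have w: "dual_le 0 w" "dual_le w c" "dual_le w (e - c)" by (auto simp: dual_le_def)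
    have "dual_le w (c - a)" if a: "a \<in> D" for a
    proof -
      have "dual_le 0 a" using a I(2) by (simp add: D_def)
      then obtain w1 w2 where ww: "w = w1 + w2" "dual_le 0 w1" "dual_le 0 w2" "dual_le w1 a" "dual_le w2 (c - a)"
        using dual_decomp[of a "c - a" w] ub[OF a] w(1,2) by auto
      have w1I: "w1 \<in> I" using I(5)[of a w1] a ww by (simp add: D_def)
      have w1e: "dual_le w1 (e - c)"
        using w(3) ww(1,3) by (fastforce simp: dual_le_def blinfun.bilinear_simps)
      have "dual_le c (c - w1)"
      proof (rule least)
        fix d assume d: "d \<in> D"
        have "d + w1 \<in> I" using I(3) d w1I by (simp add: D_def)
        moreover have "dual_le (d + w1) e"
          using ub[OF d] w1e by (fastforce simp: dual_le_def blinfun.bilinear_simps)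
        ultimately have "dual_le (d + w1) c" using ub by (simp add: D_def)
        then show "dual_le d (c - w1)" by (simp add: dual_le_def blinfun.bilinear_simps algebra_simps)
      qed
      then have "w1 = 0" using ww(2) by (intro dual_le_antisym) (auto simp: dual_le_def blinfun.bilinear_simps)
      then show ?thesis using ww by simp
    qed
    then have "dual_le a (c - w)" if "a \<in> D" for a
      using that by (force simp: dual_le_def blinfun.bilinear_simps algebra_simps)
    then have "dual_le c (c - w)" by (rule least)
    then show "w = 0" using w(1) by (intro dual_le_antisym) (auto simp: dual_le_def blinfun.bilinear_simps)
  qed (use c_nn c_e in \<open>auto simp: dual_le_def blinfun.bilinear_simps\<close>)
  moreover have "\<forall>a\<in>I. dual_le a e \<longrightarrow> dual_le a c" using ub by (simp add: D_def)
  moreover have "\<forall>x \<eta>. 0 \<le> x \<longrightarrow> 0 < \<eta> \<longrightarrow> (\<exists>a\<in>I. dual_le a e \<and> c x - \<eta> < blinfun_apply a x)"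
    using approx unfolding D_def by blast
  ultimately show ?thesis using c_nn c_e by (intro exI[of _ c]) simp
qed

definition ev :: "'a \<Rightarrow> ('a \<Rightarrow>\<^sub>L real) \<Rightarrow>\<^sub>L real" where
  "ev x = Blinfun (\<lambda>f. blinfun_apply f x)"

lemma ev_apply [simp]: "blinfun_apply (ev x) f = blinfun_apply f x"
  unfolding ev_def by (simp add: bounded_linear_Blinfun_apply)

text \<open>\<open>\<kappa>\<close> is the part of evaluation at \<open>x\<close> carried by
  \<open>I\<close>. With \<open>c\<close> the component of \<open>e\<close> in \<open>I\<close>, it
  equals evaluation at \<open>x\<close> below multiples of \<open>c\<close> and 0 below multiples of
  \<open>e - c\<close>. As these are disjoint, evaluation at a suitable \<open>y\<close> in
  \<open>E\<close> imitates both, uniformly along the sequence, and \<open>fs n y\<close> tends to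
  0.\<close>

lemma ideal_functional_null:
  fixes fs :: "nat \<Rightarrow> ('a \<Rightarrow>\<^sub>L real)" and \<kappa> :: "('a \<Rightarrow>\<^sub>L real) \<Rightarrow>\<^sub>L real"
  assumes null: "\<And>x. (\<lambda>n. fs n x) \<longlonglongrightarrow> 0"
    and e: "dual_le 0 e" and x: "0 \<le> x"
    and equi: "\<And>\<eta>. 0 < \<eta> \<Longrightarrow> \<exists>K\<ge>0. \<forall>n. blinfun_apply (E.pp (dabs (fs n) - K *\<^sub>R e)) x \<le> \<eta>"
    and I: "dual_ideal I"
    and \<kappa>_ge: "\<And>f a. dual_le 0 f \<Longrightarrow> a \<in> I \<Longrightarrow> dual_le a f \<Longrightarrow> blinfun_apply a x \<le> \<kappa> f"
    and \<kappa>_le: "\<And>f \<eta>. dual_le 0 f \<Longrightarrow> 0 < \<eta> \<Longrightarrow> \<exists>a\<in>I. dual_le a f \<and> \<kappa> f - \<eta> < blinfun_apply a x"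
  shows "(\<lambda>n. \<kappa> (fs n)) \<longlonglongrightarrow> 0"
proof -
  note II = dual_idealD[OF I]
  obtain c where c: "dual_le 0 c" "dual_le c e" "\<forall>a\<in>I. dual_le a e \<longrightarrow> dual_le a c"
    "\<forall>x \<eta>. 0 \<le> x \<longrightarrow> 0 < \<eta> \<longrightarrow> (\<exists>a\<in>I. dual_le a e \<and> blinfun_apply c x - \<eta> < blinfun_apply a x)"
    "E.disj c (e - c)"
    using ideal_component[OF I e] by blast
  have \<kappa>_nn: "0 \<le> \<kappa> f" if "dual_le 0 f" for f
    using \<kappa>_ge[OF that II(1) that] by simp
  have \<kappa>_bound: "\<kappa> f \<le> u" if f: "dual_le 0 f" and u: "\<And>a. a \<in> I \<Longrightarrow> dual_le a f \<Longrightarrow> blinfun_apply a x \<le> u" for f u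
  proof (rule field_le_epsilon)
    fix \<eta> :: real assume "0 < \<eta>"
    then obtain a where "a \<in> I" "dual_le a f" "\<kappa> f - \<eta> < a x" using \<kappa>_le[OF f] by blast
    then show "\<kappa> f \<le> u + \<eta>" using u[of a] by simp
  qed
  have \<kappa>_x: "\<kappa> f \<le> f x" if "dual_le 0 f" for f
    using \<kappa>_bound[OF that] dual_leD x by blast
  have \<kappa>_off: "\<kappa> f = 0" if f: "dual_le 0 f" "dual_le f (K *\<^sub>R (e - c))" and K: "0 \<le> K" for f K
  proof -
    have "blinfun_apply a x \<le> 0" if a: "a \<in> I" "dual_le a f" for a
    proof -
      have aK: "dual_le a (K *\<^sub>R (e - c))" using a(2) f(2) dual_le_trans by blast
      show ?thesis
      proof (cases "K = 0")
        case True
        then show ?thesis using dual_leD[OF aK x] by simp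
      next
        case False
        then have K: "0 < K" using \<open>0 \<le> K\<close> by simp
        define a' where "a' = (1/K) *\<^sub>R a"
        have a'I: "a' \<in> I" using II(4)[OF a(1), of "1/K"] K by (simp add: a'_def)
        have a'e: "dual_le a' (e - c)"
          using dual_scale_mono[OF aK, of "1/K"] K by (simp add: a'_def)
        moreover have "dual_le (e - c) e" using c(1) by (simp add: dual_le_def blinfun.bilinear_simps)
        ultimately have a'c: "dual_le a' c" using c(3) a'I dual_le_trans by blast
        have "a' = 0"
          by (rule E.disj_inf_zero[OF c(5)]) (use a'e a'c II(2)[OF a'I] in \<open>auto simp: dual_le_def\<close>)
        then show ?thesis using K by (simp add: a'_def)
      qed
    qed
    then show ?thesis using \<kappa>_bound[OF f(1), of 0] \<kappa>_nn[OF f(1)] by (simp add: antisym)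
  qed
  have \<kappa>_on: "\<kappa> f = f x" if f: "dual_le 0 f" "dual_le f (K *\<^sub>R c)" and K: "0 \<le> K" for f K
  proof (rule antisym[OF \<kappa>_x[OF f(1)]])
    show "f x \<le> \<kappa> f"
    proof (rule field_le_epsilon)
      fix \<eta> :: real assume \<eta>: "0 < \<eta>"
      then have "0 < \<eta> / (K + 1)" using K by simp
      then obtain a where a: "a \<in> I" "dual_le a e" "c x - \<eta> / (K + 1) < a x" using c(4) x by blast
      have ac: "dual_le a c" using c(3) a by blast
      have "K *\<^sub>R a + K *\<^sub>R (c - a) = K *\<^sub>R c" by (simp add: algebra_simps)
      then obtain f1 f2 where ff: "f = f1 + f2" "dual_le 0 f1" "dual_le 0 f2" "dual_le f1 (K *\<^sub>R a)" "dual_le f2 (K *\<^sub>R (c - a))"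
        using dual_decomp[of "K *\<^sub>R a" "K *\<^sub>R (c - a)" f] f ac K II(2)[OF a(1)]
        by (metis dual_scale_nonneg dual_le_diff)
      have "f1 \<in> I" using II(5)[OF II(4)[OF a(1) K]] ff by blast
      then have "f1 x \<le> \<kappa> f" using \<kappa>_ge[OF f(1), of f1] ff(1,3)
        by (simp add: dual_le_def blinfun.bilinear_simps)
      moreover have "f2 x \<le> K * (c x - a x)"
        using dual_leD[OF ff(5) x] by (simp add: blinfun.bilinear_simps)
      moreover have "K * (c x - a x) \<le> K * (\<eta> / (K + 1))" using a(3) K by (intro mult_left_mono) auto
      moreover have "K * (\<eta> / (K + 1)) \<le> \<eta>" using K \<eta> by (simp add: field_simps)
      ultimately show "f x \<le> \<kappa> f + \<eta>" using ff(1) by (simp add: blinfun.bilinear_simps)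
    qed
  qed
  show ?thesis
  proof (rule LIMSEQ_I)
    fix \<zeta> :: real assume \<zeta>: "0 < \<zeta>"
    obtain K where K: "0 \<le> K" "\<And>n. E.pp (dabs (fs n) - K *\<^sub>R e) x \<le> \<zeta> / 8"
      using equi[of "\<zeta> / 8"] \<zeta> by auto
    define \<theta> where "\<theta> = \<zeta> / (8 * (K + 1))"
    have \<theta>: "0 < \<theta>" "K * \<theta> \<le> \<zeta> / 8" using \<zeta> K(1) by (auto simp: \<theta>_def field_simps)
    obtain y where y: "0 \<le> y" "y \<le> x" "c (x - y) + (e - c) y < \<theta>"
      using dual_disjD[OF c(5) x \<theta>(1)] by blast
    \<comment> \<open>Split \<open>f\<close> into a remainder \<open>f2\<close>, a piece under
      \<open>K *\<^sub>R c\<close> and one under \<open>K *\<^sub>R (e - c)\<close>. The remainder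
      and the choice of \<open>y\<close> cost \<open>\<zeta> / 8\<close> each.\<close>
    have part: "\<bar>\<kappa> f - f y\<bar> \<le> \<zeta> / 4" if f: "dual_le 0 f" "dual_le f (dabs (fs n))" for f n
    proof -
      let ?r = "E.pp (dabs (fs n) - K *\<^sub>R e)"
      have ec: "dual_le 0 (e - c)" using c(2) by simp
      have "dual_le f (K *\<^sub>R e + ?r)"
        using f(2) pos_part_ge[of "dabs (fs n) - K *\<^sub>R e"]
        by (fastforce simp: dual_le_def blinfun.bilinear_simps)
      then obtain f1 f2 where ff: "f = f1 + f2" "dual_le 0 f1" "dual_le 0 f2" "dual_le f1 (K *\<^sub>R e)" "dual_le f2 ?r"
        using dual_decomp[of "K *\<^sub>R e" ?r f] f(1) dual_scale_nonneg[OF e K(1)] pos_part_nonneg by blast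
      have "K *\<^sub>R c + K *\<^sub>R (e - c) = K *\<^sub>R e" by (simp add: algebra_simps)
      then obtain g1 g2 where gg: "f1 = g1 + g2" "dual_le 0 g1" "dual_le 0 g2" "dual_le g1 (K *\<^sub>R c)" "dual_le g2 (K *\<^sub>R (e - c))"
        using dual_decomp[of "K *\<^sub>R c" "K *\<^sub>R (e - c)" f1] ff dual_scale_nonneg[OF c(1) K(1)]
          dual_scale_nonneg[OF ec K(1)] by metis
      have "\<kappa> f = \<kappa> f2 + g1 x"
        using \<kappa>_off[OF gg(3,5) K(1)] \<kappa>_on[OF gg(2,4) K(1)] ff(1) gg(1) by (simp add: blinfun.bilinear_simps)
      then have eq: "\<kappa> f - f y = (\<kappa> f2 - f2 y) + g1 (x - y) - g2 y"
        using ff(1) gg(1) by (simp add: blinfun.bilinear_simps)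
      have "f2 x \<le> \<zeta> / 8" using dual_leD[OF ff(5) x] K(2)[of n] by simp
      moreover have "0 \<le> f2 y" "f2 y \<le> f2 x" using dual_posD[OF ff(3) y(1)] dual_pos_mono[OF ff(3) y(2)] by auto
      moreover have "0 \<le> \<kappa> f2" "\<kappa> f2 \<le> f2 x" using \<kappa>_nn \<kappa>_x ff(3) by auto
      moreover have "0 \<le> g1 (x - y)" "g1 (x - y) \<le> K * c (x - y)"
        using dual_posD[OF gg(2), of "x - y"] dual_leD[OF gg(4), of "x - y"] y(2) by (auto simp: blinfun.scaleR_left)
      moreover have "0 \<le> g2 y" "g2 y \<le> K * (e - c) y"
        using dual_posD[OF gg(3) y(1)] dual_leD[OF gg(5) y(1)] by (auto simp: blinfun.scaleR_left)
      moreover have "K * c (x - y) + K * (e - c) y \<le> \<zeta> / 8"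
      proof -
        have "K * (c (x - y) + (e - c) y) \<le> K * \<theta>" using y(3) K(1) by (intro mult_left_mono) auto
        then show ?thesis using \<theta>(2) by (simp add: distrib_left)
      qed
      moreover have "0 \<le> c (x - y)" "0 \<le> (e - c) y"
        using dual_posD[OF c(1), of "x - y"] dual_posD[OF ec y(1)] y(2) by auto
      moreover have "0 \<le> K * c (x - y)" "0 \<le> K * (e - c) y"
        using K(1) calculation(11,12) by auto
      ultimately show ?thesis unfolding eq by linarith
    qed
    obtain N where N: "\<And>n. n \<ge> N \<Longrightarrow> \<bar>fs n y\<bar> < \<zeta> / 4"
      using LIMSEQ_D[OF null[of y], of "\<zeta> / 4"] \<zeta> by auto
    have "norm (\<kappa> (fs n) - 0) < \<zeta>" if n: "n \<ge> N" for n
    proof -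
      let ?p = "E.pp (fs n)" and ?m = "E.pp (- fs n)"
      have "fs n = ?p - ?m" by (simp add: E.pp_uminus)
      then have "\<kappa> (fs n) = \<kappa> ?p - \<kappa> ?m" "fs n y = ?p y - ?m y"
        by (metis blinfun.diff_right, metis blinfun.diff_left)
      moreover have "\<bar>\<kappa> ?p - ?p y\<bar> \<le> \<zeta> / 4" "\<bar>\<kappa> ?m - ?m y\<bar> \<le> \<zeta> / 4"
        using part pos_part_nonneg dabs_ge_parts by blast+
      ultimately have "\<bar>\<kappa> (fs n) - fs n y\<bar> \<le> \<zeta> / 2" by linarith
      then show ?thesis using N[OF n] \<zeta> unfolding real_norm_def by linarith
    qed
    then show "\<exists>N. \<forall>n\<ge>N. norm (\<kappa> (fs n) - 0) < \<zeta>" by blast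
  qed
qed

text \<open>Asking for domination at every \<open>b\<close> below \<open>a\<close>, and not only at
  \<open>a\<close>, makes the set hereditary; decomposition closes it under sums.\<close>

lemma dual_ideal_dominated:
  fixes \<rho> :: "('a \<Rightarrow>\<^sub>L real) \<Rightarrow>\<^sub>L real"
  shows "dual_ideal {a. dual_le 0 a \<and> (\<forall>b. dual_le 0 b \<longrightarrow> dual_le b a \<longrightarrow> blinfun_apply b x \<le> \<rho> b)}"
    (is "dual_ideal ?I")
  unfolding dual_ideal_def
proof (intro conjI ballI allI impI)
  have zero: "b = 0" if "dual_le 0 b" "dual_le b 0" for b :: "'a \<Rightarrow>\<^sub>L real"
    using that dual_le_antisym by blast
  show zI: "0 \<in> ?I" using zero by force
  show "dual_le 0 a" if "a \<in> ?I" for a using that by simp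
  show "b \<in> ?I" if "a \<in> ?I" "dual_le 0 b" "dual_le b a" for a b
    using that dual_le_trans by blast
  show "a + b \<in> ?I" if ab: "a \<in> ?I" "b \<in> ?I" for a b
  proof -
    have "blinfun_apply d x \<le> \<rho> d" if d: "dual_le 0 d" "dual_le d (a + b)" for d
    proof -
      obtain d1 d2 where "d = d1 + d2" "dual_le 0 d1" "dual_le 0 d2" "dual_le d1 a" "dual_le d2 b"
        using dual_decomp[of a b d] ab d by blast
      moreover from this have "blinfun_apply d1 x \<le> \<rho> d1" "blinfun_apply d2 x \<le> \<rho> d2" using ab by auto
      ultimately show ?thesis by (simp add: blinfun.bilinear_simps)
    qed
    moreover have "dual_le 0 (a + b)" using dual_add_mono[of 0 a 0 b] ab by simp
    ultimately show ?thesis by blast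
  qed
  show "c *\<^sub>R a \<in> ?I" if a: "a \<in> ?I" and c: "0 \<le> c" for a c
  proof (cases "c = 0")
    case True then show ?thesis using zI by simp
  next
    case False
    have "blinfun_apply d x \<le> \<rho> d" if d: "dual_le 0 d" "dual_le d (c *\<^sub>R a)" for d
    proof -
      have "dual_le 0 ((1/c) *\<^sub>R d)" "dual_le ((1/c) *\<^sub>R d) a"
        using dual_scale_nonneg[OF d(1), of "1/c"] dual_scale_mono[OF d(2), of "1/c"] c False by auto
      then have "((1/c) *\<^sub>R d) x \<le> \<rho> ((1/c) *\<^sub>R d)" using a by blast
      then show ?thesis using c False by (simp add: blinfun.bilinear_simps field_simps)
    qed
    then show ?thesis using a c dual_scale_nonneg by blast
  qed
qed

lemma dual_ideal_null: "0 \<le> x \<Longrightarrow> dual_ideal {a. dual_le 0 a \<and> blinfun_apply a x = 0}"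
  unfolding dual_ideal_def
proof (intro conjI ballI allI impI)
  fix a b :: "'a \<Rightarrow>\<^sub>L real" assume "0 \<le> x" "a \<in> {a. dual_le 0 a \<and> blinfun_apply a x = 0}" "dual_le 0 b" "dual_le b a"
  then show "b \<in> {a. dual_le 0 a \<and> blinfun_apply a x = 0}"
    using dual_posD[of b x] dual_leD[of b a x] by auto
qed (auto simp: blinfun.bilinear_simps dual_le_def)

text \<open>Greedy exhaustion: remove from \<open>\<phi>\<close> all positive functionals that vanish asymptotically on the
  sequence; what is left is singular to every element of \<open>E\<close>, hence vanishes at \<open>e\<close> by order continuity.\<close>

lemma weakly_null_of_equi_integrable:
  fixes fs :: "nat \<Rightarrow> ('a \<Rightarrow>\<^sub>L real)" and \<phi> :: "('a \<Rightarrow>\<^sub>L real) \<Rightarrow>\<^sub>L real"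
  assumes oc: "order_continuous_norm (dual_le :: ('a \<Rightarrow>\<^sub>L real) \<Rightarrow> _ \<Rightarrow> bool)"
    and null: "\<And>x. (\<lambda>n. fs n x) \<longlonglongrightarrow> 0"
    and e: "dual_le 0 e"
    and dom: "\<And>n. \<exists>C\<ge>0. dual_le (dabs (fs n)) (C *\<^sub>R e)"
    and equi: "\<And>(\<psi>::('a \<Rightarrow>\<^sub>L real) \<Rightarrow>\<^sub>L real) \<eta>. (\<And>f. dual_le 0 f \<Longrightarrow> 0 \<le> blinfun_apply \<psi> f) \<Longrightarrow> 0 < \<eta> \<Longrightarrow>
      \<exists>K\<ge>0. \<forall>n. blinfun_apply \<psi> (E.pp (dabs (fs n) - K *\<^sub>R e)) \<le> \<eta>"
    and \<phi>: "\<And>f. dual_le 0 f \<Longrightarrow> 0 \<le> \<phi> f"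
  shows "(\<lambda>n. \<phi> (fs n)) \<longlonglongrightarrow> 0"
proof -
  \<comment> \<open>\<open>\<rho>\<close> is admissible if it remains from \<open>\<phi>\<close>
    after removing a positive part that tends to 0 along the sequence.\<close>
  define R where "R \<rho> \<longleftrightarrow> (\<forall>f. dual_le 0 f \<longrightarrow> 0 \<le> blinfun_apply \<rho> f \<and> blinfun_apply \<rho> f \<le> \<phi> f) \<and>
      (\<lambda>n. blinfun_apply (\<phi> - \<rho>) (fs n)) \<longlonglongrightarrow> 0" for \<rho>
  define le where "le \<rho> \<rho>' \<longleftrightarrow> (\<forall>f. dual_le 0 f \<longrightarrow> blinfun_apply \<rho> f \<le> blinfun_apply \<rho>' f)"
    for \<rho> \<rho>' :: "('a \<Rightarrow>\<^sub>L real) \<Rightarrow>\<^sub>L real"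
  have R_\<phi>: "R \<phi>" using \<phi> by (simp add: R_def)
  have R_nn: "0 \<le> \<rho> f" and R_le: "\<rho> f \<le> \<phi> f" and R_lim: "(\<lambda>n. (\<phi> - \<rho>) (fs n)) \<longlonglongrightarrow> 0"
    if "R \<rho>" "dual_le 0 f" for \<rho> f using that by (auto simp: R_def)
  \<comment> \<open>Each step comes within \<open>1 / 2 ^ k\<close> of the least possible value at
    \<open>e\<close>, so that nothing admissible below the limit has a smaller value there.\<close>
  have "\<exists>r. \<forall>k. R (r k) \<and> (le (r (Suc k)) (r k) \<and>
      (\<forall>\<rho>. R \<rho> \<and> le \<rho> (r k) \<longrightarrow> blinfun_apply (r (Suc k)) e \<le> blinfun_apply \<rho> e + 1 / 2 ^ k))"
  proof (rule dependent_nat_choice)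
    show "\<exists>r. R r" using R_\<phi> by blast
  next
    fix r and k :: nat assume r: "R r"
    define A where "A = {\<rho>. R \<rho> \<and> le \<rho> r}"
    have "r \<in> A" using r by (simp add: A_def le_def)
    then have ne: "A \<noteq> {}" by blast
    have bdd: "bdd_below ((\<lambda>\<rho>. blinfun_apply \<rho> e) ` A)"
      using R_nn e by (auto simp: A_def bdd_below_def)
    have "(INF \<rho>\<in>A. blinfun_apply \<rho> e) < (INF \<rho>\<in>A. blinfun_apply \<rho> e) + 1 / 2 ^ k" by simp
    then obtain r' where r': "r' \<in> A" "r' e < (INF \<rho>\<in>A. blinfun_apply \<rho> e) + 1 / 2 ^ k"
      using cINF_less_iff[OF ne bdd] by blast
    have "r' e \<le> \<rho> e + 1 / 2 ^ k" if "R \<rho>" "le \<rho> r" for \<rho>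
      using cINF_lower[OF bdd, of \<rho>] that r'(2) by (simp add: A_def)
    then show "\<exists>r'. R r' \<and> (le r' r \<and>
        (\<forall>\<rho>. R \<rho> \<and> le \<rho> r \<longrightarrow> blinfun_apply r' e \<le> blinfun_apply \<rho> e + 1 / 2 ^ k))"
      using r'(1) by (intro exI[of _ r']) (simp add: A_def)
  qed
  then obtain r where r: "\<And>k. R (r k)" "\<And>k. le (r (Suc k)) (r k)"
    "\<And>k \<rho>. R \<rho> \<Longrightarrow> le \<rho> (r k) \<Longrightarrow> blinfun_apply (r (Suc k)) e \<le> \<rho> e + 1 / 2 ^ k" by blast
  have r_anti: "r n f \<le> r m f" if "m \<le> n" "dual_le 0 f" for m n f
    using that(1) by (induction rule: dec_induct) (use r(2) that(2) in \<open>auto simp: le_def intro: order_trans\<close>)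
  have "\<exists>\<psi>::('a \<Rightarrow>\<^sub>L real) \<Rightarrow>\<^sub>L real. \<forall>f\<in>{f. dual_le 0 f}. (\<forall>d\<in>range (\<lambda>k. - r k). blinfun_apply d f \<le> \<psi> f) \<and>
      (\<forall>\<eta>>0. \<exists>d\<in>range (\<lambda>k. - r k). \<psi> f - \<eta> < blinfun_apply d f)"
  proof (rule F.directed_sup[where h = 0])
    fix d d' assume "d \<in> range (\<lambda>k. - r k)" "d' \<in> range (\<lambda>k. - r k)"
    then obtain m n where mn: "d = - r m" "d' = - r n" by auto
    show "\<exists>e\<in>range (\<lambda>k. - r k). \<forall>f\<in>{f. dual_le 0 f}. d f \<le> blinfun_apply e f \<and> d' f \<le> blinfun_apply e f"
      by (rule bexI[of _ "- r (max m n)"]) (use r_anti mn in \<open>auto simp: blinfun.bilinear_simps\<close>)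
  next
    fix d and f :: "'a \<Rightarrow>\<^sub>L real" assume "d \<in> range (\<lambda>k. - r k)" "f \<in> {f. dual_le 0 f}"
    then show "blinfun_apply d f \<le> blinfun_apply 0 f"
      using R_nn[OF r(1)] by (auto simp: blinfun.bilinear_simps)
  qed auto
  then obtain \<psi> :: "('a \<Rightarrow>\<^sub>L real) \<Rightarrow>\<^sub>L real" where
    \<psi>: "\<forall>f\<in>{f. dual_le 0 f}. (\<forall>d\<in>range (\<lambda>k. - r k). blinfun_apply d f \<le> \<psi> f) \<and>
      (\<forall>\<eta>>0. \<exists>d\<in>range (\<lambda>k. - r k). \<psi> f - \<eta> < blinfun_apply d f)" ..
  define \<rho> where "\<rho> = - \<psi>"
  have \<rho>_le: "\<rho> f \<le> r k f" if "dual_le 0 f" for f k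
  proof -
    have "(- r k) f \<le> \<psi> f" using \<psi> that by blast
    then show ?thesis by (simp add: \<rho>_def blinfun.bilinear_simps)
  qed
  have \<rho>_approx: "\<exists>k. r k f < \<rho> f + \<eta>" if f\<eta>: "dual_le 0 f" "0 < \<eta>" for f \<eta>
  proof -
    have "\<exists>d\<in>range (\<lambda>k. - r k). \<psi> f - \<eta> < blinfun_apply d f" using \<psi> f\<eta> by blast
    then obtain k where "\<psi> f - \<eta> < (- r k) f" by blast
    then show ?thesis by (intro exI[of _ k]) (simp add: \<rho>_def blinfun.bilinear_simps)
  qed
  have \<rho>_nn: "0 \<le> \<rho> f" if f: "dual_le 0 f" for f
  proof (rule field_le_epsilon)
    fix \<eta> :: real assume "0 < \<eta>"
    then obtain k where "r k f < \<rho> f + \<eta>" using \<rho>_approx[OF f] by blast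
    then show "0 \<le> \<rho> f + \<eta>" using R_nn[OF r(1) f, of k] by simp
  qed
  have abs_le: "\<bar>\<psi> (fs n)\<bar> \<le> \<psi> (dabs (fs n))" if \<psi>: "\<And>f. dual_le 0 f \<Longrightarrow> 0 \<le> blinfun_apply \<psi> f"
    for \<psi> :: "('a \<Rightarrow>\<^sub>L real) \<Rightarrow>\<^sub>L real" and n
    using bidual_mono[OF \<psi> dabs_ge(1)[of "fs n"]] bidual_mono[OF \<psi> dabs_ge(2)[of "fs n"]]
    by (simp add: blinfun.bilinear_simps abs_le_iff)
  \<comment> \<open>Admissibility survives the limit because \<open>r k - \<rho>\<close> is small
    uniformly along the sequence: it is small at \<open>e\<close>, and \<open>\<phi>\<close>
    controls the excess over \<open>K *\<^sub>R e\<close>.\<close>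
  have "(\<lambda>n. (\<phi> - \<rho>) (fs n)) \<longlonglongrightarrow> 0"
  proof (rule LIMSEQ_I)
    fix \<zeta> :: real assume \<zeta>: "0 < \<zeta>"
    obtain K where K: "0 \<le> K" "\<And>n. \<phi> (E.pp (dabs (fs n) - K *\<^sub>R e)) \<le> \<zeta> / 4"
      using equi[OF \<phi>, of "\<zeta> / 4"] \<zeta> by auto
    have "0 < \<zeta> / (4 * (K + 1))" using \<zeta> K(1) by simp
    then obtain k where k: "r k e < \<rho> e + \<zeta> / (4 * (K + 1))" using \<rho>_approx[OF e] by blast
    have d_nn: "0 \<le> (r k - \<rho>) f" if "dual_le 0 f" for f
      using \<rho>_le[OF that] by (simp add: blinfun.bilinear_simps)
    have small: "\<bar>(r k - \<rho>) (fs n)\<bar> \<le> \<zeta> / 2" for n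
    proof -
      let ?r = "E.pp (dabs (fs n) - K *\<^sub>R e)"
      have "dual_le (dabs (fs n)) (K *\<^sub>R e + ?r)"
        using pos_part_ge[of "dabs (fs n) - K *\<^sub>R e"]
        by (simp add: dual_le_def blinfun.bilinear_simps algebra_simps)
      then have "(r k - \<rho>) (dabs (fs n)) \<le> (r k - \<rho>) (K *\<^sub>R e + ?r)"
        using bidual_mono[OF d_nn] by blast
      also have "\<dots> = K * (r k e - \<rho> e) + (r k ?r - \<rho> ?r)"
        by (simp add: blinfun.bilinear_simps)
      also have "\<dots> \<le> K * (\<zeta> / (4 * (K + 1))) + \<zeta> / 4"
      proof (intro add_mono mult_left_mono)
        show "r k e - \<rho> e \<le> \<zeta> / (4 * (K + 1))" using k by simp
        show "r k ?r - \<rho> ?r \<le> \<zeta> / 4"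
          using R_le[OF r(1)[of k] pos_part_nonneg[of "dabs (fs n) - K *\<^sub>R e"]]
            \<rho>_nn[OF pos_part_nonneg[of "dabs (fs n) - K *\<^sub>R e"]] K(2)[of n] by linarith
      qed (rule K(1))
      also have "\<dots> \<le> \<zeta> / 2" using K(1) \<zeta> by (simp add: field_simps)
      finally show ?thesis using abs_le[of "r k - \<rho>" n] d_nn by simp
    qed
    obtain N where N: "\<And>n. n \<ge> N \<Longrightarrow> \<bar>(\<phi> - r k) (fs n)\<bar> < \<zeta> / 2"
      using LIMSEQ_D[OF R_lim[OF r(1)[of k] e], of "\<zeta> / 2"] \<zeta> by auto
    have "norm ((\<phi> - \<rho>) (fs n) - 0) < \<zeta>" if "n \<ge> N" for n
    proof -
      have "(\<phi> - \<rho>) (fs n) = (\<phi> - r k) (fs n) + (r k - \<rho>) (fs n)" by (simp add: blinfun.bilinear_simps)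
      then show ?thesis using N[OF that] small[of n] by simp
    qed
    then show "\<exists>N. \<forall>n\<ge>N. norm ((\<phi> - \<rho>) (fs n) - 0) < \<zeta>" by blast
  qed
  moreover have "\<rho> f \<le> \<phi> f" if "dual_le 0 f" for f
    using \<rho>_le[OF that, of 0] R_le[OF r(1)[of 0] that] by simp
  ultimately have R_\<rho>: "R \<rho>" using \<rho>_nn by (simp add: R_def)
  have minimal: "\<rho> e \<le> \<rho>' e" if \<rho>': "R \<rho>'" "le \<rho>' \<rho>" for \<rho>'
  proof (rule LIMSEQ_le_const)
    show "(\<lambda>k. 1 / 2 ^ k + \<rho>' e) \<longlonglongrightarrow> \<rho>' e"
      using tendsto_add[OF LIMSEQ_divide_realpow_zero[of 2 1] tendsto_const[of "\<rho>' e"]] by simp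
    have "\<rho> e \<le> 1 / 2 ^ k + \<rho>' e" for k
    proof -
      have "le \<rho>' (r k)" using \<rho>'(2) \<rho>_le order_trans unfolding le_def by blast
      then show ?thesis using r(3)[OF \<rho>'(1), of k] \<rho>_le[OF e, of "Suc k"] by simp
    qed
    then show "\<exists>N. \<forall>k\<ge>N. \<rho> e \<le> 1 / 2 ^ k + \<rho>' e" by blast
  qed
  \<comment> \<open>The part \<open>\<kappa>\<close> of evaluation at \<open>x\<close> carried by
    \<open>I\<close> lies below \<open>\<rho>\<close> and is null along the sequence. So
    \<open>\<rho> - \<kappa>\<close> is admissible, and minimality gives
    \<open>\<kappa> e \<le> 0\<close>.\<close>
  have no_ac: "blinfun_apply a x \<le> 0" if x: "0 \<le> x" and a: "dual_le 0 a" "dual_le a e"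
    "\<And>b. dual_le 0 b \<Longrightarrow> dual_le b a \<Longrightarrow> blinfun_apply b x \<le> \<rho> b" for x a
  proof -
    define I where "I = {a. dual_le 0 a \<and> (\<forall>b. dual_le 0 b \<longrightarrow> dual_le b a \<longrightarrow> blinfun_apply b x \<le> \<rho> b)}"
    have I: "dual_ideal I" unfolding I_def by (rule dual_ideal_dominated)
    note II = dual_idealD[OF I]
    have "\<exists>\<kappa>::('a \<Rightarrow>\<^sub>L real) \<Rightarrow>\<^sub>L real. \<forall>f\<in>{f. dual_le 0 f}. (\<forall>b\<in>I. f - b \<in> {f. dual_le 0 f} \<longrightarrow> ev x b \<le> \<kappa> f) \<and>
        (\<forall>\<eta>>0. \<exists>b\<in>I. f - b \<in> {f. dual_le 0 f} \<and> \<kappa> f - \<eta> < ev x b)"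
    proof (rule F.ideal_sup)
      show "I \<subseteq> {f. dual_le 0 f}" using II(2) by blast
      show "b \<in> I" if "a \<in> I" "b \<in> {f. dual_le 0 f}" "a - b \<in> {f. dual_le 0 f}" for a b
        using II(5)[of a b] that by simp
    qed (fact II)+
    then obtain \<kappa> :: "('a \<Rightarrow>\<^sub>L real) \<Rightarrow>\<^sub>L real" where
      \<kappa>: "\<forall>f\<in>{f. dual_le 0 f}. (\<forall>b\<in>I. f - b \<in> {f. dual_le 0 f} \<longrightarrow> ev x b \<le> \<kappa> f) \<and>
        (\<forall>\<eta>>0. \<exists>b\<in>I. f - b \<in> {f. dual_le 0 f} \<and> \<kappa> f - \<eta> < ev x b)" ..
    have \<kappa>_ge: "blinfun_apply b x \<le> \<kappa> f" if "dual_le 0 f" "b \<in> I" "dual_le b f" for f b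
      using \<kappa> that by simp
    have \<kappa>_approx: "\<exists>b\<in>I. dual_le b f \<and> \<kappa> f - \<eta> < blinfun_apply b x" if "dual_le 0 f" "0 < \<eta>" for f \<eta>
      using \<kappa> that by simp
    have \<kappa>_nn: "0 \<le> \<kappa> f" if "dual_le 0 f" for f using \<kappa>_ge[OF that II(1) that] by simp
    have \<kappa>_\<rho>: "\<kappa> f \<le> \<rho> f" if f: "dual_le 0 f" for f
    proof (rule field_le_epsilon)
      fix \<eta> :: real assume "0 < \<eta>"
      then obtain b where b: "b \<in> I" "dual_le b f" "\<kappa> f - \<eta> < b x" using \<kappa>_approx[OF f] by blast
      have "b x \<le> \<rho> b" using b(1) by (auto simp: I_def)
      also have "\<dots> \<le> \<rho> f" by (rule bidual_mono[OF \<rho>_nn b(2)])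
      finally show "\<kappa> f \<le> \<rho> f + \<eta>" using b(3) by simp
    qed
    have "(\<lambda>n. \<kappa> (fs n)) \<longlonglongrightarrow> 0"
    proof (rule ideal_functional_null[OF null e x _ I \<kappa>_ge \<kappa>_approx])
      fix \<eta> :: real assume "0 < \<eta>"
      have "\<exists>K\<ge>0. \<forall>n. ev x (E.pp (dabs (fs n) - K *\<^sub>R e)) \<le> \<eta>"
        by (rule equi) (use dual_posD x \<open>0 < \<eta>\<close> in auto)
      then show "\<exists>K\<ge>0. \<forall>n. E.pp (dabs (fs n) - K *\<^sub>R e) x \<le> \<eta>" by simp
    qed
    from tendsto_add[OF R_lim[OF R_\<rho> e] this]
    have "(\<lambda>n. (\<phi> - (\<rho> - \<kappa>)) (fs n)) \<longlonglongrightarrow> 0" by (simp add: blinfun.bilinear_simps algebra_simps)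
    moreover have "0 \<le> (\<rho> - \<kappa>) f \<and> (\<rho> - \<kappa>) f \<le> \<phi> f" if "dual_le 0 f" for f
      using \<kappa>_\<rho>[OF that] \<kappa>_nn[OF that] R_le[OF R_\<rho> that] by (simp add: blinfun.bilinear_simps)
    ultimately have "R (\<rho> - \<kappa>)" by (simp add: R_def)
    moreover have "le (\<rho> - \<kappa>) \<rho>" using \<kappa>_nn by (simp add: le_def blinfun.bilinear_simps)
    ultimately have "\<rho> e \<le> (\<rho> - \<kappa>) e" by (rule minimal)
    then have "\<kappa> e \<le> 0" by (simp add: blinfun.bilinear_simps)
    moreover have "a \<in> I" using a by (simp add: I_def)
    ultimately show ?thesis using \<kappa>_ge[OF e _ a(2)] by fastforce
  qed
  \<comment> \<open>Hahn decomposition of \<open>\<rho>\<close> minus \<open>s\<close> times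
    evaluation at \<open>x\<close>: on the positive side \<open>no_ac\<close> forces
    \<open>a x = 0\<close>; on the other, \<open>\<rho> (e - a)\<close> is at most
    \<open>\<eta> / 2 + s * e x\<close>, which \<open>s\<close> keeps below
    \<open>\<eta>\<close>.\<close>
  have singular: "\<exists>a. dual_le 0 a \<and> dual_le a e \<and> blinfun_apply a x = 0 \<and> \<rho> (e - a) \<le> \<eta>"
    if x: "0 \<le> x" and \<eta>: "0 < \<eta>" for x \<eta>
  proof -
    have ex: "0 \<le> e x" using dual_posD[OF e x] .
    define s where "s = \<eta> / (2 * (e x + 1))"
    have s: "0 < s" "s * e x \<le> \<eta> / 2" using \<eta> ex by (auto simp: s_def field_simps)
    obtain a where a: "dual_le 0 a" "dual_le a e" "\<And>b. dual_le 0 b \<Longrightarrow> dual_le b a \<Longrightarrow> 0 \<le> (\<rho> - ev (s *\<^sub>R x)) b"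
      "(\<rho> - ev (s *\<^sub>R x)) (e - a) \<le> \<eta> / 2"
      using hahn_decomposition_approx[OF oc e, of "\<eta>/2" "\<rho> - ev (s *\<^sub>R x)"] \<eta> by (metis half_gt_zero)
    have "blinfun_apply b (s *\<^sub>R x) \<le> \<rho> b" if "dual_le 0 b" "dual_le b a" for b
      using a(3)[OF that] by (simp add: blinfun.diff_left)
    then have "a (s *\<^sub>R x) \<le> 0" using no_ac[of "s *\<^sub>R x" a] a(1,2) scale_nonneg[OF x] s(1) by auto
    then have "a x \<le> 0" using s(1) by (simp add: blinfun.scaleR_right mult_le_0_iff)
    then have "a x = 0" using dual_posD[OF a(1) x] by simp
    moreover have "\<rho> (e - a) \<le> \<eta>"
      using a(4) s \<open>a x = 0\<close> by (simp add: blinfun.bilinear_simps)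
    ultimately show ?thesis using a(1,2) by blast
  qed
  \<comment> \<open>The component of \<open>e\<close> in the ideal of functionals vanishing at
    \<open>x\<close> lies above all these \<open>a\<close>, which removes the error
    \<open>\<eta>\<close>.\<close>
  have singular0: "\<exists>c. dual_le 0 c \<and> dual_le c e \<and> blinfun_apply c x = 0 \<and> \<rho> (e - c) = 0" if x: "0 \<le> x" for x
  proof -
    obtain c where c: "dual_le 0 c" "dual_le c e"
      "\<forall>a\<in>{a. dual_le 0 a \<and> blinfun_apply a x = 0}. dual_le a e \<longrightarrow> dual_le a c"
      "\<forall>y \<eta>. 0 \<le> y \<longrightarrow> 0 < \<eta> \<longrightarrow> (\<exists>a\<in>{a. dual_le 0 a \<and> blinfun_apply a x = 0}. dual_le a e \<and> c y - \<eta> < blinfun_apply a y)"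
      using ideal_component[OF dual_ideal_null[OF x] e] by blast
    have "c x \<le> 0"
    proof (rule field_le_epsilon)
      fix \<eta> :: real assume "0 < \<eta>"
      then show "c x \<le> 0 + \<eta>" using c(4) x by fastforce
    qed
    moreover have "\<rho> (e - c) \<le> 0"
    proof (rule field_le_epsilon)
      fix \<eta> :: real assume "0 < \<eta>"
      then obtain a where a: "dual_le 0 a" "dual_le a e" "blinfun_apply a x = 0" "\<rho> (e - a) \<le> \<eta>"
        using singular[OF x] by blast
      then have "dual_le (e - c) (e - a)" using c(3) by (simp add: dual_le_def blinfun.bilinear_simps)
      then show "\<rho> (e - c) \<le> 0 + \<eta>" using bidual_mono[OF \<rho>_nn] a(4) by fastforce
    qed
    ultimately show ?thesis using c(1,2) dual_posD[OF c(1) x] \<rho>_nn[of "e - c"] by (intro exI[of _ c]) simp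
  qed
  \<comment> \<open>\<open>D\<close> is closed under binary infima, and its infimum is 0 because
    every positive \<open>x\<close> is annihilated by a member. Order continuity gives members
    \<open>d\<close> of small norm, while \<open>\<rho> d = \<rho> e\<close>.\<close>
  define D where "D = {c. dual_le 0 c \<and> dual_le c e \<and> \<rho> (e - c) = 0}"
  have "downward_directed dual_le D"
    unfolding downward_directed_def
  proof (intro conjI ballI)
    have "e \<in> D" using e by (simp add: D_def blinfun.bilinear_simps)
    then show "D \<noteq> {}" by blast
    fix c d assume cd: "c \<in> D" "d \<in> D"
    let ?w = "c - E.pp (c - d)"
    have "dual_le (E.pp (c - d)) c"
      by (rule pos_part_least) (use cd in \<open>auto simp: D_def dual_le_def blinfun.bilinear_simps\<close>)
    then have w: "dual_le 0 ?w" by simp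
    have wc: "dual_le ?w c" using pos_part_nonneg[of "c - d"] by (simp add: dual_le_def blinfun.bilinear_simps)
    have wd: "dual_le ?w d" using pos_part_ge[of "c - d"] by (simp add: dual_le_def blinfun.bilinear_simps algebra_simps)
    have "dual_le (E.pp (c - d)) (e - d)"
      by (rule pos_part_least) (use cd in \<open>auto simp: D_def dual_le_def blinfun.bilinear_simps\<close>)
    then have "\<rho> (E.pp (c - d)) \<le> \<rho> (e - d)" using bidual_mono[OF \<rho>_nn] by blast
    then have "\<rho> (E.pp (c - d)) = 0" using \<rho>_nn[OF pos_part_nonneg[of "c - d"]] cd by (simp add: D_def)
    then have "\<rho> (e - ?w) = 0" using cd by (simp add: D_def blinfun.bilinear_simps)
    then have "?w \<in> D" using w wc cd dual_le_trans by (auto simp: D_def)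
    then show "\<exists>w\<in>D. dual_le w c \<and> dual_le w d" using wc wd by blast
  qed
  moreover have "is_glb dual_le D 0"
    unfolding is_glb_def
  proof (intro conjI ballI allI impI)
    show "dual_le 0 d" if "d \<in> D" for d using that by (simp add: D_def)
    fix w assume w: "\<forall>d\<in>D. dual_le w d"
    show "dual_le w 0"
      unfolding dual_le_def
    proof (intro allI impI)
      fix x :: 'a assume x: "0 \<le> x"
      then obtain c where "c \<in> D" "blinfun_apply c x = 0" using singular0[OF x] by (auto simp: D_def)
      then show "w x \<le> blinfun_apply 0 x" using w dual_leD[of w c x] x by simp
    qed
  qed
  ultimately have D_small: "\<exists>d\<in>D. norm d < \<eta>" if "0 < \<eta>" for \<eta>
    using oc_approx[OF oc] that by blast
  have "\<rho> e \<le> 0"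
  proof (rule field_le_epsilon)
    fix \<eta> :: real assume \<eta>: "0 < \<eta>"
    then have "0 < \<eta> / (norm \<rho> + 1)" by (simp add: add_nonneg_pos)
    then obtain d where d: "d \<in> D" "norm d < \<eta> / (norm \<rho> + 1)" using D_small by blast
    have "\<rho> e = \<rho> d" using d(1) by (simp add: D_def blinfun.bilinear_simps)
    also have "\<dots> \<le> norm \<rho> * norm d" using norm_blinfun[of \<rho> d] by simp
    also have "\<dots> \<le> (norm \<rho> + 1) * (\<eta> / (norm \<rho> + 1))" using d(2) by (intro mult_mono) auto
    also have "\<dots> = \<eta>" using add_nonneg_pos[of "norm \<rho>" 1] by simp
    finally show "\<rho> e \<le> 0 + \<eta>" by simp
  qed
  then have \<rho>e: "\<rho> e = 0" using \<rho>_nn[OF e] by simp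
  have "\<rho> (fs n) = 0" for n
  proof -
    obtain C where "0 \<le> C" "dual_le (dabs (fs n)) (C *\<^sub>R e)" using dom by blast
    then have "\<rho> (dabs (fs n)) \<le> 0" using bidual_mono[OF \<rho>_nn] \<rho>e by (fastforce simp: blinfun.scaleR_right)
    then show ?thesis using abs_le[OF \<rho>_nn, of n] by simp
  qed
  then show ?thesis using R_lim[OF R_\<rho> e] by (simp add: blinfun.bilinear_simps)
qed

subsection \<open>Disjoint extraction\<close>

lemma dual_term_le_suminf:
  fixes g :: "nat \<Rightarrow> ('a \<Rightarrow>\<^sub>L real)"
  assumes "summable g" "\<And>n. dual_le 0 (g n)"
  shows "dual_le (g n) (suminf g)"
  unfolding dual_le_def
proof (intro allI impI)
  fix x :: 'a assume x: "0 \<le> x"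
  have lin: "bounded_linear (\<lambda>f. blinfun_apply f x)" by (rule blinfun.bounded_linear_left)
  have "sum (\<lambda>n. g n x) {n} \<le> (\<Sum>n. g n x)"
    by (rule sum_le_suminf[OF bounded_linear.summable[OF lin assms(1)]]) (use dual_posD[OF assms(2) x] in auto)
  then show "g n x \<le> suminf g x"
    using bounded_linear.suminf[OF lin assms(1)] by simp
qed

lemma summable_geometric_dual:
  fixes a :: "nat \<Rightarrow> ('a \<Rightarrow>\<^sub>L real)"
  assumes "\<And>n. norm (a n) \<le> B"
  shows "summable (\<lambda>n. (1 / 2) ^ n *\<^sub>R a n)"
proof (rule summable_comparison_test)
  show "\<exists>N. \<forall>n\<ge>N. norm ((1 / 2) ^ n *\<^sub>R a n) \<le> (1 / 2) ^ n * B"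
    by (rule exI[of _ 0]) (simp add: assms divide_right_mono power_one_over)
  show "summable (\<lambda>n. (1 / 2 :: real) ^ n * B)"
    by (intro summable_mult2 summable_geometric) simp
qed

text \<open>From each chosen term subtract a large multiple of the earlier terms and a small
  multiple of \<open>X\<close>, which dominates multiples of all chosen terms. For
  \<open>i < j\<close> the survivors lie below opposite parts of
  \<open>x j - 2 ^ (i + j) *\<^sub>R x i\<close>. The first subtraction is absorbed by
  \<open>bad\<close>, the second costs \<open>\<phi> X / 2 ^ j\<close>.\<close>

lemma disjoint_extraction:
  fixes a :: "nat \<Rightarrow> ('a \<Rightarrow>\<^sub>L real)" and \<phi> :: "('a \<Rightarrow>\<^sub>L real) \<Rightarrow>\<^sub>L real"
  assumes a: "\<And>n. dual_le 0 (a n)" "\<And>n. norm (a n) \<le> B"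
    and C: "\<And>n. 0 \<le> C n" "\<And>n. dual_le (a n) (C n *\<^sub>R e)"
    and \<phi>: "\<And>f. dual_le 0 f \<Longrightarrow> 0 \<le> \<phi> f" and \<epsilon>: "0 < \<epsilon>"
    and bad: "\<And>K. 0 \<le> K \<Longrightarrow> \<exists>n. \<epsilon> < \<phi> (E.pp (a n - K *\<^sub>R e))"
  obtains n u where "strict_mono (n :: nat \<Rightarrow> nat)" "\<And>j. dual_le 0 (u j)" "\<And>j. dual_le (u j) (a (n j))"
    "\<And>j. \<epsilon> / 2 \<le> \<phi> (u j)" "\<And>i j. i \<noteq> j \<Longrightarrow> E.disj (u i) (u j)"
proof -
  define s where "s n = (\<Sum>m\<le>n. a m)" for n
  have term_s: "dual_le (a m) (s n)" if "m \<le> n" for m n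
    unfolding dual_le_def s_def
  proof (intro allI impI)
    fix x :: 'a assume "0 \<le> x"
    then have "(\<Sum>i\<in>{m}. a i x) \<le> (\<Sum>i\<le>n. a i x)"
      using dual_posD[OF a(1)] that by (intro sum_mono2) auto
    then show "a m x \<le> (\<Sum>m\<le>n. a m) x" by (simp add: blinfun.sum_left)
  qed
  have s_nn: "dual_le 0 (s n)" for n using dual_le_trans[OF a(1) term_s[of 0 n]] by simp
  have s_e: "dual_le (s n) ((\<Sum>m\<le>n. C m) *\<^sub>R e)" for n
    unfolding dual_le_def s_def
  proof (intro allI impI)
    fix x :: 'a assume "0 \<le> x"
    then have "(\<Sum>i\<le>n. a i x) \<le> (\<Sum>i\<le>n. C i * e x)"
      using dual_leD[OF C(2)] by (intro sum_mono) (simp add: blinfun.scaleR_left)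
    then show "(\<Sum>m\<le>n. a m) x \<le> ((\<Sum>m\<le>n. C m) *\<^sub>R e) x"
      by (simp add: blinfun.sum_left blinfun.scaleR_left sum_distrib_right)
  qed
  have "\<exists>n. \<forall>j. True \<and> (n j < n (Suc j) \<and> \<epsilon> < \<phi> (E.pp (a (n (Suc j)) - 4 ^ Suc j *\<^sub>R s (n j))))"
  proof (rule dependent_nat_choice)
    fix n j :: nat
    \<comment> \<open>Chosen so that \<open>?K *\<^sub>R e\<close> dominates
      \<open>4 ^ Suc j *\<^sub>R s n\<close>.\<close>
    let ?K = "4 ^ Suc j * (\<Sum>m\<le>n. C m)"
    have "0 \<le> ?K" using C(1) by (intro mult_nonneg_nonneg sum_nonneg) auto
    then obtain n' where n': "\<epsilon> < \<phi> (E.pp (a n' - ?K *\<^sub>R e))" using bad by blast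
    have "dual_le (4 ^ Suc j *\<^sub>R s n) (?K *\<^sub>R e)" using dual_scale_mono[OF s_e[of n], of "4 ^ Suc j"] by simp
    then have "dual_le (a n' - ?K *\<^sub>R e) (a n' - 4 ^ Suc j *\<^sub>R s n)" by (simp add: dual_le_def blinfun.bilinear_simps)
    from bidual_mono[OF \<phi> pos_part_mono[OF this]] n'
    have big: "\<epsilon> < \<phi> (E.pp (a n' - 4 ^ Suc j *\<^sub>R s n))" by simp
    have "n < n'"
    proof (rule ccontr)
      assume "\<not> n < n'"
      then have "dual_le (a n') (s n)" using term_s by simp
      moreover have "dual_le (s n) (4 ^ Suc j *\<^sub>R s n)"
      proof -
        have "1 * s n x \<le> 4 ^ Suc j * s n x" if "0 \<le> x" for x
          using dual_posD[OF s_nn that] by (intro mult_right_mono one_le_power) auto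
        then show ?thesis by (simp add: dual_le_def blinfun.scaleR_left)
      qed
      ultimately have "dual_le (a n' - 4 ^ Suc j *\<^sub>R s n) 0"
        using dual_le_trans by (fastforce simp: dual_le_def blinfun.bilinear_simps)
      then have "dual_le (E.pp (a n' - 4 ^ Suc j *\<^sub>R s n)) 0" by (rule pos_part_least[OF dual_le_refl])
      from bidual_mono[OF \<phi> this] big \<epsilon> show False by simp
    qed
    then show "\<exists>n'. True \<and> (n < n' \<and> \<epsilon> < \<phi> (E.pp (a n' - 4 ^ Suc j *\<^sub>R s n)))" using big by blast
  qed simp
  then obtain n where n: "\<And>j. n j < n (Suc j)" "\<And>j. \<epsilon> < \<phi> (E.pp (a (n (Suc j)) - 4 ^ Suc j *\<^sub>R s (n j)))"
    by blast
  have mono: "strict_mono n" using n(1) by (simp add: strict_mono_Suc_iff)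
  define x where "x j = a (n (Suc j))" for j
  define X where "X = (\<Sum>j. (1 / 2) ^ j *\<^sub>R x j)"
  have sumX: "summable (\<lambda>j. (1 / 2) ^ j *\<^sub>R x j)"
    by (rule summable_geometric_dual[of _ B]) (simp add: x_def a(2))
  have x_nn: "dual_le 0 (x j)" for j by (simp add: x_def a(1))
  have x_X: "dual_le ((1 / 2) ^ j *\<^sub>R x j) X" for j
    unfolding X_def by (rule dual_term_le_suminf[OF sumX]) (simp add: dual_scale_nonneg x_nn)
  have X_nn: "dual_le 0 X" using dual_le_trans[OF _ x_X[of 0]] x_nn[of 0] by simp
  define u where "u j = E.pp (x j - 4 ^ Suc j *\<^sub>R s (n j) - (1 / 2) ^ j *\<^sub>R X)" for j
  have u_mass: "\<epsilon> - (1 / 2) ^ j * \<phi> X \<le> \<phi> (u j)" for j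
  proof -
    let ?g = "x j - 4 ^ Suc j *\<^sub>R s (n j)" and ?h = "(1 / 2) ^ j *\<^sub>R X"
    have "dual_le (E.pp ?g) (E.pp (?g - ?h) + ?h)"
    proof (rule pos_part_least)
      show "dual_le 0 (E.pp (?g - ?h) + ?h)"
        using dual_add_mono[OF pos_part_nonneg dual_scale_nonneg[OF X_nn]] by fastforce
      show "dual_le ?g (E.pp (?g - ?h) + ?h)"
        using pos_part_ge[of "?g - ?h"] by (simp add: dual_le_def blinfun.bilinear_simps algebra_simps)
    qed
    from bidual_mono[OF \<phi> this] have "\<phi> (E.pp ?g) \<le> \<phi> (u j) + (1 / 2) ^ j * \<phi> X"
      by (simp add: u_def blinfun.add_right blinfun.scaleR_right)
    then show ?thesis using n(2)[of j] by (simp add: x_def)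
  qed
  have u_x: "dual_le (u j) (x j)" for j
    unfolding u_def
  proof (rule pos_part_least[OF x_nn])
    have "dual_le 0 (4 ^ Suc j *\<^sub>R s (n j))" "dual_le 0 ((1 / 2) ^ j *\<^sub>R X)"
      using s_nn X_nn by (auto intro!: dual_scale_nonneg)
    from dual_add_mono[OF this]
    show "dual_le (x j - 4 ^ Suc j *\<^sub>R s (n j) - (1 / 2) ^ j *\<^sub>R X) (x j)"
      unfolding dual_le_def blinfun.diff_left blinfun.add_left by force
  qed
  have u_disj: "E.disj (u j) (u i)" if ij: "i < j" for i j
  proof -
    \<comment> \<open>\<open>l\<close> combines the weight \<open>(1 / 2) ^ i\<close> of
      \<open>X\<close> in \<open>u i\<close> with the weight \<open>(1 / 2) ^ j\<close> of
      \<open>x j\<close> in \<open>X\<close>; \<open>4 ^ Suc j\<close> exceeds it for every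
      \<open>i < j\<close>.\<close>
    define l :: real where "l = 2 ^ (i + j)"
    have l: "1 \<le> l" by (simp add: l_def)
    have l4: "l \<le> 4 ^ Suc j"
    proof -
      have "l \<le> 2 ^ (2 * Suc j)" unfolding l_def using ij by (intro power_increasing) auto
      then show ?thesis by (simp only: power_mult) simp
    qed
    let ?g = "x j - l *\<^sub>R x i"
    have xs: "dual_le (x i) (s (n j))"
      unfolding x_def by (rule term_s) (use ij mono in \<open>simp add: strict_mono_less_eq Suc_leI\<close>)
    have 1: "dual_le (u j) (E.pp ?g)"
      unfolding u_def
    proof (rule pos_part_mono)
      have "(l *\<^sub>R x i) y \<le> (4 ^ Suc j *\<^sub>R s (n j)) y" if "0 \<le> y" for y
        using dual_leD[OF xs that] dual_posD[OF x_nn that] l l4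
        by (simp only: blinfun.scaleR_left real_scaleR_def) (intro mult_mono, auto)
      moreover have "0 \<le> ((1 / 2) ^ j *\<^sub>R X) y" if "0 \<le> y" for y
        using dual_posD[OF X_nn that] by (simp add: blinfun.scaleR_left)
      ultimately have "x j y - (4 ^ Suc j *\<^sub>R s (n j)) y - ((1 / 2) ^ j *\<^sub>R X) y \<le> x j y - (l *\<^sub>R x i) y"
        if "0 \<le> y" for y using that by (smt (verit))
      then show "dual_le (x j - 4 ^ Suc j *\<^sub>R s (n j) - (1 / 2) ^ j *\<^sub>R X) ?g"
        unfolding dual_le_def blinfun.diff_left by blast
    qed
    have 2: "dual_le (u i) (E.pp (- ?g))"
      unfolding u_def
    proof (rule pos_part_least[OF pos_part_nonneg])
      have "(x i - 4 ^ Suc i *\<^sub>R s (n i) - (1 / 2) ^ i *\<^sub>R X) y \<le> E.pp (- ?g) y" if y: "0 \<le> y" for y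
      proof -
        have X1: "(1 / 2) ^ j * x j y \<le> X y" using dual_leD[OF x_X[of j] y] by (simp add: blinfun.scaleR_left)
        have "(1 / 2) ^ i * ((1 / 2) ^ j * x j y) \<le> (1 / 2) ^ i * X y" by (rule mult_left_mono[OF X1]) simp
        then have X2: "x j y / l \<le> (1 / 2) ^ i * X y"
          by (simp add: l_def power_add power_one_over field_simps)
        have "x i y - x j y / l = (l * x i y - x j y) / l" using l by (simp add: field_simps)
        also have "\<dots> \<le> E.pp (- ?g) y / l"
          using dual_leD[OF pos_part_ge[of "- ?g"] y] l by (intro divide_right_mono) (auto simp: blinfun.bilinear_simps)
        also have "\<dots> \<le> E.pp (- ?g) y"
          using dual_posD[OF pos_part_nonneg[of "- ?g"] y] l by (simp add: divide_le_eq mult_le_cancel_left1)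
        finally have "x i y - x j y / l \<le> E.pp (- ?g) y" .
        moreover have "0 \<le> 4 ^ Suc i * s (n i) y" using dual_posD[OF s_nn y] by simp
        ultimately show ?thesis using X2 unfolding blinfun.diff_left blinfun.scaleR_left real_scaleR_def by linarith
      qed
      then show "dual_le (x i - 4 ^ Suc i *\<^sub>R s (n i) - (1 / 2) ^ i *\<^sub>R X) (E.pp (- ?g))"
        by (simp add: dual_le_def)
    qed
    show ?thesis by (rule E.disj_mono[OF E.disj_pp[of ?g]]) (use 1 2 in \<open>auto simp: dual_le_def\<close>)
  qed
  have "(\<lambda>j. (1 / 2) ^ j * \<phi> X) \<longlonglongrightarrow> 0 * \<phi> X"
    by (intro tendsto_mult LIMSEQ_realpow_zero tendsto_const) auto
  then obtain N where N: "\<And>j. j \<ge> N \<Longrightarrow> \<bar>(1 / 2) ^ j * \<phi> X\<bar> < \<epsilon> / 2"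
    using LIMSEQ_D[of "\<lambda>j. (1 / 2) ^ j * \<phi> X" 0 "\<epsilon> / 2"] \<epsilon> by auto
  show thesis
  proof (rule that[of "\<lambda>j. n (Suc (j + N))" "\<lambda>j. u (j + N)"])
    show "strict_mono (\<lambda>j. n (Suc (j + N)))" using mono by (simp add: strict_mono_def)
    show "dual_le 0 (u (j + N))" for j by (simp add: u_def pos_part_nonneg)
    show "dual_le (u (j + N)) (a (n (Suc (j + N))))" for j using u_x[of "j + N"] by (simp add: x_def)
    show "\<epsilon> / 2 \<le> \<phi> (u (j + N))" for j using u_mass[of "j + N"] N[of "j + N"] by linarith
    show "E.disj (u (i + N)) (u (j + N))" if "i \<noteq> j" for i j
      using u_disj[of "i + N" "j + N"] u_disj[of "j + N" "i + N"] that E.disj_commute by (metis add_less_cancel_right nat_neq_iff)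
  qed
qed

end

theorem theorem4p3:
  fixes u0 :: "'a::{banach, lattice, ordered_ab_group_add}"
    and G :: "('a \<Rightarrow>\<^sub>L 'a) set"
  assumes BL: "banach_lattice TYPE('a)"
    and interp: "sigma_interpolation TYPE('a)"
    and dual_oc: "order_continuous_norm (dual_le :: ('a \<Rightarrow>\<^sub>L real) \<Rightarrow> _ \<Rightarrow> bool)"
    and u0_pos: "0 \<le> u0"
    and G_pos: "\<forall>T\<in>G. positive_op T"
    and G_adj: "\<forall>T\<in>G. lattice_hom dual_le (adjoint_op T)"
    and cond_a: "\<forall>x. 0 \<le> x \<longrightarrow> (\<exists>T\<in>G. x \<le> norm x *\<^sub>R blinfun_apply T u0)"
    and cond_b: "\<forall>(xs :: nat \<Rightarrow> 'a) (Ts :: nat \<Rightarrow> ('a \<Rightarrow>\<^sub>L 'a)).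
          (\<forall>n. 0 \<le> xs n \<and> xs n \<le> u0) \<and>
          (\<forall>m n. m \<noteq> n \<longrightarrow> inf (labs (xs m)) (labs (xs n)) = 0) \<and>
          (\<forall>n. Ts n \<in> G)
          \<longrightarrow> (\<exists>v. 0 \<le> v \<and> (\<forall>n. blinfun_apply (Ts n) (xs n) \<le> v))"
  shows "grothendieck TYPE('a)"
proof -
  interpret banach_lattice_space "TYPE('a)" by unfold_locales (rule BL)
  have main: "(\<lambda>n. \<phi> (gs n)) \<longlonglongrightarrow> 0"
    if null: "\<And>x. (\<lambda>n. blinfun_apply (gs n) x) \<longlonglongrightarrow> 0"
    for gs :: "nat \<Rightarrow> ('a \<Rightarrow>\<^sub>L real)" and \<phi> :: "('a \<Rightarrow>\<^sub>L real) \<Rightarrow>\<^sub>L real"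
  proof -
    obtain B where B: "\<And>n. norm (gs n) \<le> B"
      using uniform_boundedness[of gs "\<lambda>_. 0"] null by blast
    define a where "a n = dabs (gs n)" for n
    have a_nn: "dual_le 0 (a n)" for n by (simp add: a_def dabs_nonneg)
    have a_bd: "norm (a n) \<le> 2 * B" for n using norm_dabs[of "gs n"] B[of n] by (simp add: a_def)
    define e where "e = (\<Sum>n. (1 / 2) ^ n *\<^sub>R a n)"
    have term_e: "dual_le ((1 / 2) ^ n *\<^sub>R a n) e" for n
      unfolding e_def
      by (rule dual_term_le_suminf[OF summable_geometric_dual[OF a_bd]]) (simp add: dual_scale_nonneg a_nn)
    have e_nn: "dual_le 0 e" using dual_le_trans[OF _ term_e[of 0]] a_nn[of 0] by simp
    have dom: "dual_le (a n) (2 ^ n *\<^sub>R e)" for n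
      using dual_scale_mono[OF term_e[of n], of "2 ^ n"] by (simp add: power_one_over)
    have equi: "\<exists>K\<ge>0. \<forall>n. \<psi> (E.pp (a n - K *\<^sub>R e)) \<le> \<epsilon>"
      if \<psi>: "\<And>f. dual_le 0 f \<Longrightarrow> 0 \<le> blinfun_apply \<psi> f" and \<epsilon>: "0 < \<epsilon>"
      for \<psi> :: "('a \<Rightarrow>\<^sub>L real) \<Rightarrow>\<^sub>L real" and \<epsilon> :: real
    proof (rule ccontr)
      assume "\<not> ?thesis"
      then have bad: "\<exists>n. \<epsilon> < \<psi> (E.pp (a n - K *\<^sub>R e))" if "0 \<le> K" for K
        using that by (meson not_le)
      obtain n :: "nat \<Rightarrow> nat" and u where nu: "strict_mono n" "\<And>j. dual_le 0 (u j)" "\<And>j. dual_le (u j) (a (n j))"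
        "\<And>j. \<epsilon> / 2 \<le> \<psi> (u j)" "\<And>i j. i \<noteq> j \<Longrightarrow> E.disj (u i) (u j)"
      proof (rule disjoint_extraction[where C = "\<lambda>n. 2 ^ n" and a = a and e = e and \<phi> = \<psi> and \<epsilon> = \<epsilon>])
        show "\<exists>n. \<epsilon> < \<psi> (E.pp (a n - K *\<^sub>R e))" if "0 \<le> K" for K by (rule bad[OF that])
        show "0 \<le> blinfun_apply \<psi> f" if "dual_le 0 f" for f by (rule \<psi>[OF that])
        show "norm (a n) \<le> 2 * B" for n by (rule a_bd)
      qed (rule a_nn, simp, rule dom, rule \<epsilon>, rule that)
      have \<psi>0: "\<psi> \<noteq> 0" using nu(4)[of 0] \<epsilon> by auto
      \<comment> \<open>The constant of \<open>finite_goldstine\<close> at the level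
        \<open>\<epsilon> / 2\<close> left by the extraction.\<close>
      define \<delta> where "\<delta> = (\<epsilon> / 2) / (8 * norm \<psi>)"
      have \<delta>: "0 < \<delta>" using \<epsilon> \<psi>0 by (simp add: \<delta>_def)
      have "\<exists>T\<in>G. \<forall>i<N. \<delta> \<le> u i (blinfun_apply T u0)" for N
      proof -
        obtain x where x: "norm x \<le> 1" "\<And>i. i < N \<Longrightarrow> \<delta> \<le> u i x"
          using finite_goldstine[of "\<epsilon> / 2" N \<psi> u] nu(4) \<epsilon> \<psi>0 by (auto simp: \<delta>_def)
        \<comment> \<open>Condition (a) needs a positive vector: \<open>labs x\<close> dominates
          \<open>x\<close> and has the same norm, at most 1.\<close>
        obtain T where T: "T \<in> G" "labs x \<le> norm (labs x) *\<^sub>R blinfun_apply T u0"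
          using cond_a labs_nonneg by blast
        have "0 \<le> blinfun_apply T u0" using G_pos T(1) u0_pos by (simp add: positive_op_def)
        then have "norm (labs x) *\<^sub>R blinfun_apply T u0 \<le> 1 *\<^sub>R blinfun_apply T u0"
          using x(1) by (intro scale_right_mono) (auto simp: norm_labs)
        moreover have "x \<le> labs x" by (simp add: labs_def)
        ultimately have "x \<le> blinfun_apply T u0" using T(2) by simp
        then have "u i x \<le> u i (blinfun_apply T u0)" for i by (rule dual_pos_mono[OF nu(2)])
        then show ?thesis using x(2) T(1) order_trans by blast
      qed
      then obtain T where T: "\<And>N. T N \<in> G" "\<And>N i. i < N \<Longrightarrow> \<delta> \<le> u i (blinfun_apply (T N) u0)" by metis
      obtain i N :: "nat \<Rightarrow> nat" and y where y: "strict_mono i" "\<And>k. i k < N k" "\<And>k. 0 \<le> y k" "\<And>k. y k \<le> u0"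
        "\<And>k. \<delta> / 2 \<le> adjoint_op (T (N k)) (u (i k)) (y k)" "\<And>k l. k \<noteq> l \<Longrightarrow> inf (y k) (y l) = 0"
      proof (rule disjoint_selection[OF u0_pos \<delta>, where \<mu> = "\<lambda>N i. adjoint_op (T N) (u i)"])
        fix N i j
        show "dual_le 0 (adjoint_op (T N) (u i))"
          using nu(2)[of i] G_pos T(1)[of N] by (simp add: dual_le_def adjoint_op_def positive_op_def)
        show "\<delta> \<le> adjoint_op (T N) (u i) u0" if "i < N"
          using T(2)[OF that] by (simp add: adjoint_op_def)
        show "E.disj (adjoint_op (T N) (u i)) (adjoint_op (T N) (u j))" if "i \<noteq> j"
          using adjoint_preserves_disj[of "T N" "u i" "u j"] G_adj T(1) nu(2) nu(5)[OF that] by blast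
      qed (rule that)
      have "\<exists>v. 0 \<le> v \<and> (\<forall>k. blinfun_apply (T (N k)) (y k) \<le> v)"
        using cond_b[rule_format, of y "\<lambda>k. T (N k)"] y T(1) by (simp add: labs_of_nonneg)
      then obtain v where v: "0 \<le> v" "\<And>k. blinfun_apply (T (N k)) (y k) \<le> v" by blast
      have mass: "\<delta> / 2 \<le> u (i k) v" for k
        using y(5)[of k] dual_pos_mono[OF nu(2)[of "i k"] v(2)[of k]] by (simp add: adjoint_op_def)
      have \<delta>2: "0 < \<delta> / 2" using \<delta> by simp
      have i_inj: "i k \<noteq> i l" if "k \<noteq> l" for k l using y(1) that by (simp add: strict_mono_eq)
      \<comment> \<open>This array does not depend on its row: with the common bound
        \<open>v\<close> in hand, the operators have disappeared and the \<open>u (i k)\<close>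
        themselves are used.\<close>
      obtain k M :: "nat \<Rightarrow> nat" and z where z: "strict_mono k" "\<And>l. k l < M l" "\<And>l. 0 \<le> z l" "\<And>l. z l \<le> v"
        "\<And>l. \<delta> / 2 / 2 \<le> u (i (k l)) (z l)" "\<And>l m. l \<noteq> m \<Longrightarrow> inf (z l) (z m) = 0"
      proof (rule disjoint_selection[OF v(1) \<delta>2, where \<mu> = "\<lambda>N k. u (i k)"])
        show "dual_le 0 (u (i k))" "\<delta> / 2 \<le> u (i k) v" for k by (rule nu(2), rule mass)
        show "E.disj (u (i k)) (u (i l))" if "k \<noteq> l" for k l by (rule nu(5)[OF i_inj[OF that]])
      qed (rule that)
      \<comment> \<open>The modulus of \<open>gs (p l)\<close> dominates \<open>u (i (k l))\<close>
        and inherits its lower bound at \<open>z l\<close>; \<open>p\<close> is increasing, so the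
        subsequence is still weak* null.\<close>
      define p where "p l = n (i (k l))" for l
      have p: "strict_mono p" using nu(1) y(1) z(1) by (simp add: p_def strict_mono_def)
      show False
      proof (rule weak_star_null_on_disjoint[OF interp, of "\<lambda>l. gs (p l)" z v "\<delta> / 2 / 2"])
        show "(\<lambda>l. gs (p l) x) \<longlonglongrightarrow> 0" for x
          using LIMSEQ_subseq_LIMSEQ[OF null p] by (simp add: o_def)
        show "\<delta> / 2 / 2 \<le> dabs (gs (p l)) (z l)" for l
          using z(5)[of l] dual_leD[OF nu(3)[of "i (k l)"] z(3)[of l]] by (simp add: p_def a_def)
      qed (use z \<delta> in auto)
    qed
    have pos: "(\<lambda>n. \<psi> (gs n)) \<longlonglongrightarrow> 0" if "\<And>f. dual_le 0 f \<Longrightarrow> 0 \<le> blinfun_apply \<psi> f"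
      for \<psi> :: "('a \<Rightarrow>\<^sub>L real) \<Rightarrow>\<^sub>L real"
    proof (rule weakly_null_of_equi_integrable[OF dual_oc null e_nn])
      show "\<exists>C\<ge>0. dual_le (dabs (gs n)) (C *\<^sub>R e)" for n
        using dom[of n] by (intro exI[of _ "2 ^ n"]) (simp add: a_def)
      show "\<exists>K\<ge>0. \<forall>n. \<psi>' (E.pp (dabs (gs n) - K *\<^sub>R e)) \<le> \<eta>"
        if "\<And>f. dual_le 0 f \<Longrightarrow> 0 \<le> blinfun_apply \<psi>' f" "0 < \<eta>" for \<psi>' :: "('a \<Rightarrow>\<^sub>L real) \<Rightarrow>\<^sub>L real" and \<eta>
        using equi[OF that] by (simp add: a_def)
    qed (rule that)
    \<comment> \<open>Positive functionals suffice, since \<open>\<phi>\<close> is the difference of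
      its parts in the bidual.\<close>
    have "(\<lambda>n. F.pp \<phi> (gs n) - F.pp (- \<phi>) (gs n)) \<longlonglongrightarrow> 0 - 0"
      by (intro tendsto_diff pos) (use F.pp_nonneg in auto)
    then show ?thesis by (simp add: F.pp_uminus blinfun.diff_left)
  qed
  show ?thesis
    unfolding grothendieck_def
  proof (intro allI impI)
    fix fs :: "nat \<Rightarrow> ('a \<Rightarrow>\<^sub>L real)" and f and \<phi> :: "('a \<Rightarrow>\<^sub>L real) \<Rightarrow>\<^sub>L real"
    assume "\<forall>x. (\<lambda>n. blinfun_apply (fs n) x) \<longlonglongrightarrow> blinfun_apply f x"
    then have lim: "(\<lambda>n. blinfun_apply (fs n - f) x) \<longlonglongrightarrow> 0" for x
      using tendsto_diff[of "\<lambda>n. fs n x" "f x" sequentially "\<lambda>_. f x" "f x"] by (simp add: blinfun.diff_left)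
    from main[OF lim, of \<phi>] show "(\<lambda>n. blinfun_apply \<phi> (fs n)) \<longlonglongrightarrow> blinfun_apply \<phi> f"
      by (simp add: blinfun.diff_right LIM_zero_iff)
  qed
qed

end
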